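(* Let $k\ge 0$ be an integer and let $T\subset\mathbb R^3$ be a polyhedron. Then $$\mathbf P_{\mathbf{curl},T}^k(\underline{\mathbf I}_{\mathbf{curl},T}^k\mathbf v)=\mathbf v\qquad\forall\mathbf v\in\mathcal P^k(T)^3.$$
   Context: Geometry. A polyhedron $T$ is a connected set that is the interior of a finite union of tetrahedra; $T$ is assumed simply connected with connected Lipschitz-continuous boundary. $\mathcal F_T$, $\mathcal E_T$ are its sets of planar polygonal faces and edges; $\partial^2T=\bigcup_{E\in\mathcal E_T}\overline E$; each edge is shared by exactly two faces. Each face $F$ is a polygon (connected interior, in its plane, of a finite union of triangles), simply connected with connected Lipschitz boundary, with edges $\mathcal E_F$ and a fixed unit normal $\mathbf n_F$; $\omega_{TF}=1$ if $\mathbf n_F$ points out of $T$, $-1$ otherwise. Tangent fields on $F$ are regarded as $\mathbb R^2$-valued. Each edge $E$ has a fixed unit tangent $\mathbf t_E$. $\partial F$ is oriented counter-clockwise with respect to $\mathbf n_F$ and $\omega_{FE}=1$ if $\mathbf t_E$ is opposite to the orientation of $\partial F$, $-1$ otherwise. Polynomials. $\mathcal P^\ell(X)$: restrictions to $X$ (edge, face, polyhedron) of polynomials of total degree $\le\ell$, $\mathcal P^{-1}(X)=\{0\}$; $\mathcal P^{0,\ell}(X)$: its zero-average subspace; $\pi_{\mathcal P,X}^\ell$: $L^2$-orthogonal projector on $\mathcal P^\ell(X)$. $\mathcal P^\ell(\mathcal E_T)$, $\mathcal P^\ell(\mathcal E_F)$: functions on $\partial^2T$, $\partial F$ that are in $\mathcal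 P^\ell$ on each edge, without continuity. $\mathbf{grad}_F$: tangential gradient on $F$; $\mathbf{rot}_Fr=\varrho_{-\pi/2}(\mathbf{grad}_Fr)$ with $\varrho_{-\pi/2}$ the rotation of angle $-\pi/2$ in the oriented plane of $F$. $\boldsymbol{\mathcal R}^\ell(F)=\mathbf{rot}_F\mathcal P^{\ell+1}(F)$, $\boldsymbol{\mathcal R}^\ell(T)=\mathbf{curl}\,\mathcal P^{\ell+1}(T)^3$, $\boldsymbol{\mathcal G}^\ell(T)=\mathbf{grad}\,\mathcal P^{\ell+1}(T)$; $\boldsymbol{\mathcal R}^\ell(F)^\perp$, $\boldsymbol{\mathcal R}^\ell(T)^\perp$, $\boldsymbol{\mathcal G}^\ell(T)^\perp$ are their $L^2$-orthogonal complements in $\mathcal P^\ell(F)^2$, $\mathcal P^\ell(T)^3$, $\mathcal P^\ell(T)^3$. The $L^2$-orthogonal projectors on $\boldsymbol{\mathcal R}^\ell(X)$ and $\boldsymbol{\mathcal R}^\ell(X)^\perp$ ($X=F,T$) are $\boldsymbol\pi_{\mathcal R,X}^\ell$ and $\boldsymbol\pi_{\mathcal R,X}^{\perp,\ell}$. Space and interpolator. $\underline{\mathbf X}_{\mathbf{curl},T}^k=\big(\boldsymbol{\mathcal R}^{k-1}(T)\oplus\boldsymbol{\mathcal R}^k(T)^\perp\big)\times\prod_{F\in\mathcal F_T}\big(\boldsymbol{\mathcal R}^{k-1}(F)\oplus\boldsymbol{\mathcal R}^k(F)^\perp\big)\times\mathcal P^k(\mathcal E_T)$, elements $\underline{\mathbf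 v}_T=(\mathbf v_T=\mathbf v_{\mathcal R,T}+\mathbf v_{\mathcal R,T}^\perp,(\mathbf v_F=\mathbf v_{\mathcal R,F}+\mathbf v_{\mathcal R,F}^\perp)_{F\in\mathcal F_T},v_{\partial^2T})$. The restriction of $\underline{\mathbf v}_T$ to $F\in\mathcal F_T$ is $\underline{\mathbf v}_F=(\mathbf v_F,v_{\partial F})$ with $v_{\partial F}=(v_{\partial^2T})_{|\partial F}\in\mathcal P^k(\mathcal E_F)$. For $\mathbf v\in C^0(\overline T)^3$, with $\mathbf v_{\tau,F}=\mathbf n_F\times(\mathbf v_{|F}\times\mathbf n_F)$ (orthogonal projection of $\mathbf v_{|F}$ on the plane of $F$), $\underline{\mathbf I}_{\mathbf{curl},T}^k\mathbf v=\big(\boldsymbol\pi_{\mathcal R,T}^{k-1}\mathbf v+\boldsymbol\pi_{\mathcal R,T}^{\perp,k}\mathbf v,(\boldsymbol\pi_{\mathcal R,F}^{k-1}\mathbf v_{\tau,F}+\boldsymbol\pi_{\mathcal R,F}^{\perp,k}\mathbf v_{\tau,F})_{F\in\mathcal F_T},(\pi_{\mathcal P,E}^k(\mathbf v\cdot\mathbf t_E))_{E\in\mathcal E_T}\big)$. Operators. Face curl $C_F^k\underline{\mathbf v}_F\in\mathcal P^k(F)$: $\int_FC_F^k\underline{\mathbf v}_F\,r_F=\int_F\mathbf v_{\mathcal R,F}\cdot\mathbf{rot}_Fr_F-\sum_{E\in\mathcal E_F}\omega_{FE}\int_Ev_{\partial F}r_F$ for all $r_F\in\mathcal P^k(F)$.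 Tangential trace: $\boldsymbol\gamma_{\mathrm t,F}^k\underline{\mathbf v}_F\in\mathcal P^k(F)^2$ is the unique polynomial such that $\int_F\boldsymbol\gamma_{\mathrm t,F}^k\underline{\mathbf v}_F\cdot\mathbf{rot}_Fr_F=\int_FC_F^k\underline{\mathbf v}_F\,r_F+\sum_{E\in\mathcal E_F}\omega_{FE}\int_Ev_{\partial F}r_F$ for all $r_F\in\mathcal P^{0,k+1}(F)$ and $\int_F\boldsymbol\gamma_{\mathrm t,F}^k\underline{\mathbf v}_F\cdot\mathbf w_F=\int_F\mathbf v_{\mathcal R,F}^\perp\cdot\mathbf w_F$ for all $\mathbf w_F\in\boldsymbol{\mathcal R}^k(F)^\perp$. Full curl $\mathring{\mathbf C}_T^k\underline{\mathbf v}_T\in\mathcal P^k(T)^3$: $\int_T\mathring{\mathbf C}_T^k\underline{\mathbf v}_T\cdot\mathbf w_T=\int_T\mathbf v_T\cdot\mathbf{curl}\,\mathbf w_T+\sum_{F\in\mathcal F_T}\omega_{TF}\int_F\boldsymbol\gamma_{\mathrm t,F}^k\underline{\mathbf v}_F\cdot(\mathbf w_T\times\mathbf n_F)$ for all $\mathbf w_T\in\mathcal P^k(T)^3$. Vector potential: $\mathbf P_{\mathbf{curl},T}^k\underline{\mathbf v}_T\in\mathcal P^k(T)^3$ is the unique polynomial such that $$\int_T\mathbf P_{\mathbf{curl},T}^k\underline{\mathbf v}_T\cdot\mathbf{curl}\,\mathbf w_T=\int_T\mathring{\mathbf C}_T^k\underline{\mathbf v}_T\cdot\mathbf w_T-\sum_{F\in\mathcal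 F_T}\omega_{TF}\int_F\boldsymbol\gamma_{\mathrm t,F}^k\underline{\mathbf v}_F\cdot(\mathbf w_T\times\mathbf n_F)\quad\forall\mathbf w_T\in\boldsymbol{\mathcal G}^{k+1}(T)^\perp,$$ $$\int_T\mathbf P_{\mathbf{curl},T}^k\underline{\mathbf v}_T\cdot\mathbf w_T=\int_T\mathbf v_{\mathcal R,T}^\perp\cdot\mathbf w_T\quad\forall\mathbf w_T\in\boldsymbol{\mathcal R}^k(T)^\perp.$$ *)

theory Defs
  imports "HOL-Analysis.Analysis"
begin

section \<open>Polyhedra with their faces and edges\<close>

text \<open>
  A Lipschitz boundary is expressed relative to the affine hull, so that the same definition
  serves a polyhedron in space and a polygon in its plane. Near each boundary point the set is
  the part of the affine hull lying strictly below a Lipschitz graph in some unit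
  direction \<open>\<nu>\<close> of that hull; the graph is a function of the component orthogonal to \<open>\<nu>\<close>.
\<close>

definition lipschitz_boundary :: "'a::euclidean_space set \<Rightarrow> bool" where
  "lipschitz_boundary S \<longleftrightarrow>
    (\<forall>x \<in> rel_frontier S. \<exists>\<nu> \<phi> L U.
       norm \<nu> = 1 \<and> x + \<nu> \<in> affine hull S \<and> L-lipschitz_on UNIV \<phi> \<and> open U \<and> x \<in> U \<and>
       (\<forall>y \<in> U \<inter> affine hull S. y \<in> S \<longleftrightarrow> y \<bullet> \<nu> < \<phi> (y - (y \<bullet> \<nu>) *\<^sub>R \<nu>)))"

text \<open>
  For \<open>d = 3\<close> in three-dimensional space these are the polyhedra (interiors of finite unions of
  tetrahedra), for \<open>d = 2\<close> the planar polygons (the condition on \<open>aff_dim\<close> forces all triangles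
  into one plane, and \<open>rel_interior\<close> is the interior in that plane).
  The condition on \<open>aff_dim\<close> also excludes the empty set.
\<close>

definition polytopal_domain :: "int \<Rightarrow> 'a::euclidean_space set \<Rightarrow> bool" where
  "polytopal_domain d S \<longleftrightarrow>
    (\<exists>\<T>. finite \<T> \<and> (\<forall>\<tau> \<in> \<T>. d simplex \<tau>) \<and> aff_dim (\<Union>\<T>) = d \<and> S = rel_interior (\<Union>\<T>)) \<and>
    connected S \<and> simply_connected S \<and> connected (rel_frontier S) \<and> lipschitz_boundary S"

text \<open>Faces are relatively open in their planes and edges are open segments.\<close>

record polyhedral_cell =
  body :: "(real^3) set"
  faces :: "(real^3) set set"
  edges :: "(real^3) set set"
  nrm :: "(real^3) set \<Rightarrow> real^3"  \<comment> \<open>fixed unit normal of each face\<close>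
  tng :: "(real^3) set \<Rightarrow> real^3"  \<comment> \<open>fixed unit tangent of each edge\<close>

definition edges_of :: "polyhedral_cell \<Rightarrow> (real^3) set \<Rightarrow> (real^3) set set" where
  "edges_of K F = {E \<in> edges K. E \<subseteq> rel_frontier F}"

text \<open>
  The open faces, the open edges and the vertices (the points of \<open>rel_frontier E\<close> for edges \<open>E\<close>)
  are mutually disjoint. Coplanar adjacent faces are allowed.
\<close>

definition polyhedron_with_faces :: "polyhedral_cell \<Rightarrow> bool" where
  "polyhedron_with_faces K \<longleftrightarrow>
    polytopal_domain 3 (body K) \<and>
    finite (faces K) \<and> (\<forall>F \<in> faces K. polytopal_domain 2 F) \<and>
    finite (edges K) \<and>
    (\<forall>E \<in> edges K. \<exists>a b. a \<noteq> b \<and> E = open_segment a b \<and> tng K E = sgn (b - a)) \<and>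
    pairwise disjnt (faces K \<union> edges K) \<and>
    (\<forall>E \<in> edges K. \<forall>X \<in> faces K \<union> edges K. disjnt X (rel_frontier E)) \<and>
    frontier (body K) = \<Union> (closure ` faces K) \<and>
    (\<forall>F \<in> faces K. rel_frontier F = \<Union> (closure ` edges_of K F)) \<and>
    (\<forall>E \<in> edges K. card {F \<in> faces K. E \<in> edges_of K F} = 2) \<and>
    (\<forall>F \<in> faces K. norm (nrm K F) = 1 \<and> (\<forall>x \<in> F. \<forall>y \<in> F. (x - y) \<bullet> nrm K F = 0))"

definition points_out_of :: "(real^3) set \<Rightarrow> (real^3) set \<Rightarrow> real^3 \<Rightarrow> bool" where
  "points_out_of T F n \<longleftrightarrow>
    (\<forall>x \<in> F. \<forall>\<^sub>F s in at_right 0. x - s *\<^sub>R n \<in> T \<and> x + s *\<^sub>R n \<notin> T)"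

definition omega_TF :: "polyhedral_cell \<Rightarrow> (real^3) set \<Rightarrow> real" where
  "omega_TF K F = (if points_out_of (body K) F (nrm K F) then 1 else - 1)"

text \<open>
  The tangent \<open>t\<close> of the edge \<open>E\<close> agrees with the counter-clockwise orientation of the boundary
  of \<open>F\<close> (with respect to \<open>n\<close>) iff \<open>F\<close> lies to the left of \<open>E\<close>, i.e. on the side of \<open>n \<times> t\<close>.
\<close>

definition counterclockwise :: "(real^3) set \<Rightarrow> real^3 \<Rightarrow> (real^3) set \<Rightarrow> real^3 \<Rightarrow> bool" where
  "counterclockwise F n E t \<longleftrightarrow>
    (\<forall>x \<in> E. \<forall>\<^sub>F s in at_right 0. x + s *\<^sub>R cross3 n t \<in> F \<and> x - s *\<^sub>R cross3 n t \<notin> F)"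

definition omega_FE :: "polyhedral_cell \<Rightarrow> (real^3) set \<Rightarrow> (real^3) set \<Rightarrow> real" where
  "omega_FE K F E = (if counterclockwise F (nrm K F) E (- tng K E) then 1 else - 1)"


section \<open>Integrals, orthogonal complements and projections\<close>

text \<open>
  Surface and line integrals are Lebesgue integrals in an isometric affine parametrisation of the
  plane or line spanned by the set; their values do not depend on the parametrisation.
\<close>

definition isometric_chart :: "('b::euclidean_space \<Rightarrow> 'a::euclidean_space) \<Rightarrow> 'a set \<Rightarrow> bool" where
  "isometric_chart \<phi> X \<longleftrightarrow>
    (\<exists>a L. linear L \<and> (\<forall>y. norm (L y) = norm y) \<and> \<phi> = (\<lambda>y. a + L y)) \<and> range \<phi> = affine hull X"

definition int_cell :: "(real^3) set \<Rightarrow> (real^3 \<Rightarrow> real) \<Rightarrow> real" where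
  "int_cell T f = set_lebesgue_integral lborel T f"

definition int_face :: "(real^3) set \<Rightarrow> (real^3 \<Rightarrow> real) \<Rightarrow> real" where
  "int_face F f =
    (let \<phi> = (SOME \<phi> :: real \<times> real \<Rightarrow> real^3. isometric_chart \<phi> F)
     in set_lebesgue_integral lborel (\<phi> -` F) (\<lambda>y. f (\<phi> y)))"

definition int_edge :: "(real^3) set \<Rightarrow> (real^3 \<Rightarrow> real) \<Rightarrow> real" where
  "int_edge E f =
    (let \<phi> = (SOME \<phi> :: real \<Rightarrow> real^3. isometric_chart \<phi> E)
     in set_lebesgue_integral lborel (\<phi> -` E) (\<lambda>y. f (\<phi> y)))"

text \<open>
  In the next two definitions \<open>I\<close> is one of the integrals above, so that \<open>I (\<lambda>x. u x \<bullet> w x)\<close> is the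
  corresponding \<open>L\<^sup>2\<close> product (of scalar or vector fields).
\<close>

definition orth_complement_in ::
  "(('a \<Rightarrow> real) \<Rightarrow> real) \<Rightarrow> ('a \<Rightarrow> 'b::real_inner) set \<Rightarrow> ('a \<Rightarrow> 'b) set \<Rightarrow> ('a \<Rightarrow> 'b) set" where
  "orth_complement_in I V S = {w \<in> V. \<forall>z \<in> S. I (\<lambda>x. w x \<bullet> z x) = 0}"

definition L2_proj ::
  "(('a \<Rightarrow> real) \<Rightarrow> real) \<Rightarrow> ('a \<Rightarrow> 'b::real_inner) set \<Rightarrow> ('a \<Rightarrow> 'b) \<Rightarrow> ('a \<Rightarrow> 'b)" where
  "L2_proj I S f = (THE g. g \<in> S \<and> (\<forall>h \<in> S. I (\<lambda>x. g x \<bullet> h x) = I (\<lambda>x. f x \<bullet> h x)))"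

definition fun_sum_set :: "('a \<Rightarrow> 'b::real_vector) set \<Rightarrow> ('a \<Rightarrow> 'b) set \<Rightarrow> ('a \<Rightarrow> 'b) set" where
  "fun_sum_set A B = {(\<lambda>x. a x + b x) | a b. a \<in> A \<and> b \<in> B}"

text \<open>The component in \<open>A\<close> of an element of the direct sum of \<open>A\<close> and \<open>B\<close>.\<close>

definition component ::
  "('a \<Rightarrow> 'b::real_vector) set \<Rightarrow> ('a \<Rightarrow> 'b) set \<Rightarrow> ('a \<Rightarrow> 'b) \<Rightarrow> ('a \<Rightarrow> 'b)" where
  "component A B v = (THE a. a \<in> A \<and> (\<exists>b \<in> B. v = (\<lambda>x. a x + b x)))"


section \<open>Polynomial spaces\<close>

definition poly_deg_le :: "int \<Rightarrow> (real^3 \<Rightarrow> real) \<Rightarrow> bool" where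
  "poly_deg_le l p \<longleftrightarrow>
    (\<exists>c :: nat \<Rightarrow> nat \<Rightarrow> nat \<Rightarrow> real.
       p = (\<lambda>x. \<Sum>(i, j, m) \<in> {(i, j, m). int (i + j + m) \<le> l}.
                  c i j m * (x $ 1) ^ i * (x $ 2) ^ j * (x $ 3) ^ m))"

text \<open>
  An edge, a face or a polyhedron \<open>X\<close> is nonempty and relatively open in its affine hull, so a
  polynomial function on \<open>X\<close> has exactly one polynomial extension to \<open>affine hull X\<close> (a line, a
  plane or the whole space). The elements of the polynomial spaces on \<open>X\<close> are represented by these
  extensions (set to zero outside the affine hull, so that equality of functions is equality on
  \<open>X\<close>). In this way their traces on the boundary of \<open>X\<close> are ordinary values.
\<close>

definition restr_hull :: "(real^3) set \<Rightarrow> (real^3 \<Rightarrow> 'b::zero) \<Rightarrow> (real^3 \<Rightarrow> 'b)" where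
  "restr_hull X p = (\<lambda>x. if x \<in> affine hull X then p x else 0)"

definition polys :: "int \<Rightarrow> (real^3) set \<Rightarrow> (real^3 \<Rightarrow> real) set" where
  "polys l X = {restr_hull X p | p. poly_deg_le l p}"

definition vec_polys :: "int \<Rightarrow> (real^3) set \<Rightarrow> (real^3 \<Rightarrow> real^3) set" where
  "vec_polys l X = {restr_hull X p | p. \<forall>i. poly_deg_le l (\<lambda>x. p x $ i)}"

text \<open>
  Zero-average polynomials on the face \<open>F\<close>, and \<open>\<real>\<^sup>2\<close>-valued polynomials on \<open>F\<close>; the
  latter are represented as fields tangent to the plane of \<open>F\<close>, whose unit normal is \<open>n\<close>.
\<close>

definition polys0_face :: "int \<Rightarrow> (real^3) set \<Rightarrow> (real^3 \<Rightarrow> real) set" where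
  "polys0_face l F = {r \<in> polys l F. int_face F r = 0}"

definition tan_polys :: "int \<Rightarrow> (real^3) set \<Rightarrow> real^3 \<Rightarrow> (real^3 \<Rightarrow> real^3) set" where
  "tan_polys l F n = {w \<in> vec_polys l F. \<forall>x. w x \<bullet> n = 0}"

definition partial_deriv :: "3 \<Rightarrow> (real^3 \<Rightarrow> real) \<Rightarrow> real^3 \<Rightarrow> real" where
  "partial_deriv i f x = frechet_derivative f (at x) (axis i 1)"

definition grad :: "(real^3 \<Rightarrow> real) \<Rightarrow> real^3 \<Rightarrow> real^3" where
  "grad f = (\<lambda>x. \<chi> i. partial_deriv i f x)"

definition curl :: "(real^3 \<Rightarrow> real^3) \<Rightarrow> real^3 \<Rightarrow> real^3" where
  "curl w = (\<lambda>x. vector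
     [partial_deriv 2 (\<lambda>y. w y $ 3) x - partial_deriv 3 (\<lambda>y. w y $ 2) x,
      partial_deriv 3 (\<lambda>y. w y $ 1) x - partial_deriv 1 (\<lambda>y. w y $ 3) x,
      partial_deriv 1 (\<lambda>y. w y $ 2) x - partial_deriv 2 (\<lambda>y. w y $ 1) x])"

definition grad_face :: "(real^3) set \<Rightarrow> real^3 \<Rightarrow> (real^3 \<Rightarrow> real) \<Rightarrow> real^3 \<Rightarrow> real^3" where
  "grad_face F n r = restr_hull F (\<lambda>x.
     THE g. g \<bullet> n = 0 \<and> (r has_derivative (\<lambda>h. g \<bullet> h)) (at x within affine hull F))"

text \<open>
  In the plane orthogonal to the unit vector \<open>n\<close> and oriented by it, the rotation of angle
  \<open>-\<pi>/2\<close> maps \<open>u\<close> to \<open>u \<times> n\<close>.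
\<close>

definition rot_face :: "(real^3) set \<Rightarrow> real^3 \<Rightarrow> (real^3 \<Rightarrow> real) \<Rightarrow> real^3 \<Rightarrow> real^3" where
  "rot_face F n r = (\<lambda>x. cross3 (grad_face F n r x) n)"

definition R_face :: "int \<Rightarrow> (real^3) set \<Rightarrow> real^3 \<Rightarrow> (real^3 \<Rightarrow> real^3) set" where
  "R_face l F n = rot_face F n ` polys (l + 1) F"

definition R_face_perp :: "int \<Rightarrow> (real^3) set \<Rightarrow> real^3 \<Rightarrow> (real^3 \<Rightarrow> real^3) set" where
  "R_face_perp l F n = orth_complement_in (int_face F) (tan_polys l F n) (R_face l F n)"

definition R_cell :: "int \<Rightarrow> (real^3) set \<Rightarrow> (real^3 \<Rightarrow> real^3) set" where
  "R_cell l T = curl ` vec_polys (l + 1) T"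

definition R_cell_perp :: "int \<Rightarrow> (real^3) set \<Rightarrow> (real^3 \<Rightarrow> real^3) set" where
  "R_cell_perp l T = orth_complement_in (int_cell T) (vec_polys l T) (R_cell l T)"

definition G_cell :: "int \<Rightarrow> (real^3) set \<Rightarrow> (real^3 \<Rightarrow> real^3) set" where
  "G_cell l T = grad ` polys (l + 1) T"

definition G_cell_perp :: "int \<Rightarrow> (real^3) set \<Rightarrow> (real^3 \<Rightarrow> real^3) set" where
  "G_cell_perp l T = orth_complement_in (int_cell T) (vec_polys l T) (G_cell l T)"


section \<open>The discrete space and the interpolator\<close>

text \<open>
  A function on the union of the edges that is polynomial on each edge, without continuity at the
  vertices, is represented by the family of its restrictions to the edges. The restriction of an
  element to a face \<open>F\<close> then consists of \<open>vface v F\<close> and of \<open>vedge v E\<close> for \<open>E \<in> edges_of K F\<close>.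
\<close>

record curl_element =
  vcell :: "real^3 \<Rightarrow> real^3"
  vface :: "(real^3) set \<Rightarrow> real^3 \<Rightarrow> real^3"
  vedge :: "(real^3) set \<Rightarrow> real^3 \<Rightarrow> real"

definition X_curl :: "int \<Rightarrow> polyhedral_cell \<Rightarrow> curl_element set" where
  "X_curl k K = {v.
     vcell v \<in> fun_sum_set (R_cell (k - 1) (body K)) (R_cell_perp k (body K)) \<and>
     (\<forall>F \<in> faces K. vface v F \<in> fun_sum_set (R_face (k - 1) F (nrm K F)) (R_face_perp k F (nrm K F))) \<and>
     (\<forall>E \<in> edges K. vedge v E \<in> polys k E)}"

definition v_R_perp_cell :: "int \<Rightarrow> polyhedral_cell \<Rightarrow> curl_element \<Rightarrow> real^3 \<Rightarrow> real^3" where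
  "v_R_perp_cell k K v = component (R_cell_perp k (body K)) (R_cell (k - 1) (body K)) (vcell v)"

definition v_R_face :: "int \<Rightarrow> polyhedral_cell \<Rightarrow> curl_element \<Rightarrow> (real^3) set \<Rightarrow> real^3 \<Rightarrow> real^3" where
  "v_R_face k K v F =
     component (R_face (k - 1) F (nrm K F)) (R_face_perp k F (nrm K F)) (vface v F)"

definition v_R_perp_face :: "int \<Rightarrow> polyhedral_cell \<Rightarrow> curl_element \<Rightarrow> (real^3) set \<Rightarrow> real^3 \<Rightarrow> real^3" where
  "v_R_perp_face k K v F =
     component (R_face_perp k F (nrm K F)) (R_face (k - 1) F (nrm K F)) (vface v F)"

definition tangential_part :: "real^3 \<Rightarrow> (real^3 \<Rightarrow> real^3) \<Rightarrow> real^3 \<Rightarrow> real^3" where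
  "tangential_part n v = (\<lambda>x. cross3 n (cross3 (v x) n))"

text \<open>Only the values of \<open>v\<close> on the closure of \<open>body K\<close> matter.\<close>

definition I_curl :: "int \<Rightarrow> polyhedral_cell \<Rightarrow> (real^3 \<Rightarrow> real^3) \<Rightarrow> curl_element" where
  "I_curl k K v = \<lparr>
     vcell = (\<lambda>x. L2_proj (int_cell (body K)) (R_cell (k - 1) (body K)) v x
                + L2_proj (int_cell (body K)) (R_cell_perp k (body K)) v x),
     vface = (\<lambda>F x.
         L2_proj (int_face F) (R_face (k - 1) F (nrm K F)) (tangential_part (nrm K F) v) x
       + L2_proj (int_face F) (R_face_perp k F (nrm K F)) (tangential_part (nrm K F) v) x),
     vedge = (\<lambda>E. L2_proj (int_edge E) (polys k E) (\<lambda>x. v x \<bullet> tng K E)) \<rparr>"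


section \<open>Discrete operators\<close>

definition C_face :: "int \<Rightarrow> polyhedral_cell \<Rightarrow> curl_element \<Rightarrow> (real^3) set \<Rightarrow> real^3 \<Rightarrow> real" where
  "C_face k K v F = (THE q. q \<in> polys k F \<and>
     (\<forall>r \<in> polys k F.
        int_face F (\<lambda>x. q x * r x) =
        int_face F (\<lambda>x. v_R_face k K v F x \<bullet> rot_face F (nrm K F) r x)
        - (\<Sum>E \<in> edges_of K F. omega_FE K F E * int_edge E (\<lambda>x. vedge v E x * r x))))"

definition gamma_t :: "int \<Rightarrow> polyhedral_cell \<Rightarrow> curl_element \<Rightarrow> (real^3) set \<Rightarrow> real^3 \<Rightarrow> real^3" where
  "gamma_t k K v F = (THE g. g \<in> tan_polys k F (nrm K F) \<and>
     (\<forall>r \<in> polys0_face (k + 1) F.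
        int_face F (\<lambda>x. g x \<bullet> rot_face F (nrm K F) r x) =
        int_face F (\<lambda>x. C_face k K v F x * r x)
        + (\<Sum>E \<in> edges_of K F. omega_FE K F E * int_edge E (\<lambda>x. vedge v E x * r x))) \<and>
     (\<forall>w \<in> R_face_perp k F (nrm K F).
        int_face F (\<lambda>x. g x \<bullet> w x) = int_face F (\<lambda>x. v_R_perp_face k K v F x \<bullet> w x)))"

definition C_full :: "int \<Rightarrow> polyhedral_cell \<Rightarrow> curl_element \<Rightarrow> real^3 \<Rightarrow> real^3" where
  "C_full k K v = (THE c. c \<in> vec_polys k (body K) \<and>
     (\<forall>w \<in> vec_polys k (body K).
        int_cell (body K) (\<lambda>x. c x \<bullet> w x) =
        int_cell (body K) (\<lambda>x. vcell v x \<bullet> curl w x)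
        + (\<Sum>F \<in> faces K. omega_TF K F *
             int_face F (\<lambda>x. gamma_t k K v F x \<bullet> cross3 (w x) (nrm K F)))))"

definition P_curl :: "int \<Rightarrow> polyhedral_cell \<Rightarrow> curl_element \<Rightarrow> real^3 \<Rightarrow> real^3" where
  "P_curl k K v = (THE p. p \<in> vec_polys k (body K) \<and>
     (\<forall>w \<in> G_cell_perp (k + 1) (body K).
        int_cell (body K) (\<lambda>x. p x \<bullet> curl w x) =
        int_cell (body K) (\<lambda>x. C_full k K v x \<bullet> w x)
        - (\<Sum>F \<in> faces K. omega_TF K F *
             int_face F (\<lambda>x. gamma_t k K v F x \<bullet> cross3 (w x) (nrm K F)))) \<and>
     (\<forall>w \<in> R_cell_perp k (body K).
        int_cell (body K) (\<lambda>x. p x \<bullet> w x) =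
        int_cell (body K) (\<lambda>x. v_R_perp_cell k K v x \<bullet> w x)))"

end

theory Submission
  imports Defs
begin

text \<open>
  For a polynomial field \<open>v\<close> of degree at most \<open>k\<close>, the edge components of the interpolate are the
  exact tangential components of \<open>v\<close>. Stokes' formula on each face then shows that the face curl and
  the tangential trace are \<open>n \<bullet> curl v\<close> and the tangential part of \<open>v\<close>, Stokes' formula on the
  polyhedron shows that the full curl is \<open>curl v\<close>, and the equations defining the potential say that
  it has the same moments as \<open>v\<close> against \<open>R\<^sup>k\<close> (the curls of \<open>G\<^sup>k\<^sup>+\<^sup>1\<close>-orthogonal fields) and against
  its orthogonal complement.

  Stokes' formulas come from integrating a directional derivative over a region whose boundary
  consists of flat facets. Along almost every line in direction \<open>d\<close> the boundary is crossed
  transversally and only in the interior of facets, so the indicator of the region equals, almost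
  everywhere, the signed sum of the indicators of the half-infinite cylinders swept by the facets in
  direction \<open>-d\<close>. On each cylinder the formula is Fubini and the fundamental theorem of calculus.
\<close>

subsection \<open>Integration in slanted coordinates\<close>

text \<open>On a face and in the cell, the interpolate keeps only the moments of \<open>v\<close>
  against R^(k-1) and against the complement of R^k; the gap between R^(k-1) and R^k has to be
  recovered. A count of degrees makes the recovery exact. Test functions of degree k have their rot
  or curl in R^(k-1), so \<open>C_face\<close> and \<open>C_full\<close> meet only moments that were
  kept. Test functions of degree k + 1, which reach all of R^k, are paired in \<open>gamma_t\<close>
  and \<open>P_curl\<close> with curls and traces that are already identified.

  Every operator is a definite description, so each identification needs uniqueness as well as the
  equations. Uniqueness rests on one fact shared by cells, faces and edges: a nonnegative polynomial
  with zero integral vanishes on the whole affine hull.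

  The facet formula is stated in arbitrary dimension because it is applied twice: to the body in
  space, with faces as facets, and to each face in the coordinates of its chart, with edges as
  facets. Fixing one direction reduces it to counting the crossings of lines, a local matter at each
  facet.\<close>

lemma emeasure_lborel_translate:
  fixes c :: "'a::euclidean_space"
  assumes "A \<in> sets borel"
  shows "emeasure lborel {y. x + y \<in> A} = emeasure lborel A"
proof -
  have "emeasure lborel A = emeasure (distr lborel borel ((+) x)) A"
    by (simp add: lborel_distr_plus)
  also have "\<dots> = emeasure lborel ((+) x -` A \<inter> space lborel)"
    using assms by (intro emeasure_distr) auto
  finally show ?thesis by (simp add: vimage_def)
qed

text \<open>
  The image \<open>\<mu>\<close> of Lebesgue measure is translation invariant, so Fubini for \<open>1\<^sub>A(x) 1\<^sub>B(x + y)\<close> gives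
  \<open>\<mu> A * lborel B = \<mu> B * lborel (- A)\<close>; taking the unit ball for \<open>A\<close> identifies \<open>\<mu>\<close>.
\<close>

lemma distr_lborel_linear_isometry:
  fixes f :: "'b::euclidean_space \<Rightarrow> 'a::euclidean_space"
  assumes lin: "linear f" and nrm: "\<And>y. norm (f y) = norm y" and dim: "DIM('b) = DIM('a)"
  shows "distr lborel borel f = lborel"
proof (rule measure_eqI)
  let ?\<mu> = "distr lborel borel f"
  have f_borel [measurable]: "f \<in> borel_measurable borel"
    by (intro borel_measurable_continuous_onI linear_continuous_on)
      (use lin in \<open>simp add: linear_conv_bounded_linear\<close>)
  have surj: "surj f"
  proof -
    have "inj f" using lin nrm by (metis linear_injective_0 norm_eq_zero)
    then have "dim (range f) = DIM('a)"
      using dim_image_eq[of f UNIV] lin dim by (simp add: inj_on_def)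
    then show ?thesis
      by (metis dim_eq_full lin linear_subspace_image span_eq_iff subspace_UNIV)
  qed
  have \<mu>: "emeasure ?\<mu> A = emeasure lborel (f -` A)" if "A \<in> sets borel" for A
    using that by (simp add: emeasure_distr)
  \<comment> \<open>Surjectivity of \<open>f\<close> pulls a translation of the target back to a
    translation of the source, under which \<open>lborel\<close> is invariant.\<close>
  have \<mu>_transl: "emeasure ?\<mu> {y. y - x \<in> A} = emeasure ?\<mu> A" if A [measurable]: "A \<in> sets borel" for A x
  proof -
    obtain z where z: "x = - f z" using surj by (metis surj_def add.inverse_inverse)
    have "emeasure ?\<mu> {y. y - x \<in> A} = emeasure lborel (f -` {y. y - x \<in> A})"
      by (intro \<mu>) measurable
    also have "f -` {y. y - x \<in> A} = {y. z + y \<in> f -` A}"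
      using lin by (auto simp: z linear_add add.commute)
    also have "emeasure lborel \<dots> = emeasure lborel (f -` A)"
      using measurable_sets[OF f_borel A] by (intro emeasure_lborel_translate) auto
    finally show ?thesis using \<mu>[OF A] by simp
  qed
  have \<mu>_ball: "emeasure ?\<mu> (ball 0 1) = emeasure lborel (ball 0 1 :: 'a set)"
  proof -
    have "f -` ball 0 1 = ball 0 1" using nrm by (auto simp: dist_norm)
    then show ?thesis by (simp add: \<mu> emeasure_ball dim)
  qed
  have "sigma_finite_measure ?\<mu>"
  proof
    have "emeasure ?\<mu> (ball 0 r) < \<infinity>" for r
    proof -
      have "f -` ball 0 r = ball 0 r" using nrm by (auto simp: dist_norm)
      then show ?thesis by (simp add: \<mu>) (use emeasure_lborel_ball_finite[of 0 r] in \<open>simp add: less_top\<close>)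
    qed
    then show "\<exists>A. countable A \<and> A \<subseteq> sets ?\<mu> \<and> \<Union> A = space ?\<mu> \<and> (\<forall>a\<in>A. emeasure ?\<mu> a \<noteq> \<infinity>)"
      by (intro exI[of _ "range (\<lambda>n. ball 0 (real n))"])
        (auto simp: less_top reals_Archimedean2)
  qed
  then interpret M: sigma_finite_measure ?\<mu> .
  interpret pair_sigma_finite ?\<mu> "lborel :: 'a measure" ..
  have swap: "emeasure ?\<mu> A * emeasure lborel B = emeasure ?\<mu> B * emeasure lborel (uminus -` A)"
    if A [measurable]: "A \<in> sets borel" and B [measurable]: "B \<in> sets borel" for A B
  proof -
    have "(\<integral>\<^sup>+x. \<integral>\<^sup>+y. indicator A x * indicator B (x + y) \<partial>lborel \<partial>?\<mu>)
        = (\<integral>\<^sup>+y. \<integral>\<^sup>+x. indicator A x * indicator B (x + y) \<partial>?\<mu> \<partial>lborel)"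
      by (rule Fubini'[symmetric]) measurable
    moreover have "(\<integral>\<^sup>+y. indicator A x * indicator B (x + y) \<partial>lborel) = indicator A x * emeasure lborel B" for x
    proof -
      have "(\<integral>\<^sup>+y. indicator A x * indicator B (x + y) \<partial>lborel)
          = indicator A x * (\<integral>\<^sup>+y. indicator {y. x + y \<in> B} y \<partial>lborel)"
        by (subst nn_integral_cmult[symmetric]) (auto simp: indicator_def intro!: nn_integral_cong)
      also have "(\<integral>\<^sup>+y. indicator {y. x + y \<in> B} y \<partial>lborel) = emeasure lborel {y. x + y \<in> B}"
        by (intro nn_integral_indicator) measurable
      finally show ?thesis using emeasure_lborel_translate[OF B] by simp
    qed
    moreover have "(\<integral>\<^sup>+x. indicator A x * indicator B (x + y) \<partial>?\<mu>)
        = (\<integral>\<^sup>+x. indicator A (x - y) * indicator B x \<partial>?\<mu>)" for y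
    proof -
      have "distr ?\<mu> borel (\<lambda>x. x + y) = ?\<mu>"
      proof (rule measure_eqI)
        fix C :: "'a set" assume "C \<in> sets (distr ?\<mu> borel (\<lambda>x. x + y))"
        then have C: "C \<in> sets borel" by simp
        then show "emeasure (distr ?\<mu> borel (\<lambda>x. x + y)) C = emeasure ?\<mu> C"
          using \<mu>_transl[OF C, of "-y"] by (subst emeasure_distr) (auto simp: vimage_def)
      qed simp
      then have "(\<integral>\<^sup>+x. indicator A (x - y) * indicator B x \<partial>?\<mu>)
          = (\<integral>\<^sup>+x. indicator A (x - y) * indicator B x \<partial>distr ?\<mu> borel (\<lambda>x. x + y))" by simp
      also have "\<dots> = (\<integral>\<^sup>+x. indicator A (x + y - y) * indicator B (x + y) \<partial>?\<mu>)"
        by (rule nn_integral_distr) measurable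
      finally show ?thesis by simp
    qed
    moreover have "(\<integral>\<^sup>+y. \<integral>\<^sup>+x. indicator A (x - y) * indicator B x \<partial>?\<mu> \<partial>lborel)
        = (\<integral>\<^sup>+x. \<integral>\<^sup>+y. indicator A (x - y) * indicator B x \<partial>lborel \<partial>?\<mu>)"
      by (rule Fubini') measurable
    moreover have "(\<integral>\<^sup>+y. indicator A (x - y) * indicator B x \<partial>lborel) = indicator B x * emeasure lborel (uminus -` A)" for x
    proof -
      have m: "uminus -` A \<in> sets borel"
        using measurable_sets[of uminus borel borel A] A by simp
      have "(\<integral>\<^sup>+y. indicator A (x - y) * indicator B x \<partial>lborel)
          = indicator B x * (\<integral>\<^sup>+y. indicator {y. - x + y \<in> uminus -` A} y \<partial>lborel)"
        by (subst nn_integral_cmult[symmetric]) (auto simp: indicator_def intro!: nn_integral_cong)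
      also have "(\<integral>\<^sup>+y. indicator {y. - x + y \<in> uminus -` A} y \<partial>lborel)
          = emeasure lborel {y. - x + y \<in> uminus -` A}"
        by (intro nn_integral_indicator) (simp, measurable)
      finally show ?thesis using emeasure_lborel_translate[OF m, of "-x"] by simp
    qed
    moreover have "(\<integral>\<^sup>+x. indicator C x * c \<partial>?\<mu>) = emeasure ?\<mu> C * c" if "C \<in> sets borel" for C c
      using that by (subst nn_integral_multc) auto
    ultimately show ?thesis using A B by simp
  qed
  show "sets ?\<mu> = sets lborel" by simp
  fix B assume "B \<in> sets ?\<mu>"
  then have B: "B \<in> sets borel" by simp
  have u: "emeasure lborel (ball 0 1 :: 'a set) \<noteq> 0" "emeasure lborel (ball 0 1 :: 'a set) \<noteq> \<infinity>"
    using unit_ball_vol_pos[of "real DIM('a)"] by (simp_all add: emeasure_ball less_imp_neq[symmetric])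
  \<comment> \<open>The unit ball is symmetric, which removes the reflection from
    \<open>swap\<close>; its measure is positive and finite, so it can be cancelled.\<close>
  have "uminus -` ball 0 1 = (ball 0 1 :: 'a set)" by (auto simp: dist_norm)
  then have "emeasure lborel (ball 0 1 :: 'a set) * emeasure lborel B
      = emeasure lborel (ball 0 1 :: 'a set) * emeasure ?\<mu> B"
    using swap[of "ball 0 1" B] B \<mu>_ball by (simp add: mult.commute)
  then show "emeasure ?\<mu> B = emeasure lborel B"
    using u by (simp add: ennreal_mult_cancel_left)
qed

text \<open>Slanted coordinates arise from the orthonormal frame \<open>P\<close> by a scaling of
  the normal coordinate and a shear along the hyperplane. The shear is a translation for each fixed
  t and preserves measure; the scaling contributes the Jacobian |d . n|.\<close>

lemma lborel_slant_coordinates: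
  fixes L :: "'b::euclidean_space \<Rightarrow> 'a::euclidean_space"
  assumes dim: "DIM('a) = Suc DIM('b)"
    and lin: "linear L" and nrmL: "\<And>y. norm (L y) = norm y"
    and n: "norm n = 1" and orth: "\<And>y. L y \<bullet> n = 0" and c: "d \<bullet> n \<noteq> 0"
  shows "lborel = density (distr lborel borel (\<lambda>(y, t). a + L y - t *\<^sub>R d)) (\<lambda>_. ennreal \<bar>d \<bullet> n\<bar>)"
    (is "_ = density ?D _")
proof (rule measure_eqI)
  let ?c = "d \<bullet> n"
  have cont_L: "continuous_on UNIV L"
    using lin by (simp add: linear_continuous_on linear_conv_bounded_linear)
  have L_m [measurable]: "L \<in> borel_measurable borel"
    using cont_L by (rule borel_measurable_continuous_onI)
  have range_L: "range L = {x. n \<bullet> x = 0}"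
  proof -
    have "inj L" using lin nrmL by (metis linear_injective_0 norm_eq_zero)
    then have "dim (range L) = DIM('b)"
      using dim_image_eq[of L UNIV] lin by (simp add: inj_on_def)
    moreover have "dim {x. n \<bullet> x = 0} = DIM('a) - 1"
      using n by (intro dim_hyperplane) auto
    moreover have "range L \<subseteq> {x. n \<bullet> x = 0}" using orth by (auto simp: inner_commute)
    ultimately show ?thesis
      using lin dim by (intro subspace_dim_equal)
        (auto simp: subspace_hyperplane linear_subspace_image)
  qed
  have "n \<bullet> (d - ?c *\<^sub>R n) = 0" using n by (simp add: inner_diff_right inner_commute norm_eq_1)
  \<comment> \<open>\<open>e\<close> is the component of \<open>d\<close> along the hyperplane, in
    the coordinates of \<open>L\<close>; it is the velocity of the shear.\<close>
  then obtain e where e: "L e = d - ?c *\<^sub>R n" using range_L by (metis (mono_tags, lifting) mem_Collect_eq imageE)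
  define P :: "'b \<times> real \<Rightarrow> 'a" where "P = (\<lambda>(y, s). L y + s *\<^sub>R n)"
  have P_m [measurable]: "P \<in> borel_measurable borel"
    unfolding P_def by (subst borel_prod[symmetric]) measurable
  have P_lin: "linear P"
    unfolding P_def using lin by (intro linearI) (auto simp: linear_add linear_scale scaleR_add_left scaleR_add_right)
  have P_norm: "norm (P z) = norm z" for z
  proof (cases z)
    case (Pair y s)
    have "(norm (P z))\<^sup>2 = (norm z)\<^sup>2"
      using orth[of y] n nrmL[of y] unfolding Pair P_def
      by (simp add: power2_norm_eq_inner inner_add inner_commute norm_eq_1 norm_Pair)
         (simp add: dot_square_norm nrmL power2_eq_square)
    then show ?thesis by simp
  qed
  have P_distr: "distr lborel borel P = lborel"
    by (rule distr_lborel_linear_isometry[OF P_lin P_norm]) (simp add: dim)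
  have S_m [measurable]: "(\<lambda>(y, t). a + L y - t *\<^sub>R d) \<in> borel_measurable (borel :: ('b \<times> real) measure)"
    by (subst borel_prod[symmetric]) measurable
  show "sets lborel = sets (density ?D (\<lambda>_. ennreal \<bar>?c\<bar>))" by simp
  fix A :: "'a set" assume "A \<in> sets lborel"
  then have A [measurable]: "A \<in> sets borel" by simp
  have "emeasure lborel A = emeasure lborel {x. a + x \<in> A}"
    using emeasure_lborel_translate[OF A, of a] by simp
  also have "\<dots> = (\<integral>\<^sup>+x. indicator {x. a + x \<in> A} x \<partial>lborel)"
    by (intro nn_integral_indicator[symmetric]) simp
  also have "\<dots> = (\<integral>\<^sup>+x. indicator A (a + x) \<partial>lborel)"
    by (intro nn_integral_cong) (simp add: indicator_def)
  also have "\<dots> = (\<integral>\<^sup>+x. indicator A (a + x) \<partial>distr lborel borel P)"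
    by (simp add: P_distr)
  also have "\<dots> = (\<integral>\<^sup>+z. indicator A (a + P z) \<partial>(lborel :: ('b \<times> real) measure))"
    by (intro nn_integral_distr) auto
  also have "\<dots> = (\<integral>\<^sup>+z. indicator A (a + P z) \<partial>((lborel :: 'b measure) \<Otimes>\<^sub>M (lborel :: real measure)))"
    by (simp add: lborel_prod)
  also have "\<dots> = (\<integral>\<^sup>+s. \<integral>\<^sup>+y. indicator A (a + L y + s *\<^sub>R n) \<partial>lborel \<partial>lborel)"
    by (subst lborel_pair.nn_integral_snd[symmetric]) (auto simp: P_def algebra_simps split_beta')
  \<comment> \<open>Substitute s = - t (d . n) in the normal coordinate. For each fixed t the
    translation of y by \<open>- t *\<^sub>R e\<close> then replaces t (d . n) n by t d.\<close>
  also have "\<dots> = ennreal \<bar>?c\<bar> * (\<integral>\<^sup>+t. \<integral>\<^sup>+y. indicator A (a + L y - (t * ?c) *\<^sub>R n) \<partial>lborel \<partial>lborel)"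
    using c by (subst nn_integral_real_affine[where c="- ?c" and t=0]) (auto simp: mult.commute)
  also have "(\<lambda>t. \<integral>\<^sup>+y. indicator A (a + L y - (t * ?c) *\<^sub>R n) \<partial>lborel)
      = (\<lambda>t. \<integral>\<^sup>+y. indicator A (a + L y - t *\<^sub>R d) \<partial>lborel)"
  proof
    fix t
    have "(\<integral>\<^sup>+y. indicator A (a + L y - (t * ?c) *\<^sub>R n) \<partial>lborel)
        = (\<integral>\<^sup>+y. indicator A (a + L y - (t * ?c) *\<^sub>R n) \<partial>distr lborel borel ((+) (- t *\<^sub>R e)))"
      by (simp add: lborel_distr_plus)
    also have "\<dots> = (\<integral>\<^sup>+y. indicator A (a + L (- t *\<^sub>R e + y) - (t * ?c) *\<^sub>R n) \<partial>lborel)"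
      by (intro nn_integral_distr) auto
    also have "\<dots> = (\<integral>\<^sup>+y. indicator A (a + L y - t *\<^sub>R d) \<partial>lborel)"
    proof (intro nn_integral_cong arg_cong[of _ _ "indicator A"])
      fix y
      have "L (- t *\<^sub>R e + y) = - t *\<^sub>R (d - ?c *\<^sub>R n) + L y"
        using linear_add[OF lin, of "- t *\<^sub>R e" y] linear_scale[OF lin, of "- t" e] e by simp
      then show "a + L (- t *\<^sub>R e + y) - (t * ?c) *\<^sub>R n = a + L y - t *\<^sub>R d"
        by (simp add: algebra_simps)
    qed
    finally show "(\<integral>\<^sup>+y. indicator A (a + L y - (t * ?c) *\<^sub>R n) \<partial>lborel)
      = (\<integral>\<^sup>+y. indicator A (a + L y - t *\<^sub>R d) \<partial>lborel)" .
  qed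
  also have "(\<integral>\<^sup>+t. \<integral>\<^sup>+y. indicator A (a + L y - t *\<^sub>R d) \<partial>lborel \<partial>lborel)
      = (\<integral>\<^sup>+z. indicator A (case z of (y, t) \<Rightarrow> a + L y - t *\<^sub>R d) \<partial>((lborel :: 'b measure) \<Otimes>\<^sub>M (lborel :: real measure)))"
    by (subst lborel_pair.nn_integral_snd[symmetric]) (auto simp: split_beta')
  also have "\<dots> = (\<integral>\<^sup>+x. indicator A x \<partial>?D)"
    by (subst nn_integral_distr) (auto simp: lborel_prod)
  also have "\<dots> = emeasure ?D A" by simp
  also have "ennreal \<bar>?c\<bar> * emeasure ?D A = emeasure (density ?D (\<lambda>_. ennreal \<bar>?c\<bar>)) A"
    by (simp add: emeasure_density_const)
  finally show "emeasure lborel A = emeasure (density ?D (\<lambda>_. ennreal \<bar>?c\<bar>)) A" .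
qed

lemma

  fixes L :: "'b::euclidean_space \<Rightarrow> 'a::euclidean_space" and g :: "'a \<Rightarrow> real"
  assumes dim: "DIM('a) = Suc DIM('b)"
    and lin: "linear L" and nrmL: "\<And>y. norm (L y) = norm y"
    and n: "norm n = 1" and orth: "\<And>y. L y \<bullet> n = 0" and c: "d \<bullet> n \<noteq> 0"
    and g [measurable]: "g \<in> borel_measurable borel"
  shows integrable_lborel_slant_coordinates:
      "integrable lborel (\<lambda>(y, t). g (a + L y - t *\<^sub>R d)) \<Longrightarrow> integrable lborel g"
    and integral_lborel_slant_coordinates:
      "(\<integral>x. g x \<partial>lborel) = \<bar>d \<bullet> n\<bar> * (\<integral>(y, t). g (a + L y - t *\<^sub>R d) \<partial>lborel)"
proof -
  have [measurable]: "L \<in> borel_measurable borel"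
    using lin by (intro borel_measurable_continuous_onI) (simp add: linear_continuous_on linear_conv_bounded_linear)
  have [measurable]: "(\<lambda>z. a + L (fst z) - snd z *\<^sub>R d) \<in> borel_measurable (borel :: ('b \<times> real) measure)"
    by (subst borel_prod[symmetric]) measurable
  show "integrable lborel g" if "integrable lborel (\<lambda>(y, t). g (a + L y - t *\<^sub>R d))"
    using that by (subst lborel_slant_coordinates[OF assms(1-6), of a])
      (simp add: integrable_density integrable_distr_eq split_beta')
  show "(\<integral>x. g x \<partial>lborel) = \<bar>d \<bullet> n\<bar> * (\<integral>(y, t). g (a + L y - t *\<^sub>R d) \<partial>lborel)"
    by (subst lborel_slant_coordinates[OF assms(1-6), of a])
      (simp add: integral_density integral_distr split_beta')
qed

text \<open>
  The line \<open>x + t d\<close> crosses the hyperplane \<open>y \<bullet> n = b\<close> of \<open>F\<close> at the time \<open>(b - x \<bullet> n) / (d \<bullet> n)\<close>.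
\<close>

definition shadow :: "'a::euclidean_space \<Rightarrow> 'a \<Rightarrow> real \<Rightarrow> 'a set \<Rightarrow> 'a set" where
  "shadow d n b F = {x. 0 \<le> (b - x \<bullet> n) / (d \<bullet> n) \<and> x + ((b - x \<bullet> n) / (d \<bullet> n)) *\<^sub>R d \<in> F}"

text \<open>In slanted coordinates based at the facet, the shadow is \<open>A\<close> times the half
  line t >= 0. By the fundamental theorem each ray contributes the value of \<open>h\<close> at its
  start on the facet, because \<open>h\<close> vanishes at the far end. The vanishing of
  \<open>g\<close> for small x . d is what makes the integral over the unbounded cylinder
  converge.\<close>

lemma

  fixes L :: "'b::euclidean_space \<Rightarrow> 'a::euclidean_space" and g h :: "'a \<Rightarrow> real"
  assumes dim: "DIM('a) = Suc DIM('b)"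
    and lin: "linear L" and nrmL: "\<And>y. norm (L y) = norm y"
    and n: "norm n = 1" and orth: "\<And>y. L y \<bullet> n = 0" and c: "d \<bullet> n \<noteq> 0"
    and A: "A = (\<lambda>y. a + L y) -` F" "open A" "bounded A"
    and F: "F \<in> sets borel"
    and g: "continuous_on UNIV g"
    and h: "\<And>x t. ((\<lambda>t. h (x + t *\<^sub>R d)) has_real_derivative g (x + t *\<^sub>R d)) (at t)"
    and zero: "\<And>x. x \<bullet> d \<le> M \<Longrightarrow> g x = 0" "\<And>x. x \<bullet> d \<le> M \<Longrightarrow> h x = 0"
  shows integrable_shadow: "integrable lborel (\<lambda>x. indicator (shadow d n (a \<bullet> n) F) x * g x)"
    and integral_shadow: "(\<integral>x. indicator (shadow d n (a \<bullet> n) F) x * g x \<partial>lborel) = \<bar>d \<bullet> n\<bar> * (\<integral>y. indicator A y * h (a + L y) \<partial>lborel)"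
proof -
  let ?\<psi> = "\<lambda>z. a + L (fst z) - snd z *\<^sub>R d"
  have cont_L: "continuous_on UNIV L"
    using lin by (simp add: linear_continuous_on linear_conv_bounded_linear)
  have L_cont [continuous_intros]: "continuous_on X (\<lambda>x. L (f x))" if "continuous_on X f" for X and f :: "'b \<times> real \<Rightarrow> 'b"
    using that cont_L by (metis continuous_on_compose2 subset_UNIV)
  obtain R where R: "\<And>y. y \<in> A \<Longrightarrow> norm y \<le> R" using A(3) by (auto simp: bounded_iff)
  \<comment> \<open>From time \<open>T\<close> on, every ray starting in \<open>A\<close> is in the
    region x . d <= \<open>M\<close>: the first two terms bound the component along \<open>d\<close>
    of its start. The outer absolute value gives 0 <= \<open>T\<close>, needed for the interval
    {0..T}.\<close>
  define T where "T = \<bar>(\<bar>a \<bullet> d\<bar> + R * norm d - M) / (d \<bullet> d)\<bar>"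
  have dd: "d \<bullet> d > 0" using c by auto
  have beyond: "?\<psi> (y, t) \<bullet> d \<le> M" if "y \<in> A" "T \<le> t" for y t
  proof -
    have "L y \<bullet> d \<le> norm (L y) * norm d" by (rule norm_cauchy_schwarz)
    also have "\<dots> \<le> R * norm d" using R[OF that(1)] by (simp add: nrmL mult_right_mono)
    finally have 1: "L y \<bullet> d \<le> R * norm d" .
    have "(\<bar>a \<bullet> d\<bar> + R * norm d - M) / (d \<bullet> d) \<le> t" using that(2) unfolding T_def by linarith
    then have "\<bar>a \<bullet> d\<bar> + R * norm d - M \<le> t * (d \<bullet> d)" using dd by (simp add: divide_le_eq)
    then show ?thesis using 1 by (simp add: inner_diff_left inner_add_left)
  qed
  have T0: "0 \<le> T" by (simp add: T_def)
  have sh: "indicator (shadow d n (a \<bullet> n) F) (?\<psi> z) * g (?\<psi> z)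
      = indicator (A \<times> {0..T}) z * g (?\<psi> z)" for z
  proof (cases z)
    case (Pair y t)
    have "(a \<bullet> n - ?\<psi> z \<bullet> n) / (d \<bullet> n) = t"
      using c orth[of y] by (simp add: Pair inner_diff_left inner_add_left)
    then have "?\<psi> z \<in> shadow d n (a \<bullet> n) F \<longleftrightarrow> 0 \<le> t \<and> y \<in> A"
      by (simp add: shadow_def Pair A(1))
    moreover have "g (?\<psi> z) = 0" if "y \<in> A" "T < t"
      using zero(1) beyond[of y t] that Pair by simp
    ultimately show ?thesis by (auto simp: indicator_def Pair)
  qed
  have borel_g [measurable]: "g \<in> borel_measurable borel"
    using g by (rule borel_measurable_continuous_onI)
  have borel_shadow: "shadow d n b F \<in> sets borel" for b
  proof -
    have [measurable]: "F \<in> sets borel" by (rule F)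
    show ?thesis unfolding shadow_def by measurable
  qed
  have cont: "continuous_on X (\<lambda>z. g (?\<psi> z))" for X
    by (intro continuous_on_compose2[OF g] continuous_intros) auto
  have int: "integrable lborel (\<lambda>z. indicator (A \<times> {0..T}) z * g (?\<psi> z))"
  proof -
    have "compact (closure A \<times> {0..T})"
      using A(3) by (intro compact_Times) (auto simp: compact_closure)
    then have "set_integrable lborel (closure A \<times> {0..T}) (\<lambda>z. g (?\<psi> z))"
      unfolding set_integrable_def
      using cont by (intro borel_integrable_compact)
    then have "set_integrable lborel (A \<times> {0..T}) (\<lambda>z. g (?\<psi> z))"
      using A(2) closure_subset by (rule_tac set_integrable_subset) (auto simp: borel_prod[symmetric])
    then show ?thesis by (simp add: set_integrable_def)
  qed
  show "integrable lborel (\<lambda>x. indicator (shadow d n (a \<bullet> n) F) x * g x)"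
    using borel_shadow int by (intro integrable_lborel_slant_coordinates[OF dim lin nrmL n orth c, where a=a])
      (auto simp: split_beta' sh)
  have "(\<integral>x. indicator (shadow d n (a \<bullet> n) F) x * g x \<partial>lborel)
      = \<bar>d \<bullet> n\<bar> * (\<integral>z. indicator (A \<times> {0..T}) z * g (?\<psi> z) \<partial>lborel)"
    using borel_shadow by (subst integral_lborel_slant_coordinates[OF dim lin nrmL n orth c, where a=a])
      (auto simp: split_beta' sh)
  also have "(\<integral>z. indicator (A \<times> {0..T}) z * g (?\<psi> z) \<partial>lborel)
      = (\<integral>y. (\<integral>t. indicator (A \<times> {0..T}) (y, t) * g (?\<psi> (y, t)) \<partial>lborel) \<partial>lborel)"
    using int by (subst lborel_pair.integral_fst') (simp_all add: lborel_prod)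
  also have "\<dots> = (\<integral>y. indicator A y * h (a + L y) \<partial>lborel)"
  proof (intro Bochner_Integration.integral_cong refl)
    fix y
    have "(\<integral>t. indicator (A \<times> {0..T}) (y, t) * g (?\<psi> (y, t)) \<partial>lborel)
        = indicator A y * (\<integral>t. g (a + L y - t *\<^sub>R d) * indicator {0..T} t \<partial>lborel)"
      by (subst integral_mult_right_zero[symmetric])
        (auto simp: indicator_def intro!: Bochner_Integration.integral_cong)
    also have "\<dots> = indicator A y * h (a + L y)"
    proof (cases "y \<in> A")
      case True
      \<comment> \<open>Time runs against \<open>d\<close>, so the antiderivative is - h, and the
        surviving boundary term is the one at t = 0.\<close>
      have "((\<lambda>t. - h (a + L y - t *\<^sub>R d)) has_real_derivative g (a + L y - t *\<^sub>R d)) (at t)" for t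
      proof -
        have "((\<lambda>t. - h (a + L y + (- t) *\<^sub>R d)) has_real_derivative - (g (a + L y + (- t) *\<^sub>R d) * (- 1))) (at t)"
          by (intro DERIV_minus DERIV_chain'[OF _ h] derivative_eq_intros) auto
        then show ?thesis by simp
      qed
      moreover have "isCont (\<lambda>t. g (a + L y - t *\<^sub>R d)) t" for t
      proof -
        have "continuous_on UNIV (\<lambda>t. g (a + L y - t *\<^sub>R d))"
          by (intro continuous_on_compose2[OF g] continuous_intros) auto
        then show ?thesis by (simp add: continuous_on_eq_continuous_at)
      qed
      ultimately have "(\<integral>t. g (a + L y - t *\<^sub>R d) * indicator {0..T} t \<partial>lborel)
          = - h (a + L y - T *\<^sub>R d) - - h (a + L y - 0 *\<^sub>R d)"
        using T0 by (intro integral_FTC_Icc_real) auto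
      also have "h (a + L y - T *\<^sub>R d) = 0"
        using beyond[OF True, of T] by (intro zero(2)) simp
      finally show ?thesis by simp
    qed simp
    finally show "(\<integral>t. indicator (A \<times> {0..T}) (y, t) * g (?\<psi> (y, t)) \<partial>lborel) = indicator A y * h (a + L y)" .
  qed
  finally show "(\<integral>x. indicator (shadow d n (a \<bullet> n) F) x * g x \<partial>lborel)
      = \<bar>d \<bullet> n\<bar> * (\<integral>y. indicator A y * h (a + L y) \<partial>lborel)" .
qed

subsection \<open>Regions with flat facets\<close>

text \<open>
  The sets in \<open>N\<close> have codimension at least 2, so almost every line of a given direction avoids them.
\<close>

locale faceted_region =
  fixes S :: "'a::euclidean_space set" and I :: "'i set"
    and F :: "'i \<Rightarrow> 'a set" and n :: "'i \<Rightarrow> 'a" and b :: "'i \<Rightarrow> real" and N :: "'a set set"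
  assumes finite_I: "finite I" and bounded_S: "bounded S" and open_S: "open S"
    and regular_S: "interior (closure S) \<subseteq> S"
    and norm_n: "i \<in> I \<Longrightarrow> norm (n i) = 1"
    and in_plane: "i \<in> I \<Longrightarrow> x \<in> F i \<Longrightarrow> x \<bullet> n i = b i"
    and rel_open: "i \<in> I \<Longrightarrow> x \<in> F i \<Longrightarrow> \<exists>e>0. \<forall>y \<in> ball x e. y \<bullet> n i = b i \<longrightarrow> y \<in> F i"
    and connected_F: "i \<in> I \<Longrightarrow> connected (F i)"
    and separated: "i \<in> I \<Longrightarrow> j \<in> I \<Longrightarrow> i \<noteq> j \<Longrightarrow> F i \<inter> closure (F j) = {}"
    and frontier_S: "frontier S = (\<Union>i\<in>I. closure (F i))"
    and skeleton: "i \<in> I \<Longrightarrow> closure (F i) - F i \<subseteq> \<Union>N"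
    and finite_N: "finite N"
    and dim_N: "M \<in> N \<Longrightarrow> aff_dim M \<le> int DIM('a) - 2"
begin

text \<open>The sign 1 says that \<open>n i\<close> is the outward normal at \<open>x\<close>, the
  sign -1 that it is the inward one.\<close>

definition side :: "'i \<Rightarrow> 'a \<Rightarrow> real \<Rightarrow> bool" where
  "side i x \<sigma> \<longleftrightarrow> (\<exists>e>0. \<forall>y \<in> ball x e.
     (\<sigma> * (y \<bullet> n i - b i) < 0 \<longrightarrow> y \<in> S) \<and> (\<sigma> * (y \<bullet> n i - b i) > 0 \<longrightarrow> y \<notin> S))"

text \<open>Phrased by moving along the normal so that it unfolds to \<open>omega_TF\<close> for the
  body and, in the chart of a face, to \<open>omega_FE\<close>.\<close>

definition orient :: "'i \<Rightarrow> real" where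
  "orient i = (if \<forall>x \<in> F i. \<forall>\<^sub>F s in at_right 0. x - s *\<^sub>R n i \<in> S \<and> x + s *\<^sub>R n i \<notin> S then 1 else - 1)"

lemma closure_in_plane: "i \<in> I \<Longrightarrow> x \<in> closure (F i) \<Longrightarrow> x \<bullet> n i = b i"
proof -
  assume i: "i \<in> I" and x: "x \<in> closure (F i)"
  have "closed {x. n i \<bullet> x = b i}" by (rule closed_hyperplane)
  then have "closure (F i) \<subseteq> {x. n i \<bullet> x = b i}"
    using in_plane[OF i] by (intro closure_minimal) (auto simp: inner_commute)
  then show ?thesis using x by (auto simp: inner_commute)
qed

lemma facet_in_frontier: "i \<in> I \<Longrightarrow> F i \<subseteq> frontier S"
  using frontier_S closure_subset by blast

lemma n_self: "i \<in> I \<Longrightarrow> n i \<bullet> n i = 1"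
  using norm_n by (simp add: norm_eq_1)

lemma open_in_plane_empty:
  assumes i: "i \<in> I" and U: "open U" "\<And>y. y \<in> U \<Longrightarrow> y \<bullet> n i = b i"
  shows "U = {}"
proof -
  have "n i \<noteq> 0" using norm_n[OF i] by auto
  then have "negligible {y. n i \<bullet> y = b i}" by (intro negligible_hyperplane) simp
  then have "negligible U" by (rule negligible_subset) (auto simp: U(2) inner_commute[of "n i"])
  then show ?thesis using open_not_negligible U(1) by blast
qed

text \<open>Near \<open>x\<close> the frontier lies in one plane, so each open half ball is a
  connected set that misses the frontier and is therefore inside or outside \<open>S\<close>. The
  halves cannot both be inside by regularity, nor both outside because \<open>x\<close> is in the
  closure of \<open>S\<close>.\<close>

lemma side_exists:
  assumes i: "i \<in> I" and x: "x \<in> F i"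
  shows "side i x 1 \<or> side i x (- 1)"
proof -
  \<comment> \<open>The closures of the other facets form a closed set that avoids \<open>x\<close>
    by \<open>separated\<close>; a small ball around \<open>x\<close> meets only the facet
    \<open>i\<close>.\<close>
  define C where "C = (\<Union>j\<in>I - {i}. closure (F j))"
  have "closed C" unfolding C_def using finite_I by (intro closed_UN) auto
  moreover have "x \<notin> C" unfolding C_def using separated[OF i] x by fastforce
  ultimately obtain e where e: "e > 0" "ball x e \<subseteq> - C"
    by (meson Compl_iff open_Compl open_contains_ball_eq)
  have flat: "y \<bullet> n i = b i" if "y \<in> ball x e" "y \<in> frontier S" for y
  proof -
    from that e have "y \<in> closure (F i)" unfolding C_def frontier_S by blast
    then show ?thesis by (rule closure_in_plane[OF i])
  qed
  define H where "H = (\<lambda>\<sigma>::real. ball x e \<inter> {y. \<sigma> * (y \<bullet> n i - b i) > 0})"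
  have H_side: "H \<sigma> \<subseteq> S \<or> H \<sigma> \<inter> S = {}" for \<sigma>
  proof -
    have "{y. \<sigma> * (y \<bullet> n i - b i) > 0} = {y. (\<sigma> *\<^sub>R n i) \<bullet> y > \<sigma> * b i}"
      by (auto simp: inner_commute right_diff_distrib)
    then have "convex (H \<sigma>)" unfolding H_def
      by (intro convex_Int convex_ball) (simp only: convex_halfspace_gt)
    then have "connected (H \<sigma>)" by (rule convex_connected)
    moreover have "H \<sigma> \<inter> frontier S = {}" using flat by (auto simp: H_def)
    ultimately show ?thesis using connected_Int_frontier[of "H \<sigma>" S] by blast
  qed
  have ball: "y \<bullet> n i = b i" if "y \<in> ball x e" "y \<notin> H 1" "y \<notin> H (-1)" for y
    using that by (fastforce simp: H_def)
  have x_front: "x \<in> closure S" "x \<notin> S"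
    using facet_in_frontier[OF i] x open_S by (auto simp: frontier_def interior_open)
  \<comment> \<open>Otherwise the facet would be a slit with \<open>S\<close> on both sides, which
    \<open>regular_S\<close> excludes.\<close>
  have not_both_in: "\<not> (H 1 \<subseteq> S \<and> H (-1) \<subseteq> S)"
  proof
    assume "H 1 \<subseteq> S \<and> H (-1) \<subseteq> S"
    then have "ball x e - closure S = {}"
      using ball closure_subset[of S] by (intro open_in_plane_empty[OF i]) (auto simp: open_Diff)
    then have "x \<in> interior (closure S)"
      using e(1) by (intro interiorI[of "ball x e"]) auto
    then show False using regular_S x_front by blast
  qed
  have not_both_out: "\<not> (H 1 \<inter> S = {} \<and> H (-1) \<inter> S = {})"
  proof
    assume "H 1 \<inter> S = {} \<and> H (-1) \<inter> S = {}"
    then have "ball x e \<inter> S = {}"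
      using ball open_S by (intro open_in_plane_empty[OF i]) auto
    then show False
      using x_front(1) e(1) open_Int_closure_eq_empty[OF open_ball, of x e S] centre_in_ball[of x e] by blast
  qed
  consider "H 1 \<subseteq> S" "H (-1) \<inter> S = {}" | "H (-1) \<subseteq> S" "H 1 \<inter> S = {}"
    using H_side[of 1] H_side[of "-1"] not_both_in not_both_out by blast
  then show ?thesis
  proof cases
    case 1
    then have "side i x (-1)" unfolding side_def using e(1)
      by (intro exI[of _ e]) (auto simp: H_def)
    then show ?thesis ..
  next
    case 2
    then have "side i x 1" unfolding side_def using e(1)
      by (intro exI[of _ e]) (auto simp: H_def)
    then show ?thesis ..
  qed
qed

lemma side_eventually:
  assumes i: "i \<in> I" and x: "x \<in> F i" and "side i x \<sigma>" and \<sigma>: "\<sigma> = 1 \<or> \<sigma> = - 1"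
  shows "\<forall>\<^sub>F s in at_right 0. x - (\<sigma> * s) *\<^sub>R n i \<in> S \<and> x + (\<sigma> * s) *\<^sub>R n i \<notin> S"
proof -
  obtain e where e: "e > 0" "\<And>y. y \<in> ball x e \<Longrightarrow>
     (\<sigma> * (y \<bullet> n i - b i) < 0 \<longrightarrow> y \<in> S) \<and> (\<sigma> * (y \<bullet> n i - b i) > 0 \<longrightarrow> y \<notin> S)"
    using assms(3) unfolding side_def by blast
  have "\<forall>\<^sub>F s in at_right (0::real). s < e" using e(1) by (rule order_tendstoD(2)[OF tendsto_ident_at])
  moreover have "\<forall>\<^sub>F s in at_right (0::real). s > 0" by (rule eventually_at_right_less)
  ultimately show ?thesis
  proof eventually_elim
    case (elim s)
    have ball: "x - (\<sigma> * s) *\<^sub>R n i \<in> ball x e" "x + (\<sigma> * s) *\<^sub>R n i \<in> ball x e"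
      using elim \<sigma> norm_n[OF i] by (auto simp: dist_norm)
    show ?case
      using e(2)[OF ball(1)] e(2)[OF ball(2)] elim in_plane[OF i x] n_self[OF i] \<sigma>
      by (auto simp: inner_add_left inner_diff_left)
  qed
qed

lemma side_unique:
  assumes i: "i \<in> I" and x: "x \<in> F i" and "side i x 1" and "side i x (- 1)"
  shows False
proof -
  have "\<forall>\<^sub>F s in at_right (0::real). False"
    using side_eventually[OF i x assms(3), simplified] side_eventually[OF i x assms(4), simplified]
    by eventually_elim auto
  then show False by (simp add: trivial_limit_at_right_real)
qed

text \<open>The sign for which \<open>side\<close> holds is locally constant along the facet and the
  facet is connected, so one number describes all its points.\<close>

lemma side_orient:
  assumes i: "i \<in> I" and x: "x \<in> F i"
  shows "side i x (orient i)"
proof -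
  have loc: "\<forall>\<^sub>F y in at x within F i. side i y \<sigma>" if "side i x \<sigma>" for x \<sigma>
  proof -
    obtain e where e: "e > 0" "\<forall>y \<in> ball x e.
       (\<sigma> * (y \<bullet> n i - b i) < 0 \<longrightarrow> y \<in> S) \<and> (\<sigma> * (y \<bullet> n i - b i) > 0 \<longrightarrow> y \<notin> S)"
      using \<open>side i x \<sigma>\<close> unfolding side_def by blast
    have "side i y \<sigma>" if "y \<in> ball x e" for y
    proof -
      obtain e' where "e' > 0" "ball y e' \<subseteq> ball x e"
        using \<open>y \<in> ball x e\<close> by (meson open_ball open_contains_ball)
      then show ?thesis using e unfolding side_def by blast
    qed
    then show ?thesis using e(1)
      by (auto simp: eventually_at dist_commute intro!: exI[of _ e])
  qed
  have const: "side i x 1 = side i y 1" if y: "y \<in> F i" for y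
  proof (rule connected_local_const[OF connected_F[OF i] x y], safe)
    fix z assume z: "z \<in> F i"
    have F: "\<forall>\<^sub>F w in at z within F i. w \<in> F i" by (simp add: eventually_at_filter)
    show "\<forall>\<^sub>F w in at z within F i. side i z 1 = side i w 1"
    proof (cases "side i z 1")
      case True
      then show ?thesis using loc[OF True] by (auto elim: eventually_mono)
    next
      case False
      then have "side i z (-1)" using side_exists[OF i z] by blast
      from loc[OF this] F show ?thesis
        by eventually_elim (use False side_unique[OF i] in blast)
    qed
  qed
  show ?thesis
  proof (cases "side i x 1")
    case True
    then have "\<forall>y \<in> F i. \<forall>\<^sub>F s in at_right 0. y - s *\<^sub>R n i \<in> S \<and> y + s *\<^sub>R n i \<notin> S"
      using const side_eventually[OF i, of _ 1] by simp
    then show ?thesis using True by (simp add: orient_def)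
  next
    case False
    then have m: "side i x (-1)" using side_exists[OF i x] by blast
    have "\<not> (\<forall>\<^sub>F s in at_right 0. x - s *\<^sub>R n i \<in> S \<and> x + s *\<^sub>R n i \<notin> S)"
    proof
      assume "\<forall>\<^sub>F s in at_right 0. x - s *\<^sub>R n i \<in> S \<and> x + s *\<^sub>R n i \<notin> S"
      with side_eventually[OF i x m, simplified] have "\<forall>\<^sub>F s in at_right (0::real). False"
        by eventually_elim auto
      then show False by (simp add: trivial_limit_at_right_real)
    qed
    then have "orient i = -1" using x unfolding orient_def by auto
    then show ?thesis using m by simp
  qed
qed

end

section \<open>Following a line through the region\<close>

lemma negligible_line_sweep:
  fixes M :: "'a::euclidean_space set"
  assumes "aff_dim M \<le> int DIM('a) - 2"
  shows "\<exists>H. closed H \<and> negligible H \<and> (\<forall>x t. x + t *\<^sub>R d \<in> M \<longrightarrow> x \<in> H)"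
proof (cases "M = {}")
  case True
  then show ?thesis by (intro exI[of _ "{}"]) auto
next
  case False
  then obtain p where p: "p \<in> M" by blast
  \<comment> \<open>The extra point p + d adds the direction \<open>d\<close> to the hull of
    \<open>M\<close>, so the hull contains all lines in direction \<open>d\<close> that meet
    \<open>M\<close>. Its dimension grows by at most one and stays below that of the space.\<close>
  let ?H = "affine hull (insert (p + d) M)"
  have "aff_dim ?H < int DIM('a)"
    using assms by (simp add: aff_dim_insert)
  then obtain u c where "u \<noteq> 0" "?H \<subseteq> {x. u \<bullet> x = c}"
    using aff_lowdim_subset_hyperplane by blast
  then have "negligible ?H"
    by (intro negligible_subset[OF negligible_hyperplane]) auto
  moreover have "x \<in> ?H" if "x + t *\<^sub>R d \<in> M" for x t
  proof -
    have "x = 1 *\<^sub>R (x + t *\<^sub>R d) + t *\<^sub>R p + (- t) *\<^sub>R (p + d)" by (simp add: algebra_simps)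
    also have "\<dots> \<in> ?H"
      using that p by (intro mem_affine_3[OF affine_affine_hull]) (auto intro: hull_inc)
    finally show ?thesis .
  qed
  ultimately show ?thesis by (intro exI[of _ ?H]) auto
qed

text \<open>The value at t itself is left out because \<open>defect\<close> has the wrong value at
  the very moment of an exit from \<open>S\<close>. Neighbouring local constants agree, and
  connectedness of the real line makes them all equal.\<close>

lemma eventually_const_imp_const:
  fixes D :: "real \<Rightarrow> 'c"
  assumes "\<And>t. \<exists>c. \<forall>\<^sub>F s in at t. D s = c"
  shows "\<exists>c. \<forall>t. \<forall>\<^sub>F s in at t. D s = c"
proof -
  obtain C where C: "\<And>t. \<forall>\<^sub>F s in at t. D s = C t" using assms by metis
  have "C s = C t" for s t
  proof (rule connected_local_const[of UNIV], safe)
    fix t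
    obtain U where U: "open U" "t \<in> U" "\<And>s. s \<in> U \<Longrightarrow> s \<noteq> t \<Longrightarrow> D s = C t"
      using C[of t] unfolding eventually_at_topological by blast
    have "C t = C s" if "s \<in> U" for s
    proof (cases "s = t")
      case False
      have "\<forall>\<^sub>F r in at s. D r = C t"
        unfolding eventually_at_topological using U False that
        by (intro exI[of _ "U - {t}"]) auto
      with C[of s] have "\<forall>\<^sub>F r in at s. C t = C s" by eventually_elim simp
      then show ?thesis by simp
    qed simp
    then show "\<forall>\<^sub>F s in at t. C t = C s"
      unfolding eventually_at_topological using U by blast
  qed auto
  then show ?thesis using C by metis
qed

context faceted_region
begin

abbreviation shadow_of :: "'a \<Rightarrow> 'i \<Rightarrow> 'a set" where
  "shadow_of d i \<equiv> shadow d (n i) (b i) (F i)"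

definition hit :: "'a \<Rightarrow> 'a \<Rightarrow> 'i \<Rightarrow> real" where
  "hit d x i = (b i - x \<bullet> n i) / (d \<bullet> n i)"

definition transversal :: "'a \<Rightarrow> 'i set" where
  "transversal d = {i \<in> I. d \<bullet> n i \<noteq> 0}"

text \<open>This is 1 if lines in direction \<open>d\<close> leave \<open>S\<close> through the
  facet and -1 if they enter.\<close>

abbreviation exit_sign :: "'a \<Rightarrow> 'i \<Rightarrow> real" where
  "exit_sign d i \<equiv> sgn (orient i * (d \<bullet> n i))"

lemma in_shadow_line:
  assumes "d \<bullet> n i \<noteq> 0"
  shows "x + t *\<^sub>R d \<in> shadow_of d i \<longleftrightarrow> t \<le> hit d x i \<and> x + hit d x i *\<^sub>R d \<in> F i"
proof -
  have time: "(b i - (x + t *\<^sub>R d) \<bullet> n i) / (d \<bullet> n i) = hit d x i - t"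
    using assms by (simp add: hit_def inner_add_left field_simps)
  have point: "x + t *\<^sub>R d + (hit d x i - t) *\<^sub>R d = x + hit d x i *\<^sub>R d"
    by (simp add: algebra_simps)
  show ?thesis unfolding shadow_def mem_Collect_eq time point by simp
qed

lemma hit_time:
  assumes "d \<bullet> n i \<noteq> 0" and "(x + t *\<^sub>R d) \<bullet> n i = b i"
  shows "t = hit d x i"
  using assms by (simp add: hit_def field_simps inner_add_left)

abbreviation shadow_term :: "'a \<Rightarrow> 'i \<Rightarrow> 'a \<Rightarrow> real" where
  "shadow_term d i x \<equiv> exit_sign d i * indicator (shadow_of d i) x"

text \<open>The two sides of the shadow identity, compared along the line through x. The identity at
  x is the case t = 0, but its proof compares x with points far out on the line.\<close>

definition defect :: "'a \<Rightarrow> 'a \<Rightarrow> real \<Rightarrow> real" where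
  "defect d x t = indicator S (x + t *\<^sub>R d)
     - (\<Sum>i\<in>transversal d. shadow_term d i (x + t *\<^sub>R d))"

lemma finite_transversal: "finite (transversal d)"
  using finite_I by (simp add: transversal_def)

text \<open>Along a line, membership in a shadow changes only at the hitting time, and only if the
  point hit belongs to the facet.\<close>

lemma shadow_term_locally_const:
  assumes "i \<in> transversal d" and "x + t *\<^sub>R d \<notin> F i"
  shows "\<forall>\<^sub>F s in at t. indicator (shadow_of d i) (x + s *\<^sub>R d)
           = (indicator (shadow_of d i) (x + t *\<^sub>R d) :: real)"
proof -
  have c: "d \<bullet> n i \<noteq> 0" using assms(1) by (simp add: transversal_def)
  show ?thesis
  proof (cases "x + hit d x i *\<^sub>R d \<in> F i")
    case True
    with assms(2) have "t \<noteq> hit d x i" by auto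
    then consider "t < hit d x i" | "t > hit d x i" by linarith
    then show ?thesis
    proof cases
      case 1
      then have "\<forall>\<^sub>F s in at t. s < hit d x i" by (intro order_tendstoD(2)[OF tendsto_ident_at])
      then show ?thesis by eventually_elim (use 1 in \<open>simp add: indicator_def in_shadow_line[OF c]\<close>)
    next
      case 2
      then have "\<forall>\<^sub>F s in at t. s > hit d x i" by (intro order_tendstoD(1)[OF tendsto_ident_at])
      then show ?thesis by eventually_elim (use 2 in \<open>simp add: indicator_def in_shadow_line[OF c]\<close>)
    qed
  next
    case False
    then show ?thesis by (simp add: indicator_def in_shadow_line[OF c])
  qed
qed

lemma shadow_sum_locally_const:
  assumes "J \<subseteq> transversal d" and "\<And>i. i \<in> J \<Longrightarrow> x + t *\<^sub>R d \<notin> F i"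
  shows "\<forall>\<^sub>F s in at t. (\<Sum>i\<in>J. shadow_term d i (x + s *\<^sub>R d))
           = (\<Sum>i\<in>J. shadow_term d i (x + t *\<^sub>R d))"
proof -
  have "finite J" using assms(1) finite_transversal by (rule finite_subset)
  then have "\<forall>\<^sub>F s in at t. \<forall>i\<in>J. indicator (shadow_of d i) (x + s *\<^sub>R d)
           = (indicator (shadow_of d i) (x + t *\<^sub>R d) :: real)"
    using assms by (intro eventually_ball_finite ballI shadow_term_locally_const) auto
  then show ?thesis by eventually_elim simp
qed

lemma line_tendsto:
  fixes x d :: "'c::real_normed_vector"
  shows "((\<lambda>s. x + s *\<^sub>R d) \<longlongrightarrow> x + t *\<^sub>R d) (at t)"
  by (intro tendsto_intros)

lemma defect_locally_const_off_frontier: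
  assumes "x + t *\<^sub>R d \<notin> frontier S"
  shows "\<forall>\<^sub>F s in at t. defect d x s = defect d x t"
proof -
  have "\<forall>\<^sub>F s in at t. indicator S (x + s *\<^sub>R d) = (indicator S (x + t *\<^sub>R d) :: real)"
  proof (cases "x + t *\<^sub>R d \<in> S")
    case True
    then have "\<forall>\<^sub>F s in at t. x + s *\<^sub>R d \<in> S"
      by (intro topological_tendstoD[OF line_tendsto] open_S)
    then show ?thesis by eventually_elim (use True in simp)
  next
    case False
    then have "x + t *\<^sub>R d \<in> - closure S"
      using assms open_S by (auto simp: frontier_def interior_open)
    then have "\<forall>\<^sub>F s in at t. x + s *\<^sub>R d \<in> - closure S"
      by (intro topological_tendstoD[OF line_tendsto]) auto
    then show ?thesis
      by eventually_elim (use False closure_subset[of S] in \<open>auto simp: indicator_def\<close>)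
  qed
  moreover have "x + t *\<^sub>R d \<notin> F i" if "i \<in> transversal d" for i
    using that assms facet_in_frontier[of i] by (auto simp: transversal_def)
  then have "\<forall>\<^sub>F s in at t. (\<Sum>i\<in>transversal d. shadow_term d i (x + s *\<^sub>R d))
           = (\<Sum>i\<in>transversal d. shadow_term d i (x + t *\<^sub>R d))"
    by (intro shadow_sum_locally_const) auto
  ultimately show ?thesis by eventually_elim (simp add: defect_def)
qed

text \<open>At a facet the jumps of the two terms of \<open>defect\<close> cancel, and far out both terms vanish.\<close>

lemma defect_vanishes:
  assumes "d \<noteq> 0" and off_planes: "\<And>i. i \<in> I \<Longrightarrow> x \<bullet> n i \<noteq> b i"
    and off_skeleton: "\<And>M t. M \<in> N \<Longrightarrow> x + t *\<^sub>R d \<notin> M"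
  shows "defect d x 0 = 0"
proof -
  have "\<exists>c. \<forall>\<^sub>F s in at t. defect d x s = c" for t
  proof (cases "x + t *\<^sub>R d \<in> frontier S")
    case False
    then show ?thesis using defect_locally_const_off_frontier by blast
  next
    case True
    then obtain i where i: "i \<in> I" "x + t *\<^sub>R d \<in> closure (F i)" using frontier_S by blast
    \<comment> \<open>A point of the closed facet outside the open one would lie in the skeleton,
      which this line avoids.\<close>
    then have iF: "x + t *\<^sub>R d \<in> F i" using skeleton[OF i(1)] off_skeleton by blast
    \<comment> \<open>The next step excludes a tangential meeting: if \<open>d\<close> were parallel
      to the plane reached here, \<open>x\<close> would already lie in it.\<close>
    have plane: "(x + t *\<^sub>R d) \<bullet> n i = b i" by (rule in_plane[OF i(1) iF])
    have c: "d \<bullet> n i \<noteq> 0"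
      using plane off_planes[OF i(1)] by (auto simp: inner_add_left)
    have iT: "i \<in> transversal d" using i(1) c by (simp add: transversal_def)
    have hit: "hit d x i = t" using hit_time[OF c plane] by simp
    let ?J = "transversal d - {i}"
    let ?f = "\<lambda>j s. shadow_term d j (x + s *\<^sub>R d)"
    have "x + t *\<^sub>R d \<notin> F j" if "j \<in> ?J" for j
      using separated[of i j] i iF that closure_subset[of "F j"] by (auto simp: transversal_def)
    then have rest: "\<forall>\<^sub>F s in at t. (\<Sum>j\<in>?J. ?f j s) = (\<Sum>j\<in>?J. ?f j t)"
      by (intro shadow_sum_locally_const) auto
    obtain e where e: "e > 0" "\<And>y. y \<in> ball (x + t *\<^sub>R d) e \<Longrightarrow>
       (orient i * (y \<bullet> n i - b i) < 0 \<longrightarrow> y \<in> S) \<and> (orient i * (y \<bullet> n i - b i) > 0 \<longrightarrow> y \<notin> S)"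
      using side_orient[OF i(1) iF] unfolding side_def by blast
    have "\<forall>\<^sub>F s in at t. x + s *\<^sub>R d \<in> ball (x + t *\<^sub>R d) e"
      using e(1) by (intro topological_tendstoD[OF line_tendsto]) auto
    moreover have "\<forall>\<^sub>F s in at t. s \<noteq> t" by (simp add: eventually_at_filter)
    \<comment> \<open>At an exit, indicator and shadow term both drop from 1 to 0, and their
      difference is 0 on both sides. At an entry the difference is 1 on both sides: before it the
      shadow term is -1, after it the indicator is 1.\<close>
    ultimately have "\<forall>\<^sub>F s in at t. defect d x s
        = (if orient i * (d \<bullet> n i) > 0 then 0 else 1) - (\<Sum>j\<in>?J. ?f j t)"
      using rest
    proof eventually_elim
      case (elim s)
      have y: "orient i * ((x + s *\<^sub>R d) \<bullet> n i - b i) = (orient i * (d \<bullet> n i)) * (s - t)"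
      proof -
        have "(x + s *\<^sub>R d) \<bullet> n i - b i = (d \<bullet> n i) * (s - t)"
          using plane by (simp add: inner_add_left algebra_simps)
        then show ?thesis by simp
      qed
      have nz: "orient i * (d \<bullet> n i) \<noteq> 0" using c by (simp add: orient_def)
      have "indicator S (x + s *\<^sub>R d) - ?f i s = (if orient i * (d \<bullet> n i) > 0 then 0 else 1)"
        using e(2)[OF elim(1)] elim(2) nz iF unfolding y
        by (cases "s < t"; cases "orient i * (d \<bullet> n i) > 0")
          (auto simp: indicator_def in_shadow_line[OF c] hit mult_less_0_iff zero_less_mult_iff not_less)
      moreover have "(\<Sum>j\<in>transversal d. ?f j s) = ?f i s + (\<Sum>j\<in>?J. ?f j s)"
        using iT finite_transversal by (rule sum.remove[rotated])
      ultimately show ?case using elim(3) by (simp add: defect_def)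
    qed
    then show ?thesis by blast
  qed
  then obtain c where c: "\<And>t. \<forall>\<^sub>F s in at t. defect d x s = c"
    using eventually_const_imp_const[of "defect d x"] by blast
  obtain R where R: "\<And>y. y \<in> S \<Longrightarrow> norm y \<le> R" using bounded_S by (auto simp: bounded_iff)
  \<comment> \<open>After time \<open>T\<close> the line has left the bounded set \<open>S\<close>,
    by the first summand, and has passed all hitting times, by the second.\<close>
  define T where "T = \<bar>(R + norm x) / norm d\<bar> + (\<Sum>i\<in>transversal d. \<bar>hit d x i\<bar>)"
  have "defect d x s = 0" if "s > T" for s
  proof -
    have "(\<Sum>i\<in>transversal d. \<bar>hit d x i\<bar>) \<ge> 0" by (intro sum_nonneg) auto
    then have "s > \<bar>(R + norm x) / norm d\<bar>" using that unfolding T_def by linarith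
    then have "s > 0" "s > (R + norm x) / norm d" by linarith+
    then have "s * norm d > R + norm x" using \<open>d \<noteq> 0\<close> by (simp add: divide_less_eq)
    moreover have "s * norm d \<le> norm (x + s *\<^sub>R d) + norm x"
      using norm_triangle_ineq4[of "x + s *\<^sub>R d" x] \<open>s > 0\<close> by simp
    ultimately have "x + s *\<^sub>R d \<notin> S" using R by force
    moreover have "x + s *\<^sub>R d \<notin> shadow_of d i" if i: "i \<in> transversal d" for i
    proof -
      have "\<bar>hit d x i\<bar> \<le> (\<Sum>i\<in>transversal d. \<bar>hit d x i\<bar>)"
        using finite_transversal i by (intro member_le_sum) auto
      then have "hit d x i < s" using \<open>s > T\<close> unfolding T_def by linarith
      then show ?thesis using i by (simp add: in_shadow_line transversal_def)
    qed
    ultimately show ?thesis by (simp add: defect_def)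
  qed
  then have "\<forall>\<^sub>F s in at (T + 1). defect d x s = 0"
    by (intro eventually_mono[OF order_tendstoD(1)[OF tendsto_ident_at, of T "T + 1"]]) auto
  with c[of "T + 1"] have "\<forall>\<^sub>F s in at (T + 1). c = 0" by eventually_elim simp
  then have "c = 0" by simp
  \<comment> \<open>The common constant ignores values at single times. It is transferred to t = 0
    because \<open>x\<close> is off the frontier, where \<open>defect\<close> is locally constant
    including its centre.\<close>
  have "x + 0 *\<^sub>R d \<notin> frontier S"
    using off_planes closure_in_plane frontier_S by auto
  from defect_locally_const_off_frontier[OF this] c[of 0]
  have "\<forall>\<^sub>F s in at (0::real). defect d x 0 = c" by eventually_elim simp
  then show ?thesis using \<open>c = 0\<close> by simp
qed

text \<open>\<open>defect_vanishes\<close> asks that \<open>x\<close> be off the planes of the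
  facets and its line off the skeleton. The exceptions lie in finitely many hyperplanes and swept
  sets, all of them null.\<close>

lemma AE_indicator_eq_shadows:
  assumes "d \<noteq> 0"
  shows "AE x in lborel. indicator S x
    = (\<Sum>i\<in>transversal d. shadow_term d i x)"
proof -
  have "\<forall>M\<in>N. \<exists>H. closed H \<and> negligible H \<and> (\<forall>x t. x + t *\<^sub>R d \<in> M \<longrightarrow> x \<in> H)"
    using negligible_line_sweep dim_N by blast
  then obtain H where H: "\<And>M. M \<in> N \<Longrightarrow> closed (H M) \<and> negligible (H M) \<and> (\<forall>x t. x + t *\<^sub>R d \<in> M \<longrightarrow> x \<in> H M)"
    by metis
  have "AE x in lborel. x \<notin> H M" if "M \<in> N" for M
    using H[OF that] by (intro AE_not_in) (auto simp: negligible_iff_null_sets null_sets_completion_iff)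
  then have 1: "AE x in lborel. \<forall>M\<in>N. x \<notin> H M"
    using finite_N by (intro AE_finite_allI) auto
  have "AE x in lborel. x \<bullet> n i \<noteq> b i" if "i \<in> I" for i
  proof -
    have "n i \<noteq> 0" using norm_n[OF that] by auto
    then have "negligible {x. n i \<bullet> x = b i}" by (intro negligible_hyperplane) auto
    then have "AE x in lborel. x \<notin> {x. n i \<bullet> x = b i}"
      by (intro AE_not_in) (simp add: negligible_iff_null_sets null_sets_completion_iff closed_hyperplane)
    then show ?thesis by (simp add: inner_commute)
  qed
  then have 2: "AE x in lborel. \<forall>i\<in>I. x \<bullet> n i \<noteq> b i"
    using finite_I by (intro AE_finite_allI) auto
  from 1 2 show ?thesis
  proof eventually_elim
    case (elim x)
    then have "defect d x 0 = 0"
      using H by (intro defect_vanishes assms) blast+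
    then show ?case by (simp add: defect_def)
  qed
qed

section \<open>Integrating the shadow identity\<close>

lemma F_borel:
  assumes i: "i \<in> I"
  shows "F i \<in> sets borel"
proof -
  have "openin (top_of_set {x. n i \<bullet> x = b i}) (F i)"
    using rel_open[OF i] in_plane[OF i] unfolding openin_contains_ball
    by (fastforce simp: inner_commute)
  then obtain U where "open U" "F i = {x. n i \<bullet> x = b i} \<inter> U" by (auto simp: openin_open)
  then show ?thesis by (auto simp: closed_hyperplane)
qed

text \<open>The shadow identity is multiplied by \<open>g\<close> and integrated. The sign of a
  facet and its Jacobian |d . n| combine to the flux factor orient (d . n), since
  \<open>orient\<close> is 1 or -1; facets parallel to \<open>d\<close> have factor 0 and can be put
  back into the sum.\<close>

lemma integral_directional_derivative_cutoff:
  fixes L :: "'i \<Rightarrow> 'b::euclidean_space \<Rightarrow> 'a" and g h :: "'a \<Rightarrow> real"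
  assumes dim: "DIM('a) = Suc DIM('b)"
    and lin: "\<And>i. i \<in> I \<Longrightarrow> linear (L i)" and nrmL: "\<And>i y. i \<in> I \<Longrightarrow> norm (L i y) = norm y"
    and orth: "\<And>i y. i \<in> I \<Longrightarrow> L i y \<bullet> n i = 0" and a: "\<And>i. i \<in> I \<Longrightarrow> a i \<bullet> n i = b i"
    and g: "continuous_on UNIV g"
    and h: "\<And>x t. ((\<lambda>t. h (x + t *\<^sub>R d)) has_real_derivative g (x + t *\<^sub>R d)) (at t)"
    and zero: "\<And>x. x \<bullet> d \<le> M \<Longrightarrow> g x = 0" "\<And>x. x \<bullet> d \<le> M \<Longrightarrow> h x = 0"
    and "d \<noteq> 0"
  shows "(\<integral>x. indicator S x * g x \<partial>lborel) = (\<Sum>i\<in>I. orient i * (d \<bullet> n i) *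
           (\<integral>y. indicator ((\<lambda>y. a i + L i y) -` F i) y * h (a i + L i y) \<partial>lborel))"
proof -
  let ?J = "\<lambda>i. \<integral>x. indicator (shadow_of d i) x * g x \<partial>lborel"
  let ?A = "\<lambda>i. (\<lambda>y. a i + L i y) -` F i"
  let ?I = "\<lambda>i. \<integral>y. indicator (?A i) y * h (a i + L i y) \<partial>lborel"
  have A: "open (?A i)" "bounded (?A i)" if i: "i \<in> I" for i
  proof -
    have dist: "dist (a i + L i y) (a i + L i z) = dist y z" for y z
      using lin[OF i] nrmL[OF i] by (simp add: dist_norm linear_diff[symmetric])
    show "open (?A i)"
      unfolding open_contains_ball
    proof safe
      fix y assume y: "a i + L i y \<in> F i"
      obtain e where e: "e > 0" "\<forall>z\<in>ball (a i + L i y) e. z \<bullet> n i = b i \<longrightarrow> z \<in> F i"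
        using rel_open[OF i y] by blast
      then have "ball y e \<subseteq> ?A i"
        using dist orth[OF i] a[OF i] by (auto simp: inner_add_left)
      then show "\<exists>e>0. ball y e \<subseteq> ?A i" using e(1) by blast
    qed
    have "bounded (F i)"
      using facet_in_frontier[OF i] bounded_closure[OF bounded_S]
      by (auto simp: frontier_def intro: bounded_subset)
    then obtain R where R: "\<And>x. x \<in> F i \<Longrightarrow> norm x \<le> R" by (auto simp: bounded_iff)
    have "norm y \<le> R + norm (a i)" if "y \<in> ?A i" for y
      using norm_triangle_ineq4[of "a i + L i y" "a i"] R[of "a i + L i y"] that nrmL[OF i, of y] by simp
    then show "bounded (?A i)" by (auto simp: bounded_iff)
  qed
  have facet: "integrable lborel (\<lambda>x. indicator (shadow_of d i) x * g x)"
      "?J i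
        = \<bar>d \<bullet> n i\<bar> * ?I i"
    if "i \<in> transversal d" for i
  proof -
    have i: "i \<in> I" and c: "d \<bullet> n i \<noteq> 0" using that by (auto simp: transversal_def)
    note * = dim lin[OF i] nrmL[OF i] norm_n[OF i] orth[OF i] c refl A[OF i] F_borel[OF i] g h zero
    show "integrable lborel (\<lambda>x. indicator (shadow_of d i) x * g x)"
      using integrable_shadow[OF *] a[OF i] by simp
    show "?J i
        = \<bar>d \<bullet> n i\<bar> * ?I i"
      using integral_shadow[OF *] a[OF i] by simp
  qed
  have [measurable]: "g \<in> borel_measurable borel"
    using g by (rule borel_measurable_continuous_onI)
  have "AE x in lborel. indicator S x * g x
      = (\<Sum>i\<in>transversal d. exit_sign d i * (indicator (shadow_of d i) x * g x))"
    using AE_indicator_eq_shadows[OF \<open>d \<noteq> 0\<close>]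
    by eventually_elim (simp add: sum_distrib_right mult.assoc)
  then have "(\<integral>x. indicator S x * g x \<partial>lborel)
      = (\<integral>x. (\<Sum>i\<in>transversal d. exit_sign d i * (indicator (shadow_of d i) x * g x)) \<partial>lborel)"
    using open_S facet(1)
    by (intro integral_cong_AE borel_measurable_integrable[OF Bochner_Integration.integrable_sum]) auto
  also have "\<dots> = (\<Sum>i\<in>transversal d. exit_sign d i * ?J i)"
    using facet(1) by (subst Bochner_Integration.integral_sum) auto
  also have "\<dots> = (\<Sum>i\<in>transversal d. orient i * (d \<bullet> n i) *
           ?I i)"
  proof (intro sum.cong refl)
    fix i assume i: "i \<in> transversal d"
    have "exit_sign d i * \<bar>d \<bullet> n i\<bar> = orient i * (d \<bullet> n i)"
      by (simp add: orient_def sgn_mult sgn_if)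
    then show "exit_sign d i * ?J i
        = orient i * (d \<bullet> n i) * ?I i"
      by (simp only: facet(2)[OF i] mult.assoc[symmetric])
  qed
  also have "\<dots> = (\<Sum>i\<in>I. orient i * (d \<bullet> n i) *
           ?I i)"
    using finite_I by (intro sum.mono_neutral_left) (auto simp: transversal_def)
  finally show ?thesis .
qed

text \<open>This is the divergence theorem for the field f d with constant \<open>d\<close>. Both
  sides see \<open>f\<close> and \<open>g\<close> only on the closure of \<open>S\<close>, so
  \<open>f\<close> may be multiplied by a function that is 1 there and 0 far back along
  \<open>d\<close>.\<close>

theorem integral_directional_derivative:
  fixes L :: "'i \<Rightarrow> 'b::euclidean_space \<Rightarrow> 'a" and f g :: "'a \<Rightarrow> real"
  assumes dim: "DIM('a) = Suc DIM('b)"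
    and lin: "\<And>i. i \<in> I \<Longrightarrow> linear (L i)" and nrmL: "\<And>i y. i \<in> I \<Longrightarrow> norm (L i y) = norm y"
    and orth: "\<And>i y. i \<in> I \<Longrightarrow> L i y \<bullet> n i = 0" and a: "\<And>i. i \<in> I \<Longrightarrow> a i \<bullet> n i = b i"
    and f: "continuous_on UNIV f" and g: "continuous_on UNIV g"
    and deriv: "\<And>x t. ((\<lambda>t. f (x + t *\<^sub>R d)) has_real_derivative g (x + t *\<^sub>R d)) (at t)"
  shows "(\<integral>x. indicator S x * g x \<partial>lborel) = (\<Sum>i\<in>I. orient i * (d \<bullet> n i) *
           (\<integral>y. indicator ((\<lambda>y. a i + L i y) -` F i) y * f (a i + L i y) \<partial>lborel))"
proof (cases "d = 0")
  case True
  have "g x = 0" for x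
    using deriv[of x 0] DERIV_const[of "f x" "at 0"] DERIV_unique[of "\<lambda>t. f x" "g x" 0 0]
    by (simp add: True)
  then show ?thesis by (simp add: True)
next
  case False
  obtain R where R: "\<And>y. y \<in> closure S \<Longrightarrow> norm y \<le> R"
    using bounded_closure[OF bounded_S] by (auto simp: bounded_iff)
  \<comment> \<open>On the closure of \<open>S\<close> one has x . d >= - R |d| = M + 1, so the
    argument x . d - M of the cutoff is at least 1.\<close>
  define M where "M = - R * norm d - 1"
  text \<open>A cutoff in direction \<open>d\<close>, needed because the shadows are unbounded.\<close>
  define m :: "real \<Rightarrow> real" where "m s = (max 0 s)\<^sup>2" for s
  \<comment> \<open>Since \<open>m\<close> vanishes for s <= 0 and is at least 1 for s >= 1, this is
    a continuously differentiable step from 0 to 1 on [0, 1].\<close>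
  define \<theta> where "\<theta> s = 1 - m (1 - m s)" for s
  define \<theta>' where "\<theta>' s = 2 * max 0 (1 - m s) * (2 * max 0 s)" for s
  \<comment> \<open>At the kink of \<open>max\<close> the chain rule gives nothing, so the remainder
    is estimated directly: in all sign cases it is at most (y - s)^2.\<close>
  have m: "(m has_real_derivative 2 * max 0 s) (at s)" for s
    unfolding has_field_derivative_def has_derivative_at2
  proof (intro conjI)
    have bound: "norm (m y - (m s + 2 * max 0 s * (y - s))) \<le> \<bar>y - s\<bar> * \<bar>y - s\<bar>" for y
    proof -
      have sq: "\<bar>y - s\<bar> * \<bar>y - s\<bar> = y * y - 2 * (s * y) + s * s" by (simp add: algebra_simps)
      have d: "m y - (m s + 2 * max 0 s * (y - s))
          = (if 0 \<le> s then if 0 \<le> y then y * y - 2 * (s * y) + s * s else s * s - 2 * (s * y)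
             else if 0 \<le> y then y * y else 0)"
        by (simp add: m_def power2_eq_square algebra_simps)
      have "s * y \<le> 0" if "(0 \<le> s) \<noteq> (0 \<le> y)" using that by (auto simp: mult_le_0_iff)
      then show ?thesis
        using zero_le_square[of s] zero_le_square[of y] zero_le_square[of "\<bar>y - s\<bar>"]
        unfolding real_norm_def d sq by (cases "0 \<le> s"; cases "0 \<le> y") (simp_all only: if_True if_False simp_thms, linarith+)
    qed
    show "(\<lambda>y. (1 / norm (y - s)) *\<^sub>R (m y - (m s + 2 * max 0 s * (y - s)))) \<midarrow>s\<rightarrow> 0"
    proof (rule Lim_null_comparison, rule always_eventually, rule allI)
      show "norm ((1 / norm (y - s)) *\<^sub>R (m y - (m s + 2 * max 0 s * (y - s)))) \<le> \<bar>y - s\<bar>" for y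
        using bound[of y] by (cases "y = s") (simp_all add: divide_le_eq)
      have "((\<lambda>y. \<bar>y - s\<bar>) \<longlongrightarrow> \<bar>s - s\<bar>) (at s)" by (intro tendsto_intros)
      then show "((\<lambda>y. \<bar>y - s\<bar>) \<longlongrightarrow> 0) (at s)" by simp
    qed
  qed (simp add: bounded_linear_mult_right)
  have \<theta>_deriv: "(\<theta> has_real_derivative \<theta>' s) (at s)" for s
    unfolding \<theta>_def \<theta>'_def by (auto intro!: derivative_eq_intros DERIV_chain'[OF _ m] m)
  have cont_\<theta>: "continuous_on UNIV \<theta>" "continuous_on UNIV \<theta>'"
    unfolding \<theta>_def \<theta>'_def by (auto simp: m_def intro!: continuous_intros)
  have \<theta>_0: "\<theta> s = 0" "\<theta>' s = 0" if "s \<le> 0" for s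
    using that by (auto simp: \<theta>_def \<theta>'_def m_def)
  have \<theta>_1: "\<theta> s = 1" "\<theta>' s = 0" if "s \<ge> 1" for s
    using that by (auto simp: \<theta>_def \<theta>'_def m_def)
  define h where "h x = f x * \<theta> (x \<bullet> d - M)" for x
  define g' where "g' x = g x * \<theta> (x \<bullet> d - M) + f x * (\<theta>' (x \<bullet> d - M) * (d \<bullet> d))" for x
  have on_closure: "h x = f x" "g' x = g x" if "x \<in> closure S" for x
  proof -
    have "\<bar>x \<bullet> d\<bar> \<le> norm x * norm d" by (rule Cauchy_Schwarz_ineq2)
    also have "\<dots> \<le> R * norm d" using R[OF that] by (simp add: mult_right_mono)
    finally have "x \<bullet> d - M \<ge> 1" by (simp add: M_def)
    then show "h x = f x" "g' x = g x" by (simp_all add: h_def g'_def \<theta>_1)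
  qed
  have "(\<integral>x. indicator S x * g' x \<partial>lborel) = (\<Sum>i\<in>I. orient i * (d \<bullet> n i) *
           (\<integral>y. indicator ((\<lambda>y. a i + L i y) -` F i) y * h (a i + L i y) \<partial>lborel))"
  proof (rule integral_directional_derivative_cutoff[OF dim lin nrmL orth a _ _ _ _ False, where M=M])
    show "continuous_on UNIV g'"
      unfolding g'_def
      by (intro continuous_intros f g continuous_on_compose2[OF cont_\<theta>(1)] continuous_on_compose2[OF cont_\<theta>(2)]) auto
    show "((\<lambda>t. h (x + t *\<^sub>R d)) has_real_derivative g' (x + t *\<^sub>R d)) (at t)" for x t
    proof -
      have "((\<lambda>t. (x + t *\<^sub>R d) \<bullet> d - M) has_real_derivative d \<bullet> d) (at t)"
        by (auto simp: inner_add_left intro!: derivative_eq_intros)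
      from DERIV_chain'[OF this \<theta>_deriv]
      have "((\<lambda>t. \<theta> ((x + t *\<^sub>R d) \<bullet> d - M)) has_real_derivative
          \<theta>' ((x + t *\<^sub>R d) \<bullet> d - M) * (d \<bullet> d)) (at t)" by (simp add: mult.commute)
      from DERIV_mult[OF deriv this] show ?thesis
        by (simp add: h_def g'_def algebra_simps)
    qed
  qed (simp_all add: h_def g'_def \<theta>_0)
  moreover have "indicator S x * g' x = indicator S x * g x" for x
    using on_closure(2)[of x] closure_subset[of S] by (auto simp: indicator_def)
  moreover have "indicator ((\<lambda>y. a i + L i y) -` F i) y * h (a i + L i y)
      = indicator ((\<lambda>y. a i + L i y) -` F i) y * f (a i + L i y)" if "i \<in> I" for i y
    using on_closure(1)[of "a i + L i y"] facet_in_frontier[OF that]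
    by (auto simp: indicator_def frontier_def)
  ultimately show ?thesis by simp
qed

end

subsection \<open>Polynomials\<close>

lemmas real_polynomial_function_linearI = real_polynomial_function.intros(1)
  and real_polynomial_function_constI = real_polynomial_function.intros(2)
  and real_polynomial_function_addI = real_polynomial_function.intros(3)
  and real_polynomial_function_multI = real_polynomial_function.intros(4)

lemma polynomial_function_inner_product:
  fixes f g :: "'a::real_normed_vector \<Rightarrow> 'b::euclidean_space"
  assumes "polynomial_function f" "polynomial_function g"
  shows "real_polynomial_function (\<lambda>x. f x \<bullet> g x)"
proof -
  have "real_polynomial_function (\<lambda>x. \<Sum>b\<in>Basis. (f x \<bullet> b) * (g x \<bullet> b))"
    using assms by (intro real_polynomial_function_sum real_polynomial_function_multI)
      (auto simp: polynomial_function_iff_Basis_inner)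
  then show ?thesis by (simp add: euclidean_inner[symmetric])
qed

lemma polynomial_function_lincomb:
  fixes f g :: "'a::real_normed_vector \<Rightarrow> 'b::euclidean_space"
  assumes "polynomial_function f" "polynomial_function g"
  shows "polynomial_function (\<lambda>x. f x + c *\<^sub>R g x)"
  using assms by (intro polynomial_function_add polynomial_function_cmul)

lemma polynomial_function_vec:
  fixes f :: "'a::real_normed_vector \<Rightarrow> real^3"
  shows "polynomial_function f \<longleftrightarrow> (\<forall>i. real_polynomial_function (\<lambda>x. f x $ i))"
  by (auto simp: polynomial_function_iff_Basis_inner Basis_vec_def inner_axis)

lemma real_polynomial_function_continuous:
  fixes f :: "'a::real_normed_vector \<Rightarrow> real"
  shows "real_polynomial_function f \<Longrightarrow> continuous_on S f"
  by (simp add: differentiable_imp_continuous_on differentiable_on_real_polynomial_function)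

text \<open>An interval supplies infinitely many roots. Along lines this spreads the vanishing of a
  polynomial from an open piece to the whole affine hull.\<close>

lemma real_polynomial_function_eq_0_line:
  fixes p :: "real \<Rightarrow> real"
  assumes "real_polynomial_function p" and "e > 0" and zero: "\<And>t. \<bar>t\<bar> < e \<Longrightarrow> p t = 0"
  shows "p t = 0"
proof -
  obtain a and N :: nat where p: "p = (\<lambda>x. \<Sum>i\<le>N. a i * x ^ i)"
    using real_polynomial_function_imp_sum[OF assms(1)] by blast
  have "{-e<..<e} \<subseteq> {x. (\<Sum>i\<le>N. a i * x ^ i) = 0}"
    using zero p by (auto simp: abs_less_iff)
  moreover have "infinite {-e<..<e}" using \<open>e > 0\<close> by (simp add: infinite_Ioo)
  ultimately have "infinite {x. (\<Sum>i\<le>N. a i * x ^ i) = 0}" by (metis finite_subset)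
  then have "\<forall>i\<le>N. a i = 0" using polyfun_finite_roots[of a N] by blast
  then show ?thesis by (simp add: p)
qed

lemma real_polynomial_function_has_derivative:
  fixes p :: "real^3 \<Rightarrow> real"
  assumes "real_polynomial_function p"
  shows "(p has_derivative (\<lambda>h. grad p x \<bullet> h)) (at x)"
proof -
  let ?D = "frechet_derivative p (at x)"
  have D: "(p has_derivative ?D) (at x)"
    using differentiable_at_real_polynomial_function[OF assms] by (simp add: frechet_derivative_works[symmetric])
  then have lin: "linear ?D" by (rule has_derivative_linear)
  have "?D h = grad p x \<bullet> h" for h
  proof -
    have "?D h = ?D (\<Sum>i\<in>UNIV. (h $ i) *\<^sub>R axis i 1)"
      using basis_expansion[of h] by (simp add: scalar_mult_eq_scaleR)
    also have "\<dots> = (\<Sum>i\<in>UNIV. h $ i * ?D (axis i 1))"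
      by (simp add: linear_sum[OF lin] linear_scale[OF lin])
    finally show ?thesis by (simp add: grad_def partial_deriv_def inner_vec_def mult.commute)
  qed
  then have "?D = (\<lambda>h. grad p x \<bullet> h)" by auto
  with D show ?thesis by metis
qed

lemma grad_eqI:
  assumes "(p has_derivative (\<lambda>h. g \<bullet> h)) (at x)"
  shows "grad p x = g"
proof -
  have "frechet_derivative p (at x) = (\<lambda>h. g \<bullet> h)"
    using assms by (metis frechet_derivative_at)
  then show ?thesis by (simp add: grad_def partial_deriv_def vec_eq_iff inner_axis)
qed

lemma partial_deriv_eq: "partial_deriv i p x = grad p x $ i"
  by (simp add: grad_def)

lemma grad_add:
  assumes "real_polynomial_function p" "real_polynomial_function q"
  shows "grad (\<lambda>x. p x + q x) x = grad p x + grad q x"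
  using assms by (intro grad_eqI) (auto simp: inner_add_left intro!: has_derivative_add real_polynomial_function_has_derivative)

lemma grad_mult:
  assumes "real_polynomial_function p" "real_polynomial_function q"
  shows "grad (\<lambda>x. p x * q x) x = p x *\<^sub>R grad q x + q x *\<^sub>R grad p x"
proof (rule grad_eqI)
  have "((\<lambda>x. p x * q x) has_derivative (\<lambda>h. p x * (grad q x \<bullet> h) + grad p x \<bullet> h * q x)) (at x)"
    by (intro has_derivative_mult real_polynomial_function_has_derivative assms)
  then show "((\<lambda>x. p x * q x) has_derivative (\<lambda>h. (p x *\<^sub>R grad q x + q x *\<^sub>R grad p x) \<bullet> h)) (at x)"
    by (simp add: inner_add_left mult.commute)
qed

lemma grad_const: "grad (\<lambda>x. c) x = 0"
  by (intro grad_eqI) auto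

lemma grad_linear:
  assumes "bounded_linear p"
  shows "grad p x = (\<chi> i. p (axis i 1))"
proof -
  have "frechet_derivative p (at x) = p"
    using bounded_linear_imp_has_derivative[OF assms] by (metis frechet_derivative_at)
  then show ?thesis by (simp add: grad_def partial_deriv_def)
qed

lemma grad_lincomb:
  assumes "real_polynomial_function p" "real_polynomial_function q"
  shows "grad (\<lambda>x. p x + c * q x) x = grad p x + c *\<^sub>R grad q x"
  using assms grad_add[of p "\<lambda>x. c * q x"] grad_mult[of "\<lambda>x. c" q]
  by (simp add: real_polynomial_function_multI real_polynomial_function_constI grad_const)

lemma grad_sum:
  assumes "\<And>a. a \<in> A \<Longrightarrow> real_polynomial_function (p a)"
  shows "grad (\<lambda>x. \<Sum>a\<in>A. p a x) x = (\<Sum>a\<in>A. grad (p a) x)"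
  using assms by (induction A rule: infinite_finite_induct)
    (simp_all add: grad_const grad_add real_polynomial_function_sum)

lemma polynomial_function_grad:
  "real_polynomial_function p \<Longrightarrow> polynomial_function (grad p)"
proof (induction p rule: real_polynomial_function.induct)
  case (linear p)
  then have "grad p = (\<lambda>x. \<chi> i. p (axis i 1))" by (simp add: grad_linear fun_eq_iff)
  then show ?case by simp
next
  case (const c)
  have "grad (\<lambda>x. c) = (\<lambda>x. 0)" by (simp add: grad_const fun_eq_iff)
  then show ?case by simp
next
  case (add p q)
  then have "grad (\<lambda>x. p x + q x) = (\<lambda>x. grad p x + grad q x)" by (simp add: grad_add fun_eq_iff)
  then show ?case using add by (simp add: polynomial_function_add)
next
  case (mult p q)
  then have "grad (\<lambda>x. p x * q x) = (\<lambda>x. p x *\<^sub>R grad q x + q x *\<^sub>R grad p x)"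
    by (simp add: grad_mult fun_eq_iff)
  then show ?case using mult
    by (simp add: polynomial_function_add polynomial_function_mult real_polynomial_function_eq)
qed

lemma polynomial_function_partial_deriv:
  "real_polynomial_function p \<Longrightarrow> real_polynomial_function (partial_deriv i p)"
  using polynomial_function_grad[of p] by (simp add: polynomial_function_vec grad_def)

section \<open>Polynomials of bounded degree\<close>

definition monomial3 :: "nat \<times> nat \<times> nat \<Rightarrow> real^3 \<Rightarrow> real" where
  "monomial3 = (\<lambda>(i, j, m) x. (x $ 1) ^ i * (x $ 2) ^ j * (x $ 3) ^ m)"

text \<open>Empty for negative \<open>l\<close>, which makes 0 the only polynomial of degree at most
  -1; this case occurs for derivatives when k = 0.\<close>

definition exponents :: "int \<Rightarrow> (nat \<times> nat \<times> nat) set" where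
  "exponents l = {(i, j, m). int (i + j + m) \<le> l}"

lemma finite_exponents: "finite (exponents l)"
proof (rule finite_subset)
  show "exponents l \<subseteq> {..nat l} \<times> {..nat l} \<times> {..nat l}" by (auto simp: exponents_def)
qed auto

lemma poly_deg_le_iff:
  "poly_deg_le l p \<longleftrightarrow> (\<exists>c. p = (\<lambda>x. \<Sum>a\<in>exponents l. c a * monomial3 a x))"
proof -
  have eq: "(\<Sum>(i, j, m)\<in>exponents l. c i j m * (x $ 1) ^ i * (x $ 2) ^ j * (x $ 3) ^ m)
      = (\<Sum>a\<in>exponents l. (case a of (i, j, m) \<Rightarrow> c i j m) * monomial3 a x)" for c x
    by (auto simp: monomial3_def mult.assoc intro!: sum.cong)
  have "(\<exists>c. p = (\<lambda>x. \<Sum>a\<in>exponents l. (case a of (i, j, m) \<Rightarrow> c i j m) * monomial3 a x))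
      \<longleftrightarrow> (\<exists>c. p = (\<lambda>x. \<Sum>a\<in>exponents l. c a * monomial3 a x))"
  proof (rule iffI; elim exE)
    fix c assume "p = (\<lambda>x. \<Sum>a\<in>exponents l. c a * monomial3 a x)"
    then show "\<exists>c. p = (\<lambda>x. \<Sum>a\<in>exponents l. (case a of (i, j, m) \<Rightarrow> c i j m) * monomial3 a x)"
      by (intro exI[of _ "\<lambda>i j m. c (i, j, m)"]) simp
  qed (rule exI)
  then show ?thesis unfolding poly_deg_le_def exponents_def[symmetric] eq .
qed

lemma poly_deg_le_lincomb:
  assumes "poly_deg_le l p" "poly_deg_le l q"
  shows "poly_deg_le l (\<lambda>x. p x + c * q x)"
proof -
  obtain u v where "p = (\<lambda>x. \<Sum>a\<in>exponents l. u a * monomial3 a x)"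
      "q = (\<lambda>x. \<Sum>a\<in>exponents l. v a * monomial3 a x)"
    using assms by (auto simp: poly_deg_le_iff)
  then have "(\<lambda>x. p x + c * q x) = (\<lambda>x. \<Sum>a\<in>exponents l. (u a + c * v a) * monomial3 a x)"
    by (simp add: sum_distrib_left sum.distrib[symmetric] algebra_simps)
  then show ?thesis unfolding poly_deg_le_iff by (intro exI[of _ "\<lambda>a. u a + c * v a"])
qed

lemma poly_deg_le_zero: "poly_deg_le l (\<lambda>x. 0)"
  unfolding poly_deg_le_iff by (rule exI[of _ "\<lambda>_. 0"]) simp

lemma poly_deg_le_cmult: "poly_deg_le l p \<Longrightarrow> poly_deg_le l (\<lambda>x. c * p x)"
  using poly_deg_le_lincomb[OF poly_deg_le_zero] by simp

lemma poly_deg_le_add: "poly_deg_le l p \<Longrightarrow> poly_deg_le l q \<Longrightarrow> poly_deg_le l (\<lambda>x. p x + q x)"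
  using poly_deg_le_lincomb[of l p q 1] by simp

lemma poly_deg_le_diff: "poly_deg_le l p \<Longrightarrow> poly_deg_le l q \<Longrightarrow> poly_deg_le l (\<lambda>x. p x - q x)"
  using poly_deg_le_lincomb[of l p q "-1"] by simp

lemma poly_deg_le_sum:
  "(\<And>a. a \<in> A \<Longrightarrow> poly_deg_le l (p a)) \<Longrightarrow> poly_deg_le l (\<lambda>x. \<Sum>a\<in>A. p a x)"
  by (induction A rule: infinite_finite_induct) (simp_all add: poly_deg_le_zero poly_deg_le_add)

lemma poly_deg_le_monomial3: "a \<in> exponents l \<Longrightarrow> poly_deg_le l (monomial3 a)"
  unfolding poly_deg_le_iff
  by (rule exI[of _ "\<lambda>b. if b = a then 1 else 0"])
    (simp add: finite_exponents if_distrib[of "\<lambda>u. u * _"] sum.delta cong: if_cong)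

lemma poly_deg_le_mono: "poly_deg_le l p \<Longrightarrow> l \<le> l' \<Longrightarrow> poly_deg_le l' p"
  unfolding poly_deg_le_iff[of l p]
  by (auto intro!: poly_deg_le_sum poly_deg_le_cmult poly_deg_le_monomial3 simp: exponents_def)

lemma poly_deg_le_const: "0 \<le> l \<Longrightarrow> poly_deg_le l (\<lambda>x. c)"
  using poly_deg_le_cmult[OF poly_deg_le_monomial3[of "(0, 0, 0)" l], of c]
  by (simp add: exponents_def monomial3_def)

lemma polynomial_monomial3: "real_polynomial_function (monomial3 a)"
proof -
  have "real_polynomial_function (\<lambda>x::real^3. x $ i)" for i
    by (intro real_polynomial_function_linearI bounded_linear_vec_nth)
  then show ?thesis
    by (cases a) (auto simp: monomial3_def intro!: real_polynomial_function_multI real_polynomial_function_power)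
qed

lemma poly_deg_le_polynomial: "poly_deg_le l p \<Longrightarrow> real_polynomial_function p"
  unfolding poly_deg_le_iff
  by (auto intro!: real_polynomial_function_sum real_polynomial_function_multI polynomial_monomial3 finite_exponents)

text \<open>Truncated subtraction is harmless: where an exponent is 0, its factor
  \<open>of_nat\<close> is 0 as well.\<close>

lemma grad_monomial3:
  "grad (monomial3 (i, j, m)) x = vector
    [of_nat i * monomial3 (i - 1, j, m) x, of_nat j * monomial3 (i, j - 1, m) x,
     of_nat m * monomial3 (i, j, m - 1) x]"
  unfolding monomial3_def prod.case
  by (rule grad_eqI)
    (auto intro!: derivative_eq_intros bounded_linear.has_derivative[OF bounded_linear_vec_nth]
      simp: inner_vec_def sum_3 algebra_simps)

lemma poly_deg_le_partial_deriv:
  assumes "poly_deg_le l p"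
  shows "poly_deg_le (l - 1) (partial_deriv r p)"
proof -
  obtain c where p: "p = (\<lambda>x. \<Sum>a\<in>exponents l. c a * monomial3 a x)"
    using assms by (auto simp: poly_deg_le_iff)
  have mono: "poly_deg_le (l - 1) (\<lambda>x. grad (monomial3 a) x $ r)" if a: "a \<in> exponents l" for a
  proof -
    obtain i j m where a_eq: "a = (i, j, m)" by (cases a)
    have low: "poly_deg_le (l - 1) (\<lambda>x. of_nat s * monomial3 b x)"
      if "s > 0 \<Longrightarrow> b \<in> exponents (l - 1)" for s b
      using that by (cases "s = 0") (auto simp: poly_deg_le_zero intro!: poly_deg_le_cmult poly_deg_le_monomial3)
    show ?thesis
      using exhaust_3[of r] a
      by (auto simp: a_eq grad_monomial3 exponents_def of_nat_diff intro!: low)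
  qed
  have "partial_deriv r p = (\<lambda>x. \<Sum>a\<in>exponents l. c a * grad (monomial3 a) x $ r)"
  proof
    fix x
    have "grad (\<lambda>x. c a * monomial3 a x) x = c a *\<^sub>R grad (monomial3 a) x" for a
      using grad_lincomb[of "\<lambda>x. 0" "monomial3 a" "c a" x]
      by (simp add: real_polynomial_function_constI polynomial_monomial3 grad_const)
    then show "partial_deriv r p x = (\<Sum>a\<in>exponents l. c a * grad (monomial3 a) x $ r)"
      unfolding p partial_deriv_eq
      by (subst grad_sum) (auto intro!: real_polynomial_function_multI polynomial_monomial3)
  qed
  then show ?thesis
    using mono by (auto intro!: poly_deg_le_sum poly_deg_le_cmult)
qed

subsection \<open>Projections onto finite-dimensional spaces of polynomials\<close>

definition fun_subspace :: "('a \<Rightarrow> 'b::real_vector) set \<Rightarrow> bool" where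
  "fun_subspace S \<longleftrightarrow> (\<lambda>x. 0) \<in> S \<and> (\<forall>f\<in>S. \<forall>g\<in>S. \<forall>c. (\<lambda>x. f x + c *\<^sub>R g x) \<in> S)"

lemma fun_subspace_zero: "fun_subspace S \<Longrightarrow> (\<lambda>x. 0) \<in> S"
  by (simp add: fun_subspace_def)

lemma fun_subspace_lincomb:
  "fun_subspace S \<Longrightarrow> f \<in> S \<Longrightarrow> g \<in> S \<Longrightarrow> (\<lambda>x. f x + c *\<^sub>R g x) \<in> S"
  by (simp add: fun_subspace_def)

lemma fun_subspace_diff: "fun_subspace S \<Longrightarrow> f \<in> S \<Longrightarrow> g \<in> S \<Longrightarrow> (\<lambda>x. f x - g x) \<in> S"
  using fun_subspace_lincomb[of S f g "-1"] by simp

lemma fun_subspace_scale: "fun_subspace S \<Longrightarrow> g \<in> S \<Longrightarrow> (\<lambda>x. c *\<^sub>R g x) \<in> S"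
  using fun_subspace_lincomb[OF _ fun_subspace_zero] by fastforce

lemma fun_subspace_add: "fun_subspace S \<Longrightarrow> f \<in> S \<Longrightarrow> g \<in> S \<Longrightarrow> (\<lambda>x. f x + g x) \<in> S"
  using fun_subspace_lincomb[of S f g 1] by simp

definition span_insert :: "('a \<Rightarrow> 'b::real_vector) \<Rightarrow> ('a \<Rightarrow> 'b) set \<Rightarrow> ('a \<Rightarrow> 'b) set" where
  "span_insert b S = {(\<lambda>x. c *\<^sub>R b x + g x) | c g. g \<in> S}"

lemma span_insertI: "g \<in> S \<Longrightarrow> (\<lambda>x. c *\<^sub>R b x + g x) \<in> span_insert b S"
  by (auto simp: span_insert_def)

lemma span_insertE:
  assumes "f \<in> span_insert b S"
  obtains c g where "g \<in> S" "f = (\<lambda>x. c *\<^sub>R b x + g x)"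
  using assms by (auto simp: span_insert_def)

text \<open>Generators from \<open>V\<close> are added one at a time and may be dependent. The form
  is chosen for \<open>projection_exists\<close>, whose induction is the Gram-Schmidt
  process.\<close>

inductive finitely_spanned :: "('a \<Rightarrow> 'b::real_vector) set \<Rightarrow> ('a \<Rightarrow> 'b) set \<Rightarrow> bool" for V where
  zero: "finitely_spanned V {\<lambda>x. 0}"
| extend: "finitely_spanned V S \<Longrightarrow> b \<in> V \<Longrightarrow> finitely_spanned V (span_insert b S)"

lemma finitely_spanned_subspace: "finitely_spanned V S \<Longrightarrow> fun_subspace S"
proof (induction rule: finitely_spanned.induct)
  case zero
  then show ?case by (simp add: fun_subspace_def)
next
  case (extend S b)
  show ?case unfolding fun_subspace_def
  proof (intro conjI ballI allI)
    show "(\<lambda>x. 0) \<in> span_insert b S"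
      using span_insertI[OF fun_subspace_zero[OF extend.IH], of 0 b] by simp
  next
    fix f g :: "'a \<Rightarrow> 'b" and e
    assume "f \<in> span_insert b S" "g \<in> span_insert b S"
    then obtain c f' c' g' where *: "f = (\<lambda>x. c *\<^sub>R b x + f' x)" "g = (\<lambda>x. c' *\<^sub>R b x + g' x)" "f' \<in> S" "g' \<in> S"
      by (elim span_insertE) blast
    then have "(\<lambda>x. f x + e *\<^sub>R g x) = (\<lambda>x. (c + e * c') *\<^sub>R b x + (f' x + e *\<^sub>R g' x))"
      by (simp add: algebra_simps)
    then show "(\<lambda>x. f x + e *\<^sub>R g x) \<in> span_insert b S"
      using span_insertI[OF fun_subspace_lincomb[OF extend.IH *(3,4)]] by simp
  qed
qed

lemma finitely_spanned_subset:
  "finitely_spanned V S \<Longrightarrow> fun_subspace V \<Longrightarrow> S \<subseteq> V"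
proof (induction rule: finitely_spanned.induct)
  case zero
  then show ?case by (simp add: fun_subspace_zero)
next
  case (extend S b)
  show ?case
  proof
    fix f assume "f \<in> span_insert b S"
    then obtain c g where f: "g \<in> S" "f = (\<lambda>x. c *\<^sub>R b x + g x)" by (rule span_insertE)
    then have "f = (\<lambda>x. g x + c *\<^sub>R b x)" by (simp add: add.commute)
    then show "f \<in> V"
      using fun_subspace_lincomb[OF extend.prems _ extend.hyps(2), of g c] extend.IH[OF extend.prems] f(1) by auto
  qed
qed

text \<open>Meant for rot, curl and grad. Linearity of \<open>D\<close> is asked only on
  \<open>V\<close> because these operators are linear on polynomials but not on arbitrary
  functions.\<close>

lemma finitely_spanned_image:
  assumes "finitely_spanned V S" and V: "fun_subspace V"
    and W: "\<And>f. f \<in> V \<Longrightarrow> D f \<in> W" and D0: "D (\<lambda>x. 0) = (\<lambda>x. 0)"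
    and D: "\<And>f g c. f \<in> V \<Longrightarrow> g \<in> V \<Longrightarrow> D (\<lambda>x. c *\<^sub>R f x + g x) = (\<lambda>x. c *\<^sub>R D f x + D g x)"
  shows "finitely_spanned W (D ` S)"
  using assms(1)
proof (induction rule: finitely_spanned.induct)
  case zero
  then show ?case by (simp add: D0 finitely_spanned.zero)
next
  case (extend S b)
  have S: "S \<subseteq> V" by (rule finitely_spanned_subset[OF extend.hyps(1) V])
  have "D ` span_insert b S = span_insert (D b) (D ` S)" (is "?L = ?R")
  proof
    show "?L \<subseteq> ?R"
    proof
      fix h assume "h \<in> ?L"
      then obtain f where "f \<in> span_insert b S" and h: "h = D f" by blast
      then obtain c g where "g \<in> S" "f = (\<lambda>x. c *\<^sub>R b x + g x)" by (elim span_insertE)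
      then have "h = (\<lambda>x. c *\<^sub>R D b x + D g x)" "D g \<in> D ` S"
        using S D[OF extend.hyps(2), of g c] by (auto simp: h)
      then show "h \<in> ?R" using span_insertI by simp
    qed
    show "?R \<subseteq> ?L"
    proof
      fix h assume "h \<in> ?R"
      then obtain c g' where "g' \<in> D ` S" "h = (\<lambda>x. c *\<^sub>R D b x + g' x)" by (rule span_insertE)
      then obtain g where g: "g \<in> S" "h = (\<lambda>x. c *\<^sub>R D b x + D g x)" by blast
      then have "h = D (\<lambda>x. c *\<^sub>R b x + g x)" using D[OF extend.hyps(2), of g c] S by auto
      then show "h \<in> ?L" using span_insertI[OF g(1)] by simp
    qed
  qed
  then show ?case using finitely_spanned.extend[OF extend.IH W[OF extend.hyps(2)]] by simp
qed

lemma finitely_spanned_combinations: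
  assumes "finite A" "\<And>a. a \<in> A \<Longrightarrow> b a \<in> V"
  shows "finitely_spanned V (range (\<lambda>c x. \<Sum>a\<in>A. c a *\<^sub>R b a x))"
  using assms
proof (induction A)
  case empty
  then show ?case by (simp add: finitely_spanned.zero)
next
  case (insert a A)
  let ?S = "\<lambda>A. range (\<lambda>c x. \<Sum>a\<in>A. c a *\<^sub>R b a x)"
  have "?S (insert a A) = span_insert (b a) (?S A)"
  proof (intro equalityI subsetI)
    fix f assume "f \<in> ?S (insert a A)"
    then obtain c where "f = (\<lambda>x. \<Sum>a\<in>insert a A. c a *\<^sub>R b a x)" by blast
    then have f: "f = (\<lambda>x. c a *\<^sub>R b a x + (\<Sum>a\<in>A. c a *\<^sub>R b a x))"
      using insert.hyps by simp
    show "f \<in> span_insert (b a) (?S A)" unfolding f by (rule span_insertI) (rule rangeI)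
  next
    fix f assume "f \<in> span_insert (b a) (?S A)"
    then obtain e g where "g \<in> ?S A" "f = (\<lambda>x. e *\<^sub>R b a x + g x)" by (rule span_insertE)
    then obtain c where f: "f = (\<lambda>x. e *\<^sub>R b a x + (\<Sum>a\<in>A. c a *\<^sub>R b a x))" by blast
    have "(\<Sum>r\<in>A. (c(a := e)) r *\<^sub>R b r x) = (\<Sum>r\<in>A. c r *\<^sub>R b r x)" for x
      using insert.hyps by (intro sum.cong) auto
    then show "f \<in> ?S (insert a A)"
      using insert.hyps unfolding f by (intro image_eqI[where x="c(a := e)"]) auto
  qed
  then show ?case using insert by (auto intro: finitely_spanned.extend)
qed

section \<open>Polynomial functions on a set and their integrals\<close>

definition poly_on :: "(real^3) set \<Rightarrow> (real^3 \<Rightarrow> 'b::real_normed_vector) \<Rightarrow> bool" where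
  "poly_on X f \<longleftrightarrow> (\<exists>p. polynomial_function p \<and> (\<forall>x\<in>X. f x = p x))"

text \<open>Polynomials of all degrees in the cut-off representation: the common ambient space in
  which a function is determined by its values on the affine hull.\<close>

definition hull_polys :: "(real^3) set \<Rightarrow> (real^3 \<Rightarrow> 'b::real_normed_vector) set" where
  "hull_polys X = {restr_hull X p | p. polynomial_function p}"

lemma hull_polysI: "polynomial_function p \<Longrightarrow> restr_hull X p \<in> hull_polys X"
  by (auto simp: hull_polys_def)

lemma hull_polysE:
  assumes "f \<in> hull_polys X"
  obtains p where "polynomial_function p" "f = restr_hull X p"
  using assms by (auto simp: hull_polys_def)

lemma restr_hull_on: "x \<in> X \<Longrightarrow> restr_hull X p x = p x"
  by (simp add: restr_hull_def hull_inc)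

lemma restr_hull_lincomb:
  fixes p :: "real^3 \<Rightarrow> 'b::real_vector"
  shows "(\<lambda>x. restr_hull X p x + c *\<^sub>R restr_hull X q x) = restr_hull X (\<lambda>x. p x + c *\<^sub>R q x)"
  by (auto simp: restr_hull_def)

lemma poly_on_hull_polys: "f \<in> hull_polys X \<Longrightarrow> poly_on X f"
  by (auto simp: hull_polys_def poly_on_def restr_hull_on)

lemma poly_on_lincomb:
  fixes f :: "real^3 \<Rightarrow> 'b::euclidean_space"
  assumes "poly_on X f" "poly_on X g"
  shows "poly_on X (\<lambda>x. f x + c *\<^sub>R g x)"
proof -
  obtain p q where "polynomial_function p" "\<forall>x\<in>X. f x = p x" "polynomial_function q" "\<forall>x\<in>X. g x = q x"
    using assms unfolding poly_on_def by blast
  then show ?thesis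
    unfolding poly_on_def
    by (intro exI[of _ "\<lambda>x. p x + c *\<^sub>R q x"]) (auto intro: polynomial_function_lincomb)
qed

lemma fun_subspace_hull_polys: "fun_subspace (hull_polys X :: (real^3 \<Rightarrow> 'b::euclidean_space) set)"
  unfolding fun_subspace_def
proof (intro conjI ballI allI)
  have "restr_hull X (\<lambda>x. 0) = (\<lambda>x. 0 :: 'b)" by (auto simp: restr_hull_def)
  then show "(\<lambda>x. 0 :: 'b) \<in> hull_polys X"
    using hull_polysI[of "\<lambda>x. 0 :: 'b" X] by simp
next
  fix f g :: "real^3 \<Rightarrow> 'b" and c
  assume "f \<in> hull_polys X" "g \<in> hull_polys X"
  then show "(\<lambda>x. f x + c *\<^sub>R g x) \<in> hull_polys X"
    by (auto elim!: hull_polysE simp: restr_hull_lincomb intro!: hull_polysI polynomial_function_lincomb)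
qed

lemma polys_finitely_spanned: "finitely_spanned (hull_polys X) (polys l X)"
proof -
  have "(\<lambda>x. \<Sum>a\<in>exponents l. c a *\<^sub>R restr_hull X (monomial3 a) x)
      = restr_hull X (\<lambda>x. \<Sum>a\<in>exponents l. c a * monomial3 a x)" for c
    by (auto simp: restr_hull_def)
  then have eq: "polys l X = range (\<lambda>c x. \<Sum>a\<in>exponents l. c a *\<^sub>R restr_hull X (monomial3 a) x)"
    by (auto simp: polys_def poly_deg_le_iff)
  show ?thesis
    using polynomial_monomial3 unfolding eq real_polynomial_function_eq
    by (intro finitely_spanned_combinations finite_exponents hull_polysI)
qed

lemma vec_polys_finitely_spanned: "finitely_spanned (hull_polys X) (vec_polys l X)"
proof -
  define b :: "3 \<times> nat \<times> nat \<times> nat \<Rightarrow> real^3 \<Rightarrow> real^3"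
    where "b z = restr_hull X (\<lambda>x. monomial3 (snd z) x *\<^sub>R axis (fst z) 1)" for z
  let ?A = "UNIV \<times> exponents l"
  have comb: "(\<lambda>x. \<Sum>z\<in>?A. c z *\<^sub>R b z x)
      = restr_hull X (\<lambda>x. \<chi> i. \<Sum>a\<in>exponents l. c (i, a) * monomial3 a x)" for c
  proof -
    have "(\<Sum>i\<in>UNIV. \<Sum>a\<in>exponents l. c (i, a) * (monomial3 a x * axis i 1 $ j))
        = (\<Sum>a\<in>exponents l. c (j, a) * monomial3 a x)" for x and j :: 3
    proof -
      have "(\<Sum>a\<in>exponents l. c (i, a) * (monomial3 a x * axis i 1 $ j))
          = (if i = j then \<Sum>a\<in>exponents l. c (j, a) * monomial3 a x else 0)" for i
        by (auto simp: axis_def)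
      then show ?thesis by simp
    qed
    then show ?thesis
      by (auto simp: fun_eq_iff restr_hull_def b_def vec_eq_iff sum.cartesian_product')
  qed
  have "vec_polys l X = range (\<lambda>c x. \<Sum>z\<in>?A. c z *\<^sub>R b z x)"
  proof (intro equalityI subsetI)
    fix f assume "f \<in> vec_polys l X"
    then obtain p where p: "f = restr_hull X p" "\<And>i. poly_deg_le l (\<lambda>x. p x $ i)"
      by (auto simp: vec_polys_def)
    then obtain C where C: "\<And>i. (\<lambda>x. p x $ i) = (\<lambda>x. \<Sum>a\<in>exponents l. C i a * monomial3 a x)"
      unfolding poly_deg_le_iff by metis
    have "p = (\<lambda>x. \<chi> i. \<Sum>a\<in>exponents l. C i a * monomial3 a x)"
      using fun_cong[OF C] by (auto simp: vec_eq_iff fun_eq_iff)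
    then have "f = (\<lambda>x. \<Sum>z\<in>?A. (case z of (i, a) \<Rightarrow> C i a) *\<^sub>R b z x)"
      by (simp only: p(1) comb prod.case)
    then show "f \<in> range (\<lambda>c x. \<Sum>z\<in>?A. c z *\<^sub>R b z x)"
      by (intro image_eqI[where x="\<lambda>(i, a). C i a"]) auto
  next
    fix f assume "f \<in> range (\<lambda>c x. \<Sum>z\<in>?A. c z *\<^sub>R b z x)"
    then obtain c where "f = restr_hull X (\<lambda>x. \<chi> i. \<Sum>a\<in>exponents l. c (i, a) * monomial3 a x)"
      using comb by auto
    then show "f \<in> vec_polys l X"
      by (auto simp: vec_polys_def intro!: poly_deg_le_sum poly_deg_le_cmult poly_deg_le_monomial3)
  qed
  moreover have "b z \<in> hull_polys X" for z
    unfolding b_def using polynomial_monomial3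
    by (intro hull_polysI polynomial_function_mult) (auto simp: real_polynomial_function_eq)
  ultimately show ?thesis by (simp add: finitely_spanned_combinations finite_exponents)
qed

text \<open>What integration over a cell, a face and an edge have in common, so that projections and
  uniqueness are treated once. In \<open>definite\<close> the polynomial vanishes on the affine hull
  and not only on \<open>X\<close>, because the elements of the polynomial spaces are extensions to
  the hull.\<close>

locale polynomial_integral =
  fixes X :: "(real^3) set" and J :: "(real^3 \<Rightarrow> real) \<Rightarrow> real"
  assumes cong: "(\<And>x. x \<in> X \<Longrightarrow> f x = g x) \<Longrightarrow> J f = J g"
    and lincomb: "real_polynomial_function p \<Longrightarrow> real_polynomial_function q \<Longrightarrow>
      J (\<lambda>x. p x + c * q x) = J p + c * J q"
    and definite: "real_polynomial_function p \<Longrightarrow> (\<And>x. x \<in> X \<Longrightarrow> 0 \<le> p x) \<Longrightarrow> J p = 0 \<Longrightarrow>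
      x \<in> affine hull X \<Longrightarrow> p x = 0"
begin

abbreviation ip :: "(real^3 \<Rightarrow> 'b::euclidean_space) \<Rightarrow> (real^3 \<Rightarrow> 'b) \<Rightarrow> real" where
  "ip f g \<equiv> J (\<lambda>x. f x \<bullet> g x)"

lemma lincomb_on:
  assumes "poly_on X f" "poly_on X g"
  shows "J (\<lambda>x. f x + c * g x) = J f + c * J g"
proof -
  obtain p q where p: "polynomial_function p" "\<And>x. x \<in> X \<Longrightarrow> f x = p x"
    and q: "polynomial_function q" "\<And>x. x \<in> X \<Longrightarrow> g x = q x"
    using assms unfolding poly_on_def by blast
  then have "J (\<lambda>x. f x + c * g x) = J (\<lambda>x. p x + c * q x)" "J f = J p" "J g = J q"
    by (auto intro!: cong)
  then show ?thesis using lincomb[of p q c] p q by (simp add: real_polynomial_function_eq)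
qed

lemma poly_on_inner:
  fixes f :: "real^3 \<Rightarrow> 'b::euclidean_space"
  assumes "poly_on X f" "poly_on X g"
  shows "poly_on X (\<lambda>x. f x \<bullet> g x)"
proof -
  obtain p q where "polynomial_function p" "\<forall>x\<in>X. f x = p x" "polynomial_function q" "\<forall>x\<in>X. g x = q x"
    using assms unfolding poly_on_def by blast
  then show ?thesis unfolding poly_on_def
    by (intro exI[of _ "\<lambda>x. p x \<bullet> q x"])
      (simp add: polynomial_function_inner_product real_polynomial_function_eq[symmetric])
qed

lemma ip_commute: "ip f g = ip g f"
  by (simp add: inner_commute)

lemma ip_lincomb:
  assumes "poly_on X f" "poly_on X g" "poly_on X h"
  shows "ip (\<lambda>x. f x + c *\<^sub>R g x) h = ip f h + c * ip g h"
  using lincomb_on[OF poly_on_inner[OF assms(1,3)] poly_on_inner[OF assms(2,3)]]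
  by (simp add: inner_add_left)

lemma ip_diff:
  assumes "poly_on X f" "poly_on X g" "poly_on X h"
  shows "ip (\<lambda>x. f x - g x) h = ip f h - ip g h"
  using ip_lincomb[OF assms, of "-1"] by simp

lemma ip_add:
  assumes "poly_on X f" "poly_on X g" "poly_on X h"
  shows "ip (\<lambda>x. f x + g x) h = ip f h + ip g h"
  using ip_lincomb[OF assms, of 1] by simp

lemma ip_definite:
  assumes f: "f \<in> hull_polys X" and "ip f f = 0"
  shows "f = (\<lambda>x. 0)"
proof -
  obtain p where p: "polynomial_function p" "f = restr_hull X p" using f by (auto simp: hull_polys_def)
  have "ip f f = J (\<lambda>x. p x \<bullet> p x)" by (rule cong) (simp add: p restr_hull_on)
  then have "p x \<bullet> p x = 0" if "x \<in> affine hull X" for x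
    using assms(2) that p(1) by (intro definite[of "\<lambda>x. p x \<bullet> p x"] polynomial_function_inner_product) auto
  then show ?thesis by (auto simp: p restr_hull_def)
qed

text \<open>The difference of the two functions is orthogonal to itself. This is the uniqueness half
  for the projections and for the face and full curls.\<close>

lemma ip_eqI:
  assumes S: "fun_subspace S" "S \<subseteq> hull_polys X" and "f \<in> S" "g \<in> S"
    and eq: "\<And>h. h \<in> S \<Longrightarrow> ip f h = ip g h"
  shows "f = g"
proof -
  have fg: "(\<lambda>x. f x - g x) \<in> S" using assms by (intro fun_subspace_diff)
  have "ip (\<lambda>x. f x - g x) (\<lambda>x. f x - g x) = 0"
    using fg assms by (subst ip_diff) (auto intro!: poly_on_hull_polys)
  then have "(\<lambda>x. f x - g x) = (\<lambda>x. 0)" using fg S(2) by (intro ip_definite) auto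
  then show ?thesis by (simp add: fun_eq_iff)
qed

text \<open>Gram-Schmidt: a new generator is replaced by its residual \<open>r\<close>, which is
  orthogonal to the old span. Either the residual is 0 and nothing is added, or the component along
  it is added to the old projection.\<close>

lemma projection_exists:
  fixes f :: "real^3 \<Rightarrow> 'b::euclidean_space"
  assumes "finitely_spanned (hull_polys X) S" and f: "poly_on X f"
  shows "\<exists>g\<in>S. \<forall>h\<in>S. ip g h = ip f h"
  using assms(1) f
proof (induction arbitrary: f rule: finitely_spanned.induct)
  case zero
  have "ip (\<lambda>x. 0) (\<lambda>x. 0) = ip f (\<lambda>x. 0)" for f :: "real^3 \<Rightarrow> 'b" by simp
  then show ?case by simp
next
  case (extend S b)
  let ?S' = "span_insert b S"
  have sub: "fun_subspace S" and S_hull: "S \<subseteq> hull_polys X"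
    using finitely_spanned_subspace finitely_spanned_subset extend.hyps fun_subspace_hull_polys by blast+
  note S_poly = poly_on_hull_polys[OF subsetD[OF S_hull]]
  have b_poly: "poly_on X b" using extend.hyps(2) by (rule poly_on_hull_polys)
  obtain pb where pb: "pb \<in> S" "\<forall>h\<in>S. ip pb h = ip b h" using extend.IH[OF b_poly] by blast
  obtain pf where pf: "pf \<in> S" "\<forall>h\<in>S. ip pf h = ip f h" using extend.IH[OF extend.prems] by blast
  define r where "r = (\<lambda>x. b x - pb x)"
  have r_hull: "r \<in> hull_polys X"
    unfolding r_def using pb(1) S_hull extend.hyps(2) by (intro fun_subspace_diff fun_subspace_hull_polys) auto
  then have r_poly: "poly_on X r" by (rule poly_on_hull_polys)
  have r_orth: "ip r h = 0" if "h \<in> S" for h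
    unfolding r_def using that pb by (subst ip_diff) (auto intro: b_poly S_poly)
  show ?case
  proof (cases "ip r r = 0")
    case True
    then have "b = pb" using ip_definite[OF r_hull] by (auto simp: r_def fun_eq_iff)
    then have "?S' \<subseteq> S"
      using pb(1) by (auto elim!: span_insertE intro!: fun_subspace_add[OF sub] fun_subspace_scale[OF sub])
    moreover have "pf \<in> ?S'" using span_insertI[OF pf(1), of 0 b] by simp
    ultimately show ?thesis using pf(2) by blast
  next
    case False
    \<comment> \<open>The coefficient for which \<open>g\<close> and \<open>f\<close> have the same
      product with \<open>r\<close>, given that \<open>pf\<close> is orthogonal to
      \<open>r\<close>.\<close>
    define c where "c = ip f r / ip r r"
    define g where "g = (\<lambda>x. pf x + c *\<^sub>R r x)"
    have "g = (\<lambda>x. c *\<^sub>R b x + (pf x + (- c) *\<^sub>R pb x))"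
      by (simp add: g_def r_def algebra_simps)
    then have "g \<in> ?S'" using span_insertI[OF fun_subspace_lincomb[OF sub pf(1) pb(1), of "- c"], of c b] by simp
    moreover have "ip g h = ip f h" if h_in: "h \<in> ?S'" for h
    proof -
      obtain e s where h: "s \<in> S" "h = (\<lambda>x. e *\<^sub>R b x + s x)" using h_in by (rule span_insertE)
      \<comment> \<open>Since b = r + pb, the test function splits orthogonally into
        \<open>t\<close> in the old span and a multiple of \<open>r\<close>.\<close>
      define t where "t = (\<lambda>x. s x + e *\<^sub>R pb x)"
      have t: "t \<in> S" unfolding t_def using h(1) pb(1) by (intro fun_subspace_lincomb sub)
      have h_eq: "h = (\<lambda>x. t x + e *\<^sub>R r x)" by (simp add: h(2) t_def r_def algebra_simps)
      have split: "ip u h = ip u t + e * ip u r" if "poly_on X u" for u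
        using ip_lincomb[OF S_poly[OF t] r_poly that, of e] by (simp add: h_eq ip_commute[of u])
      have g_with: "ip g u = ip pf u + c * ip r u" if "poly_on X u" for u
        unfolding g_def using S_poly[OF pf(1)] r_poly that by (rule ip_lincomb)
      have "ip g h = ip g t + e * ip g r"
        unfolding g_def using S_poly[OF pf(1)] r_poly by (intro split poly_on_lincomb)
      also have "ip g t = ip f t" using g_with[OF S_poly[OF t]] r_orth[OF t] pf(2) t by simp
      also have "ip g r = ip f r"
        using g_with[OF r_poly] r_orth[OF pf(1)] False by (simp add: ip_commute[of pf] c_def)
      finally show ?thesis using split[OF extend.prems] by simp
    qed
    ultimately show ?thesis by blast
  qed
qed

lemma L2_proj_eqI:
  fixes f :: "real^3 \<Rightarrow> 'b::euclidean_space"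
  assumes "fun_subspace S" "S \<subseteq> hull_polys X" and "g \<in> S" and "\<And>h. h \<in> S \<Longrightarrow> ip g h = ip f h"
  shows "L2_proj J S f = g"
  unfolding L2_proj_def
proof (rule the_equality)
  fix g' :: "real^3 \<Rightarrow> 'b" assume "g' \<in> S \<and> (\<forall>h\<in>S. ip g' h = ip f h)"
  then show "g' = g" using assms by (intro ip_eqI[of S]) auto
qed (use assms in auto)

end

subsection \<open>Integrals over cells, faces and edges\<close>

lemma isometric_chart_polynomial:
  fixes \<phi> :: "'b::euclidean_space \<Rightarrow> 'a::euclidean_space"
  assumes "isometric_chart \<phi> X"
  shows "polynomial_function \<phi>"
proof -
  obtain a L where L: "linear L" "\<phi> = (\<lambda>y. a + L y)" using assms by (auto simp: isometric_chart_def)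
  then have "polynomial_function L"
    by (simp add: linear_conv_bounded_linear polynomial_function_bounded_linear)
  then show ?thesis unfolding L(2) by (intro polynomial_function_add polynomial_function_const)
qed

lemma isometric_chart_dist:
  assumes "isometric_chart \<phi> X"
  shows "dist (\<phi> y) (\<phi> z) = dist y z"
  using assms by (auto simp: isometric_chart_def dist_norm linear_diff[symmetric])

lemma isometric_chart_continuous:
  assumes "isometric_chart \<phi> X"
  shows "continuous_on S \<phi>"
  using isometric_chart_dist[OF assms] by (auto simp: continuous_on_iff)

text \<open>Translated to the origin, the affine hull is a subspace of the dimension of the chart
  domain, and subspaces of equal dimension are isometric.\<close>

lemma isometric_chart_exists:
  fixes X :: "'a::euclidean_space set"
  assumes "aff_dim X = int DIM('b::euclidean_space)"
  shows "\<exists>\<phi> :: 'b \<Rightarrow> 'a. isometric_chart \<phi> X"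
proof -
  have "X \<noteq> {}" using assms by auto
  then obtain a where a: "a \<in> affine hull X" by (auto intro: hull_inc)
  define T where "T = (\<lambda>x. - a + x) ` (affine hull X)"
  have T: "subspace T"
    unfolding T_def using affine_diffs_subspace[OF affine_affine_hull a] by simp
  have "int (dim T) = aff_dim (affine hull X)"
    using aff_dim_dim_affine_diffs[OF affine_affine_hull a] by (simp add: T_def image_def)
  then have "dim (UNIV :: 'b set) = dim T" using assms by simp
  then obtain f :: "'b \<Rightarrow> 'a" where f: "linear f" "f ` UNIV = T" "\<And>x. norm (f x) = norm x"
    using isometries_subspaces[OF subspace_UNIV T] by (metis UNIV_I)
  have "range (\<lambda>y. a + f y) = (\<lambda>x. a + x) ` T" using f(2) by (auto simp: image_iff)
  also have "\<dots> = affine hull X" by (auto simp: T_def image_iff)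
  finally have "isometric_chart (\<lambda>y. a + f y) X"
    using f unfolding isometric_chart_def by blast
  then show ?thesis by blast
qed

lemma isometric_chart_open_vimage:
  assumes "isometric_chart \<phi> X" and "openin (top_of_set (affine hull X)) Y"
  shows "open (\<phi> -` Y)"
proof -
  obtain U where "open U" "Y = affine hull X \<inter> U" using assms(2) by (auto simp: openin_open)
  moreover have "range \<phi> = affine hull X" using assms(1) by (simp add: isometric_chart_def)
  ultimately have "\<phi> -` Y = \<phi> -` U" by auto
  then show ?thesis
    using \<open>open U\<close> isometric_chart_continuous[OF assms(1), of UNIV] by (simp add: open_vimage)
qed

lemma isometric_chart_bounded_vimage:
  assumes "isometric_chart \<phi> X" and "bounded Y"
  shows "bounded (\<phi> -` Y)"
proof -
  obtain R where R: "\<And>x. x \<in> Y \<Longrightarrow> dist (\<phi> 0) x \<le> R"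
    using assms(2) bounded_any_center[of Y "\<phi> 0"] by auto
  then have "dist 0 y \<le> R" if "y \<in> \<phi> -` Y" for y
    using that R[of "\<phi> y"] isometric_chart_dist[OF assms(1), of 0 y] by simp
  then show ?thesis unfolding bounded_def by blast
qed

lemma set_integrable_polynomial:
  fixes p :: "'b::euclidean_space \<Rightarrow> real"
  assumes "real_polynomial_function p" "open A" "bounded A"
  shows "set_integrable lborel A p"
proof -
  have "set_integrable lborel (closure A) p"
    unfolding set_integrable_def
    by (intro borel_integrable_compact real_polynomial_function_continuous assms)
      (simp add: assms compact_closure)
  then show ?thesis using assms(2) closure_subset by (rule_tac set_integrable_subset) auto
qed

text \<open>The point is definiteness. A nonnegative polynomial with zero integral vanishes almost
  everywhere on the open set \<open>?A\<close>, by continuity everywhere on it, and from there along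
  lines on the entire chart.\<close>

lemma polynomial_integral_chart:
  fixes \<phi> :: "'b::euclidean_space \<Rightarrow> real^3"
  assumes chart: "isometric_chart \<phi> X" and op: "open (\<phi> -` X)" and bdd: "bounded X" and ne: "X \<noteq> {}"
  shows "polynomial_integral X (\<lambda>f. set_lebesgue_integral lborel (\<phi> -` X) (\<lambda>y. f (\<phi> y)))"
proof
  let ?A = "\<phi> -` X"
  have comp: "real_polynomial_function (\<lambda>y. p (\<phi> y))" if "real_polynomial_function p" for p
    using real_polynomial_function_compose[OF isometric_chart_polynomial[OF chart] that] by (simp add: o_def)
  have int: "set_integrable lborel ?A (\<lambda>y. p (\<phi> y))" if "real_polynomial_function p" for p
    using comp[OF that] op isometric_chart_bounded_vimage[OF chart bdd] by (rule set_integrable_polynomial)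
  show "(LINT y:?A|lborel. f (\<phi> y)) = (LINT y:?A|lborel. g (\<phi> y))"
    if "\<And>x. x \<in> X \<Longrightarrow> f x = g x" for f g
    using that op by (intro set_lebesgue_integral_cong) auto
  show "(LINT y:?A|lborel. p (\<phi> y) + c * q (\<phi> y))
      = (LINT y:?A|lborel. p (\<phi> y)) + c * (LINT y:?A|lborel. q (\<phi> y))"
    if "real_polynomial_function p" "real_polynomial_function q" for p q c
    using int[OF that(1)] int[OF that(2)] by (subst set_integral_add) auto
  fix p x
  assume p: "real_polynomial_function p" and pos: "\<And>x. x \<in> X \<Longrightarrow> 0 \<le> p x"
    and zero: "(LINT y:?A|lborel. p (\<phi> y)) = 0" and x: "x \<in> affine hull X"
  have range: "range \<phi> = affine hull X" using chart by (simp add: isometric_chart_def)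
  have on_A: "p (\<phi> y) = 0" if "y \<in> ?A" for y
  proof (rule ccontr)
    assume nz: "p (\<phi> y) \<noteq> 0"
    let ?U = "?A \<inter> {y. p (\<phi> y) \<noteq> 0}"
    have "open {y. p (\<phi> y) \<noteq> 0}"
      using open_Collect_neq[OF real_polynomial_function_continuous[OF comp[OF p]] continuous_on_const] by simp
    then have "open ?U" using op by blast
    have "AE y in lborel. indicator ?A y *\<^sub>R p (\<phi> y) = 0"
      using zero int[OF p] pos unfolding set_lebesgue_integral_def set_integrable_def
      by (subst integral_nonneg_eq_0_iff_AE[symmetric]) (auto simp: indicator_def)
    then have "AE y in lborel. y \<notin> ?U" by eventually_elim (auto simp: indicator_def)
    then have "emeasure lborel ?U = 0"
      using \<open>open ?U\<close> by (subst (asm) AE_iff_measurable[where N="?U"]) auto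
    then have "negligible ?U"
      using \<open>open ?U\<close> by (auto simp: negligible_iff_null_sets null_sets_completion_iff null_sets_def)
    then show False using open_not_negligible[OF \<open>open ?U\<close>] nz that by blast
  qed
  obtain x0 where "x0 \<in> X" using ne by blast
  then obtain y0 where y0: "y0 \<in> ?A" using range hull_subset[of X affine] by (metis rangeE subsetD vimageI)
  obtain y where y: "x = \<phi> y" using x range by blast
  obtain e where e: "e > 0" "ball y0 e \<subseteq> ?A" using op y0 by (meson open_contains_ball)
  \<comment> \<open>The polynomial along the line from a point \<open>y0\<close> inside
    \<open>?A\<close> to the given point: it vanishes for small t and is evaluated at t = 1. The
    radius is divided by 1 + |y - y0| so that y = y0 is covered.\<close>
  define q where "q = (\<lambda>t. p (\<phi> (y0 + t *\<^sub>R (y - y0))))"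
  have "polynomial_function (\<lambda>t::real. y0 + t *\<^sub>R (y - y0))"
    by (intro polynomial_function_add polynomial_function_const polynomial_function_bounded_linear bounded_linear_scaleR_left)
  from real_polynomial_function_compose[OF this comp[OF p]]
  have "real_polynomial_function q" by (simp add: q_def o_def)
  moreover have "e / (1 + norm (y - y0)) > 0" using e(1) by (simp add: add_pos_nonneg)
  moreover have "q t = 0" if t: "\<bar>t\<bar> < e / (1 + norm (y - y0))" for t
  proof -
    have "\<bar>t\<bar> * norm (y - y0) \<le> \<bar>t\<bar> * (1 + norm (y - y0))" by (intro mult_left_mono) auto
    also have "\<dots> < e" using t by (simp add: less_divide_eq add_pos_nonneg)
    finally have "y0 + t *\<^sub>R (y - y0) \<in> ball y0 e" by (simp add: dist_norm)
    then show ?thesis using e(2) on_A by (auto simp: q_def)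
  qed
  ultimately have "q 1 = 0" by (rule real_polynomial_function_eq_0_line)
  then show "p x = 0" by (simp add: q_def y)
qed

lemma polynomial_integral_int_cell:
  assumes "open T" "bounded T" "T \<noteq> {}"
  shows "polynomial_integral T (int_cell T)"
proof -
  have "isometric_chart (\<lambda>y. y) T"
    unfolding isometric_chart_def using affine_hull_open[OF assms(1,3)]
    by (intro conjI exI[of _ 0] exI[of _ "\<lambda>y. y"]) (auto simp: linear_id[unfolded id_def])
  from polynomial_integral_chart[OF this] assms show ?thesis
    by (simp add: int_cell_def[abs_def])
qed

text \<open>The chart chosen inside \<open>int_face\<close>, made nameable so that the integration
  formula can be proved in exactly that chart.\<close>

definition face_chart :: "(real^3) set \<Rightarrow> real \<times> real \<Rightarrow> real^3" where
  "face_chart F = (SOME \<phi>. isometric_chart \<phi> F)"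

definition edge_chart :: "(real^3) set \<Rightarrow> real \<Rightarrow> real^3" where
  "edge_chart E = (SOME \<phi>. isometric_chart \<phi> E)"

lemma int_face_eq: "int_face F f = set_lebesgue_integral lborel (face_chart F -` F) (\<lambda>y. f (face_chart F y))"
  by (simp add: int_face_def face_chart_def Let_def)

lemma int_edge_eq: "int_edge E f = set_lebesgue_integral lborel (edge_chart E -` E) (\<lambda>y. f (edge_chart E y))"
  by (simp add: int_edge_def edge_chart_def Let_def)

lemma face_chart: "aff_dim F = 2 \<Longrightarrow> isometric_chart (face_chart F) F"
  unfolding face_chart_def by (rule someI_ex[OF isometric_chart_exists]) simp

lemma edge_chart: "aff_dim E = 1 \<Longrightarrow> isometric_chart (edge_chart E) E"
  unfolding edge_chart_def by (rule someI_ex[OF isometric_chart_exists]) simp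

lemma polynomial_integral_int_face:
  assumes "aff_dim F = 2" "openin (top_of_set (affine hull F)) F" "bounded F"
  shows "polynomial_integral F (int_face F)"
proof -
  have "F \<noteq> {}" using assms(1) by auto
  with polynomial_integral_chart[OF face_chart isometric_chart_open_vimage[OF face_chart]] assms
  show ?thesis by (simp add: int_face_eq[abs_def])
qed

lemma polynomial_integral_int_edge:
  assumes "aff_dim E = 1" "openin (top_of_set (affine hull E)) E" "bounded E"
  shows "polynomial_integral E (int_edge E)"
proof -
  have "E \<noteq> {}" using assms(1) by auto
  with polynomial_integral_chart[OF edge_chart isometric_chart_open_vimage[OF edge_chart]] assms
  show ?thesis by (simp add: int_edge_eq[abs_def])
qed

subsection \<open>Polyhedra and polygons as faceted regions\<close>

text \<open>\<open>C\<close> is the union of the simplices. Its relative interior contains that of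
  each single simplex, which already has dimension \<open>d\<close>; hence neither the dimension nor
  the affine hull shrinks.\<close>

lemma polytopal_domainE:
  fixes S :: "'a::euclidean_space set"
  assumes "polytopal_domain d S" and "0 \<le> d"
  obtains C where "compact C" "S = rel_interior C" "affine hull S = affine hull C" "aff_dim S = d"
proof -
  obtain \<T> where \<T>: "finite \<T>" "\<And>\<tau>. \<tau> \<in> \<T> \<Longrightarrow> d simplex \<tau>" "aff_dim (\<Union>\<T>) = d" "S = rel_interior (\<Union>\<T>)"
    using assms(1) unfolding polytopal_domain_def by blast
  then obtain \<tau> where \<tau>: "\<tau> \<in> \<T>" using assms(2) by fastforce
  have dim_\<tau>: "aff_dim \<tau> = d" and conv: "convex \<tau>"
    using \<T>(2)[OF \<tau>] by (auto simp: aff_dim_simplex convex_simplex)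
  then have "\<tau> \<noteq> {}" using assms(2) by auto
  have hull: "affine hull \<tau> = affine hull (\<Union>\<T>)"
    using \<T>(3) dim_\<tau> \<open>\<tau> \<noteq> {}\<close> by (intro affine_dim_equal hull_mono Union_upper \<tau>) auto
  have "rel_interior \<tau> \<subseteq> S"
    unfolding \<T>(4) using \<tau> hull by (intro rel_interior_mono) auto
  then have "aff_dim (rel_interior \<tau>) \<le> aff_dim S" by (rule aff_dim_subset)
  moreover have "aff_dim (rel_interior \<tau>) = d" using rel_interior_aff_dim[OF conv] dim_\<tau> by simp
  moreover have S_sub: "S \<subseteq> \<Union>\<T>" unfolding \<T>(4) by (rule rel_interior_subset)
  ultimately have dim: "aff_dim S = d" using aff_dim_subset[OF S_sub] \<T>(3) by simp
  then have "S \<noteq> {}" using assms(2) by auto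
  then have "affine hull S = affine hull (\<Union>\<T>)"
    using dim \<T>(3) by (intro affine_dim_equal hull_mono S_sub) auto
  moreover have "compact (\<Union>\<T>)" using \<T>(1,2) compact_simplex by (intro compact_Union) auto
  ultimately show ?thesis using that \<T>(4) dim by blast
qed

lemma polytopal_domain_basic:
  assumes "polytopal_domain d S" and "0 \<le> d"
  shows polytopal_domain_aff_dim: "aff_dim S = d"
    and polytopal_domain_openin: "openin (top_of_set (affine hull S)) S"
    and polytopal_domain_bounded: "bounded S"
    and polytopal_domain_connected: "connected S"
    and polytopal_domain_closure: "closure S = S \<union> rel_frontier S"
proof -
  obtain C where C: "compact C" "S = rel_interior C" "affine hull S = affine hull C" "aff_dim S = d"
    by (rule polytopal_domainE[OF assms])
  show "aff_dim S = d" by fact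
  show op: "openin (top_of_set (affine hull S)) S" using openin_rel_interior[of C] C by simp
  show "bounded S" using C compact_imp_bounded bounded_subset rel_interior_subset by metis
  show "connected S" using assms(1) by (simp add: polytopal_domain_def)
  have "rel_interior S = S" using op by (simp add: rel_interior_eq)
  then show "closure S = S \<union> rel_frontier S" using closure_subset by (auto simp: rel_frontier_def)
qed

lemma isometric_chart_range: "isometric_chart \<phi> X \<Longrightarrow> range \<phi> = affine hull X"
  by (simp add: isometric_chart_def)

lemma isometric_chart_closure:
  assumes chart: "isometric_chart \<phi> X" and Y: "Y \<subseteq> affine hull X"
  shows "closure (\<phi> -` Y) = \<phi> -` closure Y"
proof
  show "closure (\<phi> -` Y) \<subseteq> \<phi> -` closure Y"
    using closure_subset[of Y] isometric_chart_continuous[OF chart, of UNIV]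
    by (intro closure_minimal) (auto intro: closed_vimage)
  show "\<phi> -` closure Y \<subseteq> closure (\<phi> -` Y)"
  proof
    fix y assume y: "y \<in> \<phi> -` closure Y"
    show "y \<in> closure (\<phi> -` Y)" unfolding closure_approachable
    proof safe
      fix e :: real assume "e > 0"
      then obtain x where x: "x \<in> Y" "dist x (\<phi> y) < e" using y by (auto simp: closure_approachable)
      then obtain z where "x = \<phi> z" using Y isometric_chart_range[OF chart] by blast
      then show "\<exists>z\<in>\<phi> -` Y. dist z y < e" using x isometric_chart_dist[OF chart] by auto
    qed
  qed
qed

text \<open>\<open>S\<close> is the relative interior of a closed set \<open>C\<close> that contains
  the closure of \<open>S\<close>. A ball inside the closure is therefore inside \<open>C\<close>,
  and its centre is a relative interior point of \<open>C\<close>.\<close>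

lemma isometric_chart_regular:
  assumes chart: "isometric_chart \<phi> S" and S: "polytopal_domain d S" "0 \<le> d"
  shows "interior (closure (\<phi> -` S)) \<subseteq> \<phi> -` S"
proof
  fix y assume y: "y \<in> interior (closure (\<phi> -` S))"
  obtain C where C: "compact C" "S = rel_interior C" "affine hull S = affine hull C"
    by (rule polytopal_domainE[OF S])
  obtain e where e: "e > 0" "ball y e \<subseteq> closure (\<phi> -` S)" using y by (auto simp: mem_interior)
  have "closure S \<subseteq> C"
    unfolding C(2) using C(1) compact_imp_closed rel_interior_subset by (metis closure_minimal)
  then have sub: "\<phi> z \<in> C" if "z \<in> ball y e" for z
    using e(2) that isometric_chart_closure[OF chart hull_subset] by auto
  have "ball (\<phi> y) e \<inter> affine hull C \<subseteq> C"
  proof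
    fix x assume x: "x \<in> ball (\<phi> y) e \<inter> affine hull C"
    then obtain z where "x = \<phi> z" using isometric_chart_range[OF chart] C(3) by blast
    then show "x \<in> C" using sub[of z] x isometric_chart_dist[OF chart, of y z] by simp
  qed
  then show "y \<in> \<phi> -` S"
    using sub[of y] e(1) by (auto simp: C(2) mem_rel_interior_ball)
qed

lemma polytopal_domain_frontier_chart:
  assumes chart: "isometric_chart \<phi> S" and S: "polytopal_domain d S" "0 \<le> d"
  shows "frontier (\<phi> -` S) = \<phi> -` rel_frontier S"
proof -
  have "rel_interior S = S" using polytopal_domain_openin[OF S] by (simp add: rel_interior_eq)
  moreover have "open (\<phi> -` S)"
    by (rule isometric_chart_open_vimage[OF chart polytopal_domain_openin[OF S]])
  ultimately show ?thesis
    using isometric_chart_closure[OF chart hull_subset]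
    by (auto simp: frontier_def interior_open rel_frontier_def)
qed

section \<open>Faces and edges of a polyhedron\<close>

locale polyhedron =
  fixes K :: polyhedral_cell
  assumes polyhedron: "polyhedron_with_faces K"
begin

lemma body: "polytopal_domain 3 (body K)"
  and finite_faces: "finite (faces K)"
  and face: "F \<in> faces K \<Longrightarrow> polytopal_domain 2 F"
  and finite_edges: "finite (edges K)"
  and edge: "E \<in> edges K \<Longrightarrow> \<exists>a b. a \<noteq> b \<and> E = open_segment a b \<and> tng K E = sgn (b - a)"
  and disjoint_cells: "pairwise disjnt (faces K \<union> edges K)"
  and disjoint_vertices: "E \<in> edges K \<Longrightarrow> X \<in> faces K \<union> edges K \<Longrightarrow> disjnt X (rel_frontier E)"
  and frontier_body: "frontier (body K) = \<Union> (closure ` faces K)"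
  and rel_frontier_face: "F \<in> faces K \<Longrightarrow> rel_frontier F = \<Union> (closure ` edges_of K F)"
  and norm_nrm: "F \<in> faces K \<Longrightarrow> norm (nrm K F) = 1"
  and face_flat: "F \<in> faces K \<Longrightarrow> x \<in> F \<Longrightarrow> y \<in> F \<Longrightarrow> (x - y) \<bullet> nrm K F = 0"
  using polyhedron unfolding polyhedron_with_faces_def by simp_all

lemma edges_of: "E \<in> edges_of K F \<Longrightarrow> E \<in> edges K" "E \<in> edges_of K F \<Longrightarrow> E \<subseteq> rel_frontier F"
  by (auto simp: edges_of_def)

lemma edge_end_points:
  assumes "E \<in> edges K"
  obtains a b where "a \<noteq> b" "E = open_segment a b" "tng K E = sgn (b - a)"
    "rel_frontier E = {a, b}" "affine hull E = affine hull {a, b}"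
proof -
  obtain a b where ab: "a \<noteq> b" "E = open_segment a b" "tng K E = sgn (b - a)" using edge[OF assms] by blast
  then have "closure E = closed_segment a b" by simp
  then have "rel_frontier E = {a, b}"
    unfolding rel_frontier_def ab(2) rel_interior_open_segment by (auto simp: open_segment_def)
  with ab show ?thesis by (intro that[of a b]) auto
qed

lemma
  assumes "E \<in> edges K"
  shows edge_closure: "closure E = E \<union> rel_frontier E"
    and edge_aff_dim: "aff_dim E = 1"
    and edge_openin: "openin (top_of_set (affine hull E)) E"
    and edge_bounded: "bounded E"
    and edge_vertices_finite: "finite (rel_frontier E)"
proof -
  obtain a b where ab: "a \<noteq> b" "E = open_segment a b" "rel_frontier E = {a, b}"
    "affine hull E = affine hull {a, b}" by (rule edge_end_points[OF assms])
  have ri: "rel_interior E = E" by (simp add: ab(2) rel_interior_open_segment)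
  then show "closure E = E \<union> rel_frontier E" using closure_subset[of E] by (auto simp: rel_frontier_def)
  show "openin (top_of_set (affine hull E)) E" using ri by (simp add: rel_interior_eq)
  show "aff_dim E = 1" using ab(1,4) by (metis aff_dim_2 aff_dim_affine_hull)
  show "bounded E" by (simp add: ab(2) bounded_open_segment)
  show "finite (rel_frontier E)" by (simp add: ab(3))
qed

text \<open>The hull lies in the plane orthogonal to the normal and has the same dimension 2, so it
  is that plane.\<close>

lemma face_hull:
  assumes F: "F \<in> faces K" and x: "x \<in> affine hull F"
  shows "affine hull F = {y. (y - x) \<bullet> nrm K F = 0}"
proof -
  let ?n = "nrm K F"
  have "F \<noteq> {}" using polytopal_domain_aff_dim[OF face[OF F]] by auto
  then obtain z where z: "z \<in> F" by blast
  have n: "?n \<noteq> 0" using norm_nrm[OF F] by auto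
  have H: "affine hull F = {y. ?n \<bullet> y = ?n \<bullet> z}"
  proof (rule affine_dim_equal)
    show "affine hull F \<subseteq> {y. ?n \<bullet> y = ?n \<bullet> z}"
      using face_flat[OF F _ z]
      by (intro hull_minimal affine_hyperplane) (auto simp: inner_diff_left inner_commute[of ?n])
    show "aff_dim (affine hull F) = aff_dim {y. ?n \<bullet> y = ?n \<bullet> z}"
      using n polytopal_domain_aff_dim[OF face[OF F]] by simp
  qed (use \<open>F \<noteq> {}\<close> affine_hyperplane in auto)
  have "nrm K F \<bullet> x = nrm K F \<bullet> z" using x unfolding H by simp
  then show ?thesis unfolding H by (simp add: inner_diff_left inner_commute[of "nrm K F"])
qed

lemma closure_face_subset_hull:
  fixes F :: "(real^3) set"
  shows "closure F \<subseteq> affine hull F"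
  by (intro closure_minimal hull_subset closed_affine_hull)

lemma closure_edge_subset_hull:
  assumes "F \<in> faces K" "E \<in> edges_of K F"
  shows "closure E \<subseteq> affine hull F"
proof -
  have "closure E \<subseteq> rel_frontier F" using rel_frontier_face[OF assms(1)] assms(2) by blast
  also have "\<dots> \<subseteq> closure F" by (auto simp: rel_frontier_def)
  finally show ?thesis using closure_face_subset_hull by blast
qed

lemma face_disjoint_closure:
  assumes "F \<in> faces K" "G \<in> faces K" "F \<noteq> G"
  shows "F \<inter> closure G = {}"
proof -
  have "F \<inter> closure E = {}" if E: "E \<in> edges_of K G" for E
  proof -
    have E': "E \<in> edges K" using edges_of(1)[OF E] .
    \<comment> \<open>Disjointness of cells is assumed for distinct members of one family holding
      faces and edges; the dimension tells a face from an edge.\<close>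
    have "F \<noteq> E"
    proof
      assume "F = E"
      moreover have "aff_dim E = 1" by (rule edge_aff_dim[OF E'])
      ultimately show False using polytopal_domain_aff_dim[OF face[OF assms(1)]] by simp
    qed
    then have "disjnt F E" using disjoint_cells assms(1) E' by (auto simp: pairwise_def)
    moreover have "disjnt F (rel_frontier E)" using disjoint_vertices[OF E'] assms(1) by blast
    moreover note edge_closure[OF E']
    ultimately show ?thesis by (auto simp: disjnt_def)
  qed
  moreover have "disjnt F G" using disjoint_cells assms by (auto simp: pairwise_def)
  ultimately show ?thesis
    using polytopal_domain_closure[OF face[OF assms(2)]] rel_frontier_face[OF assms(2)]
    by (auto simp: disjnt_def)
qed

lemma face_chart_affine:
  assumes F: "F \<in> faces K"
  shows "\<exists>a L. face_chart F = (\<lambda>y. a + L y) \<and> linear L \<and> (\<forall>y. norm (L y) = norm y) \<and>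
    (\<forall>y. L y \<bullet> nrm K F = 0) \<and> a \<in> affine hull F \<and> range (\<lambda>y. a + L y) = affine hull F"
proof -
  have "isometric_chart (face_chart F) F"
    using polytopal_domain_aff_dim[OF face[OF F]] by (intro face_chart) simp
  then obtain a L where L: "face_chart F = (\<lambda>y. a + L y)" "linear L" "\<forall>y. norm (L y) = norm y"
      and range: "range (face_chart F) = affine hull F"
    unfolding isometric_chart_def by blast
  then have mem: "a + L y \<in> affine hull F" for y by (metis rangeI)
  from mem[of 0] have a: "a \<in> affine hull F" using linear_0[OF L(2)] by simp
  have "\<forall>y. L y \<bullet> nrm K F = 0" using mem face_hull[OF F a] by auto
  then show ?thesis using L a range by (intro exI[of _ a] exI[of _ L] conjI) simp_all
qed

definition face_level :: "(real^3) set \<Rightarrow> real" where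
  "face_level F = (SOME x. x \<in> affine hull F) \<bullet> nrm K F"

lemma face_level: "F \<in> faces K \<Longrightarrow> x \<in> affine hull F \<longleftrightarrow> x \<bullet> nrm K F = face_level F"
proof -
  assume F: "F \<in> faces K"
  have "F \<noteq> {}" using polytopal_domain_aff_dim[OF face[OF F]] by auto
  then have "(SOME x. x \<in> affine hull F) \<in> affine hull F"
    by (intro someI_ex[of "\<lambda>x. x \<in> affine hull F"]) auto
  from face_hull[OF F this] show "x \<in> affine hull F \<longleftrightarrow> x \<bullet> nrm K F = face_level F"
    by (auto simp: face_level_def inner_diff_left)
qed

lemma open_body: "open (body K)"
  and bounded_body: "bounded (body K)"
  and body_nonempty: "body K \<noteq> {}"
  and affine_hull_body: "affine hull (body K) = UNIV"
proof -
  have dim: "aff_dim (body K) = 3" using polytopal_domain_aff_dim[OF body] by simp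
  show ne: "body K \<noteq> {}" using dim by auto
  show hull: "affine hull (body K) = UNIV"
    using dim ne by (intro affine_dim_equal) auto
  show "open (body K)" using polytopal_domain_openin[OF body] hull by simp
  show "bounded (body K)" using polytopal_domain_bounded[OF body] by simp
qed

text \<open>The skeleton consists of the closed edges, of dimension 1 = 3 - 2.\<close>

sublocale cell: faceted_region "body K" "faces K" "\<lambda>F. F" "nrm K" face_level "closure ` edges K"
proof
  have id: "isometric_chart (\<lambda>y. y) (body K)"
    unfolding isometric_chart_def using affine_hull_body
    by (intro conjI exI[of _ 0] exI[of _ "\<lambda>y. y"]) (auto simp: linear_id[unfolded id_def])
  show "interior (closure (body K)) \<subseteq> body K"
    using isometric_chart_regular[OF id body] by simp
  fix F assume F: "F \<in> faces K"
  note dom = face[OF F]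
  show "x \<bullet> nrm K F = face_level F" if "x \<in> F" for x
    using face_level[OF F, of x] hull_inc[OF that, of affine] by blast
  show "\<exists>e>0. \<forall>y\<in>ball x e. y \<bullet> nrm K F = face_level F \<longrightarrow> y \<in> F" if x: "x \<in> F" for x
  proof -
    obtain e where "e > 0" "ball x e \<inter> affine hull F \<subseteq> F"
      using polytopal_domain_openin[OF dom] x by (auto simp: openin_contains_ball)
    then show ?thesis using face_level[OF F] by blast
  qed
  show "connected F" using polytopal_domain_connected[OF dom] by simp
  show "closure F - F \<subseteq> \<Union> (closure ` edges K)"
    using polytopal_domain_closure[OF dom] rel_frontier_face[OF F] edges_of(1) by fastforce
next
  fix M assume "M \<in> closure ` edges K"
  then obtain E where "E \<in> edges K" "M = closure E" by blast
  then have "aff_dim M = 1" using edge_aff_dim[of E] by (metis aff_dim_affine_hull2 closure_same_affine_hull)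
  then show "aff_dim M \<le> int DIM(real^3) - 2" by simp
qed (use open_body bounded_body finite_faces finite_edges norm_nrm face_disjoint_closure frontier_body in auto)

lemma integral_directional_derivative_cell:
  assumes "continuous_on UNIV f" "continuous_on UNIV g"
    and "\<And>x t. ((\<lambda>t. f (x + t *\<^sub>R d)) has_real_derivative g (x + t *\<^sub>R d)) (at t)"
  shows "int_cell (body K) g = (\<Sum>F\<in>faces K. omega_TF K F * (d \<bullet> nrm K F) * int_face F f)"
proof -
  have "\<forall>F\<in>faces K. \<exists>a L. face_chart F = (\<lambda>y. a + L y) \<and> linear L \<and>
      (\<forall>y. norm (L y) = norm y) \<and> (\<forall>y. L y \<bullet> nrm K F = 0) \<and> a \<bullet> nrm K F = face_level F"
    using face_chart_affine face_level by blast
  then obtain a L where aL: "\<And>F. F \<in> faces K \<Longrightarrow> face_chart F = (\<lambda>y. a F + L F y) \<and> linear (L F) \<and>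
      (\<forall>y. norm (L F y) = norm y) \<and> (\<forall>y. L F y \<bullet> nrm K F = 0) \<and> a F \<bullet> nrm K F = face_level F"
    by metis
  have "(\<integral>x. indicator (body K) x * g x \<partial>lborel) = (\<Sum>F\<in>faces K. cell.orient F * (d \<bullet> nrm K F) *
     (\<integral>y. indicator ((\<lambda>y. a F + L F y) -` F) y * f (a F + L F y) \<partial>(lborel :: (real \<times> real) measure)))"
    using aL assms by (intro cell.integral_directional_derivative) auto
  also have "\<dots> = (\<Sum>F\<in>faces K. omega_TF K F * (d \<bullet> nrm K F) * int_face F f)"
  proof (intro sum.cong refl)
    fix F assume "F \<in> faces K"
    then have "face_chart F = (\<lambda>y. a F + L F y)" using aL by blast
    then show "cell.orient F * (d \<bullet> nrm K F) *
       (\<integral>y. indicator ((\<lambda>y. a F + L F y) -` F) y * f (a F + L F y) \<partial>(lborel :: (real \<times> real) measure))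
      = omega_TF K F * (d \<bullet> nrm K F) * int_face F f"
      by (simp add: int_face_eq set_lebesgue_integral_def cell.orient_def omega_TF_def points_out_of_def)
  qed
  finally show ?thesis by (simp add: int_cell_def set_lebesgue_integral_def)
qed

end

section \<open>A face as a planar region bounded by its edges\<close>

lemma cross3_dot_zero_unit:
  fixes n t w :: "real^3"
  assumes "norm n = 1" "norm t = 1" "t \<bullet> n = 0" "w \<bullet> n = 0" "w \<bullet> cross3 n t = 0"
  shows "w = (w \<bullet> t) *\<^sub>R t"
proof -
  define u where "u = w - (w \<bullet> t) *\<^sub>R t"
  have t: "t \<bullet> t = 1" and n: "n \<bullet> n = 1" using assms by (simp_all add: norm_eq_1)
  have 1: "u \<bullet> t = 0" using t by (simp add: u_def inner_diff_left)
  have 2: "u \<bullet> n = 0" using assms(3,4) by (simp add: u_def inner_diff_left)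
  have 3: "u \<bullet> cross3 n t = 0" using assms(5) by (simp add: u_def inner_diff_left dot_cross_self)
  \<comment> \<open>\<open>u\<close> is orthogonal to the whole frame n, t, n x t. By Lagrange its
    cross product with n x t is 0, and since both are orthogonal and n x t is a unit vector, |u| =
    0.\<close>
  have "cross3 u (cross3 n t) = (u \<bullet> t) *\<^sub>R n - (u \<bullet> n) *\<^sub>R t" by (rule Lagrange)
  then have "cross3 u (cross3 n t) = 0" using 1 2 by simp
  moreover have "(norm (cross3 u (cross3 n t)))\<^sup>2 = (norm u)\<^sup>2 * (norm (cross3 n t))\<^sup>2 - (u \<bullet> cross3 n t)\<^sup>2"
    by (rule norm_cross)
  moreover have "(norm (cross3 n t))\<^sup>2 = 1"
    using assms(1-3) by (simp add: norm_cross inner_commute)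
  ultimately have "(norm u)\<^sup>2 = 0" using 3 by simp
  then show ?thesis by (simp add: u_def)
qed

context polyhedron
begin

text \<open>Normal to the edge within the plane of the face. By the convention in
  \<open>omega_FE\<close> the sign is 1 exactly when this vector points out of the face.\<close>

definition edge_normal :: "(real^3) set \<Rightarrow> (real^3) set \<Rightarrow> real^3" where
  "edge_normal F E = cross3 (nrm K F) (tng K E)"

lemma edge_frame:
  assumes F: "F \<in> faces K" and E: "E \<in> edges_of K F"
  shows "norm (tng K E) = 1" "tng K E \<bullet> nrm K F = 0" "norm (edge_normal F E) = 1"
    "edge_normal F E \<bullet> nrm K F = 0"
    "x \<in> affine hull E \<Longrightarrow> y \<in> affine hull E \<Longrightarrow> (x - y) \<bullet> edge_normal F E = 0"
    "x \<in> affine hull E \<Longrightarrow> x + s *\<^sub>R tng K E \<in> affine hull E"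
proof -
  obtain a b where ab: "a \<noteq> b" "E = open_segment a b" "tng K E = sgn (b - a)"
    "rel_frontier E = {a, b}" "affine hull E = affine hull {a, b}"
    by (rule edge_end_points[OF edges_of(1)[OF E]])
  show t: "norm (tng K E) = 1" using ab by (simp add: norm_sgn)
  have "a \<in> affine hull F" "b \<in> affine hull F"
    using closure_edge_subset_hull[OF F E] edge_closure[OF edges_of(1)[OF E]] ab(4) by auto
  then have "(b - a) \<bullet> nrm K F = 0" using face_level[OF F] by (simp add: inner_diff_left)
  then show tn: "tng K E \<bullet> nrm K F = 0" by (simp add: ab(3) sgn_div_norm)
  show "norm (edge_normal F E) = 1"
  proof -
    have "(norm (edge_normal F E))\<^sup>2 = 1"
      using t tn norm_nrm[OF F] by (simp add: edge_normal_def norm_cross inner_commute)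
    then show ?thesis by (simp add: power2_eq_1_iff) (metis norm_ge_zero not_one_le_zero neg_0_le_iff_le)
  qed
  show "edge_normal F E \<bullet> nrm K F = 0"
    by (simp add: edge_normal_def dot_cross_self)
  have hull: "affine hull E \<subseteq> {x. edge_normal F E \<bullet> x = edge_normal F E \<bullet> a}"
    unfolding ab(5)
  proof (intro hull_minimal affine_hyperplane)
    have "tng K E \<bullet> edge_normal F E = 0" by (simp add: edge_normal_def dot_cross_self)
    moreover have "b = a + norm (b - a) *\<^sub>R tng K E" using ab(1) by (simp add: ab(3) sgn_div_norm)
    ultimately have "edge_normal F E \<bullet> b = edge_normal F E \<bullet> a"
      by (metis add.right_neutral inner_add_right inner_commute inner_scaleR_right mult_zero_right)
    then show "{a, b} \<subseteq> {x. edge_normal F E \<bullet> x = edge_normal F E \<bullet> a}" by simp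
  qed
  show "(x - y) \<bullet> edge_normal F E = 0" if "x \<in> affine hull E" "y \<in> affine hull E"
  proof -
    have "edge_normal F E \<bullet> x = edge_normal F E \<bullet> y"
      using subsetD[OF hull that(1)] subsetD[OF hull that(2)] by simp
    then show ?thesis
      by (simp add: inner_diff_left inner_commute[of x "edge_normal F E"] inner_commute[of y "edge_normal F E"])
  qed
  show "x + s *\<^sub>R tng K E \<in> affine hull E" if "x \<in> affine hull E"
  proof -
    have "x + s *\<^sub>R tng K E = x + (s / norm (b - a)) *\<^sub>R (b - a)"
      by (simp add: ab(3) sgn_div_norm divide_inverse)
    also have "\<dots> \<in> affine hull E"
      using that unfolding ab(5) by (intro mem_affine_3_minus affine_affine_hull) (auto intro: hull_inc)
    finally show ?thesis .
  qed
qed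

lemma edge_disjoint_closure:
  assumes "E \<in> edges K" "E' \<in> edges K" "E \<noteq> E'"
  shows "E \<inter> closure E' = {}"
proof -
  note edge_closure[OF assms(2)]
  moreover have "disjnt E E'" using disjoint_cells assms by (auto simp: pairwise_def)
  moreover have "disjnt E (rel_frontier E')" using disjoint_vertices assms by blast
  ultimately show ?thesis by (auto simp: disjnt_def)
qed

text \<open>The facet formula is applied in the chart of the face: facets are the preimages of the
  edges, and the skeleton consists of single points, of dimension 0 = 2 - 2. Directions and normals
  are carried over by \<open>L\<close>, which preserves inner products.\<close>

lemma integral_directional_derivative_face:
  assumes F: "F \<in> faces K" and d: "d \<bullet> nrm K F = 0"
    and f: "continuous_on UNIV f" and g: "continuous_on UNIV g"
    and deriv: "\<And>x t. ((\<lambda>t. f (x + t *\<^sub>R d)) has_real_derivative g (x + t *\<^sub>R d)) (at t)"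
  shows "int_face F g = (\<Sum>E\<in>edges_of K F. omega_FE K F E * (d \<bullet> edge_normal F E) * int_edge E f)"
proof -
  let ?\<phi> = "face_chart F"
  obtain a L where "?\<phi> = (\<lambda>y. a + L y) \<and> linear L \<and> (\<forall>y. norm (L y) = norm y) \<and>
    (\<forall>y. L y \<bullet> nrm K F = 0) \<and> a \<in> affine hull F \<and> range (\<lambda>y. a + L y) = affine hull F"
    using face_chart_affine[OF F] by blast
  then have aL: "?\<phi> = (\<lambda>y. a + L y)" "linear L" "norm (L y) = norm y"
    "L y \<bullet> nrm K F = 0" "a \<in> affine hull F" "range (\<lambda>y. a + L y) = affine hull F" for y
    by blast+
  have chart: "isometric_chart ?\<phi> F"
    using polytopal_domain_aff_dim[OF face[OF F]] by (intro face_chart) simp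
  have inner_L: "L x \<bullet> L y = x \<bullet> y" for x y
    using aL(2,3) by (simp add: dot_norm linear_add[symmetric])
  have onto: "\<exists>y. L y = w" if "w \<bullet> nrm K F = 0" for w
  proof -
    have "a + w \<in> affine hull F" using face_hull[OF F aL(5)] that by auto
    then show ?thesis using aL(6) by (metis (no_types, lifting) add_left_cancel rangeE)
  qed
  have \<phi>_hull: "?\<phi> y \<in> affine hull F" for y using isometric_chart_range[OF chart] by blast
  have L_diff: "L (x - y) = ?\<phi> x - ?\<phi> y" for x y by (simp add: aL(1) linear_diff[OF aL(2)])
  obtain d' where d': "L d' = d" using onto[OF d] by blast
  have "\<forall>E\<in>edges_of K F. \<exists>\<nu>. L \<nu> = edge_normal F E"
    using onto edge_frame(4)[OF F] by blast
  then obtain \<nu> where \<nu>: "\<And>E. E \<in> edges_of K F \<Longrightarrow> L (\<nu> E) = edge_normal F E" by metis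
  have E_hull: "E \<subseteq> affine hull F" if "E \<in> edges_of K F" for E
    using closure_edge_subset_hull[OF F that] closure_subset by blast
  have \<nu>_inner: "(y - z) \<bullet> \<nu> E = (?\<phi> y - ?\<phi> z) \<bullet> edge_normal F E" if "E \<in> edges_of K F" for E y z
    using inner_L[of "y - z" "\<nu> E"] by (simp add: \<nu>[OF that] L_diff)
  \<comment> \<open>The level of the line through the edge in chart coordinates. Any point of that
    line serves, since the edge normal is constant along it; \<open>a\<close> is the base point of
    the chart.\<close>
  define \<beta> where "\<beta> E = ((SOME x. x \<in> affine hull E) - a) \<bullet> edge_normal F E" for E
  have \<nu>_level: "y \<bullet> \<nu> E = \<beta> E" if "E \<in> edges_of K F" "?\<phi> y \<in> affine hull E" for E y
    using inner_L[of y "\<nu> E"] edge_frame(5)[OF F that(1) that(2) someI[of "\<lambda>x. x \<in> affine hull E", OF that(2)]]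
    by (simp add: \<beta>_def \<nu>[OF that(1)] aL(1) inner_diff_left inner_add_left)
  let ?N = "(\<lambda>y. {y}) ` (?\<phi> -` \<Union> (rel_frontier ` edges_of K F))"
  have finite_edges_of: "finite (edges_of K F)" using finite_edges by (simp add: edges_of_def)
  have inj: "inj ?\<phi>" using isometric_chart_dist[OF chart] by (metis dist_eq_0_iff injI)
  interpret poly: faceted_region "?\<phi> -` F" "edges_of K F" "\<lambda>E. ?\<phi> -` E" \<nu> \<beta> ?N
  proof
    show "finite (edges_of K F)" by fact
    show "bounded (?\<phi> -` F)"
      using polytopal_domain_bounded[OF face[OF F]] by (intro isometric_chart_bounded_vimage[OF chart]) simp
    show "open (?\<phi> -` F)"
      using polytopal_domain_openin[OF face[OF F]] by (intro isometric_chart_open_vimage[OF chart]) simp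
    show "interior (closure (?\<phi> -` F)) \<subseteq> ?\<phi> -` F"
      by (rule isometric_chart_regular[OF chart face[OF F]]) simp
    show "frontier (?\<phi> -` F) = (\<Union>E\<in>edges_of K F. closure (?\<phi> -` E))"
      using polytopal_domain_frontier_chart[OF chart face[OF F]] rel_frontier_face[OF F]
        isometric_chart_closure[OF chart E_hull] by auto
    show "finite ?N"
      using finite_edges_of inj edge_vertices_finite[OF edges_of(1)]
      by (intro finite_imageI finite_vimageI) auto
    show "aff_dim M \<le> int DIM(real \<times> real) - 2" if "M \<in> ?N" for M
      using that by auto
  next
    fix E assume E: "E \<in> edges_of K F"
    note E' = edges_of(1)[OF E]
    show "norm (\<nu> E) = 1" using aL(3)[of "\<nu> E"] edge_frame(3)[OF F E] \<nu>[OF E] by simp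
    show "y \<bullet> \<nu> E = \<beta> E" if "y \<in> ?\<phi> -` E" for y
      using \<nu>_level[OF E, of y] that by (simp add: hull_inc)
    show "\<exists>e>0. \<forall>z\<in>ball y e. z \<bullet> \<nu> E = \<beta> E \<longrightarrow> z \<in> ?\<phi> -` E" if y: "y \<in> ?\<phi> -` E" for y
    proof -
      have y_hull: "?\<phi> y \<in> affine hull E" using y by (simp add: hull_inc)
      obtain e where e: "e > 0" "ball (?\<phi> y) e \<inter> affine hull E \<subseteq> E"
        using edge_openin[OF E'] y by (auto simp: openin_contains_ball)
      have "z \<in> ?\<phi> -` E" if z: "z \<in> ball y e" "z \<bullet> \<nu> E = \<beta> E" for z
      proof -
        \<comment> \<open>A vector orthogonal to the face normal and to the edge normal is a
          multiple of the tangent, so z stays on the line of the edge.\<close>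
        have "(?\<phi> z - ?\<phi> y) \<bullet> edge_normal F E = 0"
          using \<nu>_inner[OF E, of z y] z(2) \<nu>_level[OF E y_hull] by (simp add: inner_diff_left)
        moreover have "(?\<phi> z - ?\<phi> y) \<bullet> nrm K F = 0"
          using face_hull[OF F \<phi>_hull[of y]] \<phi>_hull[of z] by auto
        ultimately obtain s where "?\<phi> z - ?\<phi> y = s *\<^sub>R tng K E"
          using cross3_dot_zero_unit[OF norm_nrm[OF F] edge_frame(1,2)[OF F E], of "?\<phi> z - ?\<phi> y"]
          by (auto simp: edge_normal_def)
        then have "?\<phi> z = ?\<phi> y + s *\<^sub>R tng K E" by (simp add: algebra_simps)
        then have "?\<phi> z \<in> affine hull E" using edge_frame(6)[OF F E y_hull] by simp
        moreover have "?\<phi> z \<in> ball (?\<phi> y) e" using z(1) isometric_chart_dist[OF chart] by simp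
        ultimately show ?thesis using e(2) by blast
      qed
      then show ?thesis using e(1) by blast
    qed
    show "connected (?\<phi> -` E)"
    proof (rule convex_connected, rule convexI)
      fix x y and u v :: real
      assume xy: "x \<in> ?\<phi> -` E" "y \<in> ?\<phi> -` E" and uv: "0 \<le> u" "0 \<le> v" "u + v = 1"
      have "?\<phi> (u *\<^sub>R x + v *\<^sub>R y) = u *\<^sub>R ?\<phi> x + v *\<^sub>R ?\<phi> y"
        using uv(3) by (simp add: aL(1) linear_add[OF aL(2)] linear_scale[OF aL(2)] scaleR_add_right)
          (metis scaleR_add_left scaleR_one add.assoc add.left_commute)
      moreover have "convex E" using edge[OF E'] by auto
      ultimately show "u *\<^sub>R x + v *\<^sub>R y \<in> ?\<phi> -` E" using xy uv by (simp add: convexD)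
    qed
    show "closure (?\<phi> -` E) - ?\<phi> -` E \<subseteq> \<Union> ?N"
      using isometric_chart_closure[OF chart E_hull[OF E]] edge_closure[OF E'] E by auto
    show "?\<phi> -` E \<inter> closure (?\<phi> -` E') = {}" if "E' \<in> edges_of K F" "E \<noteq> E'" for E'
      using isometric_chart_closure[OF chart E_hull[OF that(1)]]
        edge_disjoint_closure[OF edges_of(1)[OF E] edges_of(1)[OF that(1)] that(2)] by auto
  qed
  \<comment> \<open>A parametrisation of the edge inside the chart of the face whose composition
    with that chart is the very chart used by \<open>int_edge\<close>.\<close>
  let ?C = "\<lambda>E m M. linear M \<and> (\<forall>s::real. norm (M s) = norm s) \<and> (\<forall>s. M s \<bullet> \<nu> E = 0)
      \<and> m \<bullet> \<nu> E = \<beta> E \<and> (\<forall>s. ?\<phi> (m + M s) = edge_chart E s)"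
  have "\<forall>E\<in>edges_of K F. \<exists>m M. ?C E m M"
  proof
    fix E assume E: "E \<in> edges_of K F"
    note E' = edges_of(1)[OF E]
    have ec: "isometric_chart (edge_chart E) E" by (rule edge_chart[OF edge_aff_dim[OF E']])
    then obtain b R where R: "linear R" "\<And>s. norm (R s) = norm s" "edge_chart E = (\<lambda>s. b + R s)"
      unfolding isometric_chart_def by blast
    have in_hull: "b + R s \<in> affine hull E" for s using isometric_chart_range[OF ec] R(3) by auto
    have b: "b \<in> affine hull E" using in_hull[of 0] linear_0[OF R(1)] by simp
    have "affine hull E \<subseteq> affine hull F"
      using hull_mono[OF E_hull[OF E], of affine] by simp
    then obtain m where m: "?\<phi> m = b" using b isometric_chart_range[OF chart] by (metis rangeE subsetD)
    have R0: "R s \<bullet> nrm K F = 0" for s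
    proof -
      have "b \<in> affine hull F" "b + R s \<in> affine hull F"
        using \<open>affine hull E \<subseteq> affine hull F\<close> in_hull[of s] b by (simp_all add: subsetD)
      then have "(b + R s) \<bullet> nrm K F = b \<bullet> nrm K F"
        using face_level[OF F, of b] face_level[OF F, of "b + R s"] by simp
      then show ?thesis by (simp add: inner_add_left)
    qed
    \<comment> \<open>The unit direction of the edge chart, pulled back to the chart of the
      face.\<close>
    obtain w where w: "L w = R 1" using onto[OF R0] by blast
    have R_w: "L (s *\<^sub>R w) = R s" for s
      using linear_scale[OF aL(2), of s w] linear_scale[OF R(1), of s 1] w by simp
    have "norm (s *\<^sub>R w) = norm s" for s using aL(3)[of "s *\<^sub>R w"] R(2)[of s] R_w by simp
    moreover have "(s *\<^sub>R w) \<bullet> \<nu> E = 0" for s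
      using inner_L[of "s *\<^sub>R w" "\<nu> E"] edge_frame(5)[OF F E in_hull[of s] b] by (simp only: R_w \<nu>[OF E]) simp
    moreover have "m \<bullet> \<nu> E = \<beta> E" using \<nu>_level[OF E, of m] b m by simp
    moreover have "?\<phi> (m + s *\<^sub>R w) = edge_chart E s" for s
      using m R_w[of s] by (simp add: aL(1) R(3) linear_add[OF aL(2)])
    moreover have "linear (\<lambda>s. s *\<^sub>R w)" by (simp add: linear_scaleR_left)
    ultimately show "\<exists>m M. ?C E m M" by blast
  qed
  then obtain m M where mM: "\<And>E. E \<in> edges_of K F \<Longrightarrow> ?C E (m E) (M E)"
    by metis
  have cont_\<phi>: "continuous_on UNIV ?\<phi>" by (rule isometric_chart_continuous[OF chart])
  have "(\<integral>y. indicator (?\<phi> -` F) y * g (?\<phi> y) \<partial>lborel)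
    = (\<Sum>E\<in>edges_of K F. poly.orient E * (d' \<bullet> \<nu> E) *
        (\<integral>s. indicator ((\<lambda>s. m E + M E s) -` (?\<phi> -` E)) s * f (?\<phi> (m E + M E s)) \<partial>(lborel :: real measure)))"
  proof (rule poly.integral_directional_derivative)
    show "continuous_on UNIV (\<lambda>y. f (?\<phi> y))" "continuous_on UNIV (\<lambda>y. g (?\<phi> y))"
      using continuous_on_compose2[OF f cont_\<phi>] continuous_on_compose2[OF g cont_\<phi>] by auto
    show "((\<lambda>t. f (?\<phi> (y + t *\<^sub>R d'))) has_real_derivative g (?\<phi> (y + t *\<^sub>R d'))) (at t)" for y t
      using deriv[of "?\<phi> y" t] by (simp add: aL(1) linear_add[OF aL(2)] linear_scale[OF aL(2)] d' add.assoc)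
  qed (use mM in auto)
  also have "\<dots> = (\<Sum>E\<in>edges_of K F. omega_FE K F E * (d \<bullet> edge_normal F E) * int_edge E f)"
  proof (intro sum.cong refl)
    fix E assume E: "E \<in> edges_of K F"
    have "d' \<bullet> \<nu> E = d \<bullet> edge_normal F E" using inner_L[of d' "\<nu> E"] d' \<nu>[OF E] by simp
    moreover have "poly.orient E = omega_FE K F E"
    proof -
      have "?\<phi> (y + s *\<^sub>R \<nu> E) = ?\<phi> y + s *\<^sub>R edge_normal F E"
          "?\<phi> (y - s *\<^sub>R \<nu> E) = ?\<phi> y - s *\<^sub>R edge_normal F E" for y s
        by (simp_all add: aL(1) linear_add[OF aL(2)] linear_diff[OF aL(2)] linear_scale[OF aL(2)] \<nu>[OF E])
      moreover have "(\<forall>x\<in>E. P x) \<longleftrightarrow> (\<forall>y\<in>?\<phi> -` E. P (?\<phi> y))" for P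
      proof -
        have "?\<phi> ` (?\<phi> -` E) = E"
          using E_hull[OF E] isometric_chart_range[OF chart] by (simp add: image_vimage_eq Int_absorb2)
        moreover have "(\<forall>y\<in>?\<phi> -` E. P (?\<phi> y)) \<longleftrightarrow> (\<forall>x\<in>?\<phi> ` (?\<phi> -` E). P x)" by fast
        ultimately show ?thesis by simp
      qed
      ultimately show ?thesis
        by (simp add: poly.orient_def omega_FE_def counterclockwise_def edge_normal_def)
    qed
    moreover have on_edge: "?\<phi> (m E + M E s) = edge_chart E s" for s using mM[OF E] by blast
    moreover have "(\<lambda>s. m E + M E s) -` (?\<phi> -` E) = edge_chart E -` E"
      unfolding vimage_def mem_Collect_eq on_edge ..
    ultimately show "poly.orient E * (d' \<bullet> \<nu> E) *
        (\<integral>s. indicator ((\<lambda>s. m E + M E s) -` (?\<phi> -` E)) s * f (?\<phi> (m E + M E s)) \<partial>(lborel :: real measure))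
      = omega_FE K F E * (d \<bullet> edge_normal F E) * int_edge E f"
      by (simp add: int_edge_eq set_lebesgue_integral_def)
  qed
  finally show ?thesis by (simp add: int_face_eq set_lebesgue_integral_def)
qed

end

subsection \<open>Stokes formulas\<close>

context polynomial_integral
begin

lemma J_cmult:
  assumes "real_polynomial_function p"
  shows "J (\<lambda>x. c * p x) = c * J p"
proof -
  have "J (\<lambda>x. 0 + 1 * 0) = J (\<lambda>x. 0) + 1 * J (\<lambda>x. 0)"
    by (intro lincomb real_polynomial_function_constI)
  then have "J (\<lambda>x. 0) = 0" by simp
  then show ?thesis using lincomb[OF real_polynomial_function_constI[of 0] assms, of c] by simp
qed

lemma J_sum:
  fixes p :: "'i \<Rightarrow> real^3 \<Rightarrow> real"
  assumes "\<And>i. i \<in> A \<Longrightarrow> real_polynomial_function (p i)"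
  shows "J (\<lambda>x. \<Sum>i\<in>A. p i x) = (\<Sum>i\<in>A. J (p i))"
  using assms
proof (induction A rule: infinite_finite_induct)
  case (insert i A)
  then show ?case
    using lincomb[of "p i" "\<lambda>x. \<Sum>i\<in>A. p i x" 1] real_polynomial_function_sum[of A "\<lambda>x i. p i x"] by simp
qed (use J_cmult[OF real_polynomial_function_constI, of 0 0] in auto)

end

lemma real_polynomial_function_line_derivative:
  fixes p :: "real^3 \<Rightarrow> real"
  assumes "real_polynomial_function p"
  shows "((\<lambda>t. p (x + t *\<^sub>R d)) has_real_derivative grad p (x + t *\<^sub>R d) \<bullet> d) (at t)"
proof -
  have "((\<lambda>t. x + t *\<^sub>R d) has_derivative (\<lambda>h. h *\<^sub>R d)) (at t)"
    by (auto intro!: derivative_eq_intros)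
  from has_derivative_compose[OF this real_polynomial_function_has_derivative[OF assms]]
  show ?thesis by (simp add: has_field_derivative_def mult_commute_abs)
qed

lemma real_polynomial_function_inner_grad:
  assumes "real_polynomial_function p"
  shows "real_polynomial_function (\<lambda>x. grad p x \<bullet> d)"
  using assms by (intro polynomial_function_inner_product polynomial_function_grad polynomial_function_const)

lemma polynomial_function_component:
  "polynomial_function v \<Longrightarrow> real_polynomial_function (\<lambda>x. v x $ i)" for v :: "real^3 \<Rightarrow> real^3"
  by (simp add: polynomial_function_vec)

lemma curl_components:
  "curl v x $ 1 = partial_deriv 2 (\<lambda>y. v y $ 3) x - partial_deriv 3 (\<lambda>y. v y $ 2) x"
  "curl v x $ 2 = partial_deriv 3 (\<lambda>y. v y $ 1) x - partial_deriv 1 (\<lambda>y. v y $ 3) x"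
  "curl v x $ 3 = partial_deriv 1 (\<lambda>y. v y $ 2) x - partial_deriv 2 (\<lambda>y. v y $ 1) x"
  by (simp_all add: curl_def)

lemma polynomial_function_curl:
  assumes "polynomial_function v"
  shows "polynomial_function (curl v)"
  unfolding polynomial_function_vec forall_3 curl_components
  by (intro conjI real_polynomial_function_diff polynomial_function_partial_deriv
      polynomial_function_component assms)

lemma polynomial_function_cross3:
  fixes v w :: "real^3 \<Rightarrow> real^3"
  assumes "polynomial_function v" "polynomial_function w"
  shows "polynomial_function (\<lambda>x. cross3 (v x) (w x))"
  unfolding polynomial_function_vec forall_3 cross_components
  by (intro conjI real_polynomial_function_diff real_polynomial_function_multI
      polynomial_function_component assms)

lemma grad_mult_diff:
  assumes "real_polynomial_function p" "real_polynomial_function q" "real_polynomial_function r" "real_polynomial_function s"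
  shows "grad (\<lambda>x. p x * q x - r x * s x) x
    = p x *\<^sub>R grad q x + q x *\<^sub>R grad p x - (r x *\<^sub>R grad s x + s x *\<^sub>R grad r x)"
  using grad_lincomb[of "\<lambda>x. p x * q x" "\<lambda>x. r x * s x" "-1" x] assms
  by (simp add: real_polynomial_function_multI grad_mult)

text \<open>The left-hand side is the divergence of v x w, written as a sum of directional
  derivatives to match the integration formula.\<close>

lemma divergence_cross3:
  assumes v: "polynomial_function v" and w: "polynomial_function w"
  shows "(\<Sum>i\<in>UNIV. grad (\<lambda>x. cross3 (v x) (w x) $ i) x \<bullet> axis i 1)
    = curl v x \<bullet> w x - v x \<bullet> curl w x"
  by (simp add: sum_3 cross3_def grad_mult_diff polynomial_function_component v w inner_axis
      curl_def partial_deriv_eq inner_vec_def axis_def algebra_simps)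

lemma curl_scaleR:
  assumes p: "real_polynomial_function p" and v: "polynomial_function v"
  shows "curl (\<lambda>x. p x *\<^sub>R v x) x = cross3 (grad p x) (v x) + p x *\<^sub>R curl v x"
  by (simp add: curl_def partial_deriv_eq grad_mult p polynomial_function_component v cross3_def
      vec_eq_iff forall_3 algebra_simps)

text \<open>Each direction e_i x n is tangent to the face, so the formula on faces applies to every
  summand.\<close>

lemma curl_tangential:
  "(\<Sum>i\<in>UNIV. grad (\<lambda>x. u x $ i) x \<bullet> cross3 (axis i 1) n) = curl u x \<bullet> n"
  by (simp add: sum_3 curl_def partial_deriv_eq cross3_def inner_vec_def axis_def algebra_simps)

context polyhedron
begin

lemma polynomial_integral_body: "polynomial_integral (body K) (int_cell (body K))"
  by (intro polynomial_integral_int_cell open_body bounded_body body_nonempty)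

lemma polynomial_integral_face: "F \<in> faces K \<Longrightarrow> polynomial_integral F (int_face F)"
  using polytopal_domain_basic[OF face] by (intro polynomial_integral_int_face) auto

lemma polynomial_integral_edge:
  assumes "E \<in> edges K"
  shows "polynomial_integral E (int_edge E)"
  by (intro polynomial_integral_int_edge edge_aff_dim edge_openin edge_bounded assms)

text \<open>The divergence of v x w is integrated one coordinate direction at a time; on a face the
  flux (v x w) . n equals v . (w x n).\<close>

theorem stokes_cell:
  assumes v: "polynomial_function v" and w: "polynomial_function w"
  shows "int_cell (body K) (\<lambda>x. curl v x \<bullet> w x) = int_cell (body K) (\<lambda>x. v x \<bullet> curl w x)
    + (\<Sum>F\<in>faces K. omega_TF K F * int_face F (\<lambda>x. v x \<bullet> cross3 (w x) (nrm K F)))"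
proof -
  interpret T: polynomial_integral "body K" "int_cell (body K)" by (rule polynomial_integral_body)
  let ?f = "\<lambda>i x. cross3 (v x) (w x) $ i"
  have f: "real_polynomial_function (?f i)" for i
    by (intro polynomial_function_component polynomial_function_cross3 v w)
  have cv: "real_polynomial_function (\<lambda>x. curl v x \<bullet> w x)" and cw: "real_polynomial_function (\<lambda>x. v x \<bullet> curl w x)"
    by (intro polynomial_function_inner_product polynomial_function_curl v w)+
  have "int_cell (body K) (\<lambda>x. curl v x \<bullet> w x) - int_cell (body K) (\<lambda>x. v x \<bullet> curl w x)
      = int_cell (body K) (\<lambda>x. \<Sum>i\<in>UNIV. grad (?f i) x \<bullet> axis i 1)"
    using T.lincomb[OF cv cw, of "-1"] by (simp add: divergence_cross3[OF v w])
  also have "\<dots> = (\<Sum>i\<in>UNIV. int_cell (body K) (\<lambda>x. grad (?f i) x \<bullet> axis i 1))"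
    by (intro T.J_sum real_polynomial_function_inner_grad f)
  also have "\<dots> = (\<Sum>i\<in>UNIV. \<Sum>F\<in>faces K. omega_TF K F * (axis i 1 \<bullet> nrm K F) * int_face F (?f i))"
    by (intro sum.cong refl integral_directional_derivative_cell real_polynomial_function_line_derivative
        real_polynomial_function_continuous real_polynomial_function_inner_grad f)
  also have "\<dots> = (\<Sum>F\<in>faces K. omega_TF K F * int_face F (\<lambda>x. v x \<bullet> cross3 (w x) (nrm K F)))"
  proof (subst sum.swap, intro sum.cong refl)
    fix F assume "F \<in> faces K"
    then interpret F: polynomial_integral F "int_face F" by (rule polynomial_integral_face)
    have "v x \<bullet> cross3 (w x) (nrm K F) = (\<Sum>i\<in>UNIV. nrm K F $ i * ?f i x)" for x
      by (simp add: inner_vec_def cross3_def sum_3 algebra_simps)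
    then have "int_face F (\<lambda>x. v x \<bullet> cross3 (w x) (nrm K F)) = (\<Sum>i\<in>UNIV. nrm K F $ i * int_face F (?f i))"
      using f by (simp add: F.J_sum F.J_cmult real_polynomial_function_multI real_polynomial_function_constI)
    then show "(\<Sum>i\<in>UNIV. omega_TF K F * (axis i 1 \<bullet> nrm K F) * int_face F (?f i))
        = omega_TF K F * int_face F (\<lambda>x. v x \<bullet> cross3 (w x) (nrm K F))"
      by (simp add: sum_distrib_left mult.assoc inner_axis')
  qed
  finally show ?thesis by simp
qed

text \<open>Component \<open>i\<close> of \<open>u\<close> is integrated along e_i x n. The flux
  factor (e_i x n) . (n x t) is - t_i because t . n = 0, so the components reassemble to - u .
  t.\<close>

lemma stokes_face:
  assumes F: "F \<in> faces K" and u: "polynomial_function u"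
  shows "int_face F (\<lambda>x. curl u x \<bullet> nrm K F)
    = - (\<Sum>E\<in>edges_of K F. omega_FE K F E * int_edge E (\<lambda>x. u x \<bullet> tng K E))"
proof -
  interpret F: polynomial_integral F "int_face F" by (rule polynomial_integral_face[OF F])
  let ?n = "nrm K F"
  have ui: "real_polynomial_function (\<lambda>x. u x $ i)" for i by (rule polynomial_function_component[OF u])
  have "int_face F (\<lambda>x. curl u x \<bullet> ?n)
      = (\<Sum>i\<in>UNIV. int_face F (\<lambda>x. grad (\<lambda>x. u x $ i) x \<bullet> cross3 (axis i 1) ?n))"
    unfolding curl_tangential[symmetric] by (intro F.J_sum real_polynomial_function_inner_grad ui)
  also have "\<dots> = (\<Sum>i\<in>UNIV. \<Sum>E\<in>edges_of K F. omega_FE K F E *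
      (cross3 (axis i 1) ?n \<bullet> edge_normal F E) * int_edge E (\<lambda>x. u x $ i))"
    by (intro sum.cong refl integral_directional_derivative_face F real_polynomial_function_line_derivative
        real_polynomial_function_continuous real_polynomial_function_inner_grad ui)
      (simp add: dot_cross_self)
  also have "\<dots> = (\<Sum>E\<in>edges_of K F. - (omega_FE K F E * int_edge E (\<lambda>x. u x \<bullet> tng K E)))"
  proof (subst sum.swap, intro sum.cong refl)
    fix E assume E: "E \<in> edges_of K F"
    interpret E: polynomial_integral E "int_edge E" by (rule polynomial_integral_edge[OF edges_of(1)[OF E]])
    have "cross3 (axis i 1) ?n \<bullet> edge_normal F E = - (tng K E $ i)" for i
    proof -
      have "cross3 (axis i 1) ?n \<bullet> cross3 ?n (tng K E)
          = (axis i 1 \<bullet> ?n) * (?n \<bullet> tng K E) - (axis i 1 \<bullet> tng K E) * (?n \<bullet> ?n)"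
        by (rule dot_cross)
      then show ?thesis
        using edge_frame(2)[OF F E] norm_nrm[OF F]
        by (simp add: edge_normal_def inner_commute[of ?n "tng K E"] norm_eq_1 inner_axis')
    qed
    moreover have "int_edge E (\<lambda>x. u x \<bullet> tng K E) = (\<Sum>i\<in>UNIV. tng K E $ i * int_edge E (\<lambda>x. u x $ i))"
    proof -
      have "u x \<bullet> tng K E = (\<Sum>i\<in>UNIV. tng K E $ i * u x $ i)" for x
        by (simp add: inner_vec_def mult.commute)
      then show ?thesis
        using ui by (simp add: E.J_sum E.J_cmult real_polynomial_function_multI real_polynomial_function_constI)
    qed
    ultimately show "(\<Sum>i\<in>UNIV. omega_FE K F E * (cross3 (axis i 1) ?n \<bullet> edge_normal F E) * int_edge E (\<lambda>x. u x $ i))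
        = - (omega_FE K F E * int_edge E (\<lambda>x. u x \<bullet> tng K E))"
      by (simp add: sum_distrib_left sum_negf mult.assoc)
  qed
  finally show ?thesis by (simp add: sum_negf)
qed

text \<open>Integration by parts: \<open>stokes_face\<close> for p v, where the product rule for the
  curl gives v . (grad p x n) = p (curl v . n) - curl (p v) . n.\<close>

lemma stokes_face_rot:
  assumes F: "F \<in> faces K" and p: "real_polynomial_function p" and v: "polynomial_function v"
  shows "int_face F (\<lambda>x. v x \<bullet> cross3 (grad p x) (nrm K F))
    = int_face F (\<lambda>x. (curl v x \<bullet> nrm K F) * p x)
      + (\<Sum>E\<in>edges_of K F. omega_FE K F E * int_edge E (\<lambda>x. (v x \<bullet> tng K E) * p x))"
proof -
  interpret F: polynomial_integral F "int_face F" by (rule polynomial_integral_face[OF F])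
  have pv: "polynomial_function (\<lambda>x. p x *\<^sub>R v x)"
    using p v by (simp add: real_polynomial_function_eq polynomial_function_mult)
  have 1: "real_polynomial_function (\<lambda>x. (curl v x \<bullet> nrm K F) * p x)"
    by (intro real_polynomial_function_multI p polynomial_function_inner_product polynomial_function_curl v) simp
  have 2: "real_polynomial_function (\<lambda>x. curl (\<lambda>x. p x *\<^sub>R v x) x \<bullet> nrm K F)"
    by (intro polynomial_function_inner_product polynomial_function_curl pv) simp
  have "v x \<bullet> cross3 (grad p x) (nrm K F)
      = (curl v x \<bullet> nrm K F) * p x + (-1) * (curl (\<lambda>x. p x *\<^sub>R v x) x \<bullet> nrm K F)" for x
    unfolding curl_scaleR[OF p v] by (simp add: inner_vec_def sum_3 cross3_def algebra_simps)
  then have "int_face F (\<lambda>x. v x \<bullet> cross3 (grad p x) (nrm K F))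
      = int_face F (\<lambda>x. (curl v x \<bullet> nrm K F) * p x) + (-1) * int_face F (\<lambda>x. curl (\<lambda>x. p x *\<^sub>R v x) x \<bullet> nrm K F)"
    using F.lincomb[OF 1 2, of "-1"] by simp
  then show ?thesis
    by (simp add: stokes_face[OF F pv] mult.commute[of "p _"])
qed

end

subsection \<open>Interpolation and consistency\<close>

lemma orth_complementD:
  assumes "w \<in> orth_complement_in J V R"
  shows "w \<in> V" "z \<in> R \<Longrightarrow> J (\<lambda>x. w x \<bullet> z x) = 0"
  using assms by (auto simp: orth_complement_in_def)

context polynomial_integral
begin

lemma fun_subspace_orth_complement:
  fixes V R :: "(real^3 \<Rightarrow> 'b::euclidean_space) set"
  assumes "fun_subspace V" "V \<subseteq> hull_polys X" "R \<subseteq> hull_polys X"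
  shows "fun_subspace (orth_complement_in J V R)"
  unfolding fun_subspace_def
proof (intro conjI ballI allI)
  have "ip (\<lambda>x. 0) z = 0" for z :: "real^3 \<Rightarrow> 'b"
    using J_cmult[OF real_polynomial_function_constI, of 0 0] by simp
  then show "(\<lambda>x. 0) \<in> orth_complement_in J V R"
    using fun_subspace_zero[OF assms(1)] by (simp add: orth_complement_in_def)
next
  fix f g :: "real^3 \<Rightarrow> 'b" and c
  assume f: "f \<in> orth_complement_in J V R" and g: "g \<in> orth_complement_in J V R"
  have "ip (\<lambda>x. f x + c *\<^sub>R g x) z = 0" if "z \<in> R" for z
  proof -
    have "ip (\<lambda>x. f x + c *\<^sub>R g x) z = ip f z + c * ip g z"
      using orth_complementD(1)[OF f] orth_complementD(1)[OF g] assms(2,3) that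
      by (intro ip_lincomb poly_on_hull_polys) auto
    then show ?thesis using orth_complementD(2)[OF f that] orth_complementD(2)[OF g that] by simp
  qed
  moreover have "(\<lambda>x. f x + c *\<^sub>R g x) \<in> V"
    using orth_complementD(1)[OF f] orth_complementD(1)[OF g] by (rule fun_subspace_lincomb[OF assms(1)])
  ultimately show "(\<lambda>x. f x + c *\<^sub>R g x) \<in> orth_complement_in J V R"
    by (simp add: orth_complement_in_def)
qed

text \<open>
  The difference of two elements of \<open>V\<close> with the same moments against \<open>R\<close> lies in the orthogonal
  complement of \<open>R\<close>, so no decomposition of \<open>V\<close> is needed.
\<close>

lemma eq_by_moments:
  fixes V R :: "(real^3 \<Rightarrow> 'b::euclidean_space) set"
  assumes V: "fun_subspace V" "V \<subseteq> hull_polys X" and R: "R \<subseteq> hull_polys X"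
    and p: "p \<in> V" and q: "q \<in> V"
    and on_R: "\<And>z. z \<in> R \<Longrightarrow> ip p z = ip q z"
    and on_perp: "\<And>w. w \<in> orth_complement_in J V R \<Longrightarrow> ip p w = ip q w"
  shows "p = q"
proof -
  let ?d = "\<lambda>x. p x - q x"
  have d: "?d \<in> V" using V(1) p q by (rule fun_subspace_diff)
  have diff: "ip ?d w = ip p w - ip q w" if "w \<in> hull_polys X" for w
    using p q V(2) that by (intro ip_diff poly_on_hull_polys) auto
  have "?d \<in> orth_complement_in J V R"
    using d on_R diff R by (auto simp: orth_complement_in_def)
  then have "ip ?d ?d = 0" using on_perp diff d V(2) by auto
  then have "?d = (\<lambda>x. 0)" using d V(2) by (intro ip_definite) auto
  then show ?thesis by (simp add: fun_eq_iff)
qed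

text \<open>The projection onto the complement is obtained by subtracting from \<open>f0\<close> its
  projection onto \<open>R\<close>. As \<open>R'\<close> lies in \<open>R\<close>, it meets the
  complement only in 0, so \<open>component\<close> recovers the two projections from their sum.
  \<open>f0\<close> represents in \<open>V\<close> a function \<open>f\<close> that matters only on
  \<open>X\<close>.\<close>

lemma L2_proj_decomposition:
  fixes V R R' :: "(real^3 \<Rightarrow> 'b::euclidean_space) set"
  assumes V: "fun_subspace V" "V \<subseteq> hull_polys X"
    and R: "finitely_spanned (hull_polys X) R" "R \<subseteq> V"
    and R': "finitely_spanned (hull_polys X) R'" "R' \<subseteq> R"
    and f: "f0 \<in> V" "\<And>x. x \<in> X \<Longrightarrow> f x = f0 x"
  defines "P \<equiv> orth_complement_in J V R"
  defines "a \<equiv> L2_proj J R' f" and "b \<equiv> L2_proj J P f"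
  shows "a \<in> R'" "b \<in> P" "\<And>h. h \<in> R' \<Longrightarrow> ip a h = ip f h" "\<And>h. h \<in> P \<Longrightarrow> ip b h = ip f h"
    "component R' P (\<lambda>x. a x + b x) = a" "component P R' (\<lambda>x. a x + b x) = b"
proof -
  have R_hull: "R \<subseteq> hull_polys X" using R(2) V(2) by blast
  have R'_hull: "R' \<subseteq> hull_polys X" using R'(2) R_hull by blast
  have P: "fun_subspace P" unfolding P_def by (rule fun_subspace_orth_complement[OF V R_hull])
  have P_V: "P \<subseteq> V" by (auto simp: P_def orth_complement_in_def)
  have P_hull: "P \<subseteq> hull_polys X" using P_V V(2) by blast
  have R'_sub: "fun_subspace R'" by (rule finitely_spanned_subspace[OF R'(1)])
  have f0_poly: "poly_on X f0" using f(1) V(2) by (auto intro: poly_on_hull_polys)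
  have ip_f: "ip f h = ip f0 h" for h using f(2) by (intro cong) simp
  obtain a' where a': "a' \<in> R'" "\<forall>h\<in>R'. ip a' h = ip f0 h"
    using projection_exists[OF R'(1) f0_poly] by blast
  have "a = a'" unfolding a_def using a' ip_f by (intro L2_proj_eqI R'_sub R'_hull) auto
  then show a: "a \<in> R'" and "\<And>h. h \<in> R' \<Longrightarrow> ip a h = ip f h" using a' ip_f by auto
  obtain r where r: "r \<in> R" "\<forall>h\<in>R. ip r h = ip f0 h"
    using projection_exists[OF R(1) f0_poly] by blast
  define b' where "b' = (\<lambda>x. f0 x - r x)"
  have r_poly: "poly_on X r" using r(1) R_hull by (auto intro: poly_on_hull_polys)
  have b'_V: "b' \<in> V" unfolding b'_def using r(1) R(2) by (intro fun_subspace_diff V f(1)) auto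
  have b'_ip: "ip b' h = ip f0 h - ip r h" if "h \<in> hull_polys X" for h
    unfolding b'_def using that by (intro ip_diff f0_poly r_poly poly_on_hull_polys)
  have b'_P: "b' \<in> P"
    using b'_V b'_ip r(2) R_hull by (auto simp: P_def orth_complement_in_def)
  have b'_proj: "ip b' h = ip f h" if h: "h \<in> P" for h
  proof -
    have "ip h r = 0" using orth_complementD(2)[OF h[unfolded P_def] r(1)] .
    then show ?thesis using b'_ip[of h] h P_hull ip_f[of h] by (auto simp: ip_commute[of r h])
  qed
  have "b = b'" unfolding b_def using b'_P b'_proj by (intro L2_proj_eqI P P_hull) auto
  then show b: "b \<in> P" and "\<And>h. h \<in> P \<Longrightarrow> ip b h = ip f h" using b'_P b'_proj by auto
  \<comment> \<open>The difference of two first summands is also a difference of second summands;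
    lying in \<open>R'\<close> and in \<open>P\<close>, it is orthogonal to itself.\<close>
  have unique: "c = a \<and> e = b" if c: "c \<in> R'" and e: "e \<in> P" and eq: "(\<lambda>x. a x + b x) = (\<lambda>x. c x + e x)" for c e
  proof -
    let ?d = "\<lambda>x. a x - c x"
    have pointwise: "a x + b x = c x + e x" for x using fun_cong[OF eq, of x] .
    have "?d = (\<lambda>x. e x - b x)"
      using pointwise by (auto simp: fun_eq_iff algebra_simps)
    moreover have "(\<lambda>x. e x - b x) \<in> P" using P e b by (rule fun_subspace_diff)
    ultimately have "?d \<in> P" by simp
    moreover have "?d \<in> R'" using R'_sub a c by (rule fun_subspace_diff)
    ultimately have "ip ?d ?d = 0"
      using R'(2) by (intro orth_complementD(2)[of ?d J V R]) (auto simp: P_def)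
    then have "?d = (\<lambda>x. 0)" using \<open>?d \<in> R'\<close> R'_hull by (intro ip_definite) auto
    then have "a x = c x" for x by (simp add: fun_eq_iff)
    then show ?thesis using pointwise by (auto simp: fun_eq_iff)
  qed
  show "component R' P (\<lambda>x. a x + b x) = a"
    unfolding component_def using a b unique by (intro the_equality) blast+
  have swap: "(\<lambda>x. a x + b x) = (\<lambda>x. b x + a x)" by (simp add: add.commute)
  show "component P R' (\<lambda>x. a x + b x) = b"
    unfolding component_def
  proof (rule the_equality)
    show "b \<in> P \<and> (\<exists>c\<in>R'. (\<lambda>x. a x + b x) = (\<lambda>x. b x + c x))" using a b swap by blast
    fix e assume "e \<in> P \<and> (\<exists>c\<in>R'. (\<lambda>x. a x + b x) = (\<lambda>x. e x + c x))"
    then obtain c where "e \<in> P" "c \<in> R'" "(\<lambda>x. a x + b x) = (\<lambda>x. c x + e x)"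
      by (auto simp: add.commute)
    then show "e = b" using unique by blast
  qed
qed

end

section \<open>The discrete polynomial spaces\<close>

lemma polys_subset_hull_polys: "polys l X \<subseteq> hull_polys X"
  by (rule finitely_spanned_subset[OF polys_finitely_spanned fun_subspace_hull_polys])

lemma vec_polys_subset_hull_polys: "vec_polys l X \<subseteq> hull_polys X"
  by (rule finitely_spanned_subset[OF vec_polys_finitely_spanned fun_subspace_hull_polys])

lemma fun_subspace_polys: "fun_subspace (polys l X)"
  by (rule finitely_spanned_subspace[OF polys_finitely_spanned])

lemma fun_subspace_vec_polys: "fun_subspace (vec_polys l X)"
  by (rule finitely_spanned_subspace[OF vec_polys_finitely_spanned])

lemma polysI: "poly_deg_le l p \<Longrightarrow> restr_hull X p \<in> polys l X"
  by (auto simp: polys_def)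

lemma polysE:
  assumes "r \<in> polys l X"
  obtains p where "r = restr_hull X p" "poly_deg_le l p" "real_polynomial_function p"
  using assms poly_deg_le_polynomial by (auto simp: polys_def)

lemma vec_polysI: "(\<And>i. poly_deg_le l (\<lambda>x. p x $ i)) \<Longrightarrow> restr_hull X p \<in> vec_polys l X"
  by (auto simp: vec_polys_def)

lemma poly_deg_le_inner_const:
  "(\<And>i. poly_deg_le l (\<lambda>x. w x $ i)) \<Longrightarrow> poly_deg_le l (\<lambda>x. w x \<bullet> d)" for w :: "real^3 \<Rightarrow> real^3"
  unfolding inner_vec_def inner_real_def
  using poly_deg_le_cmult by (intro poly_deg_le_sum) (simp add: mult.commute)

lemma poly_deg_le_cross3_const:
  fixes w :: "real^3 \<Rightarrow> real^3"
  assumes "\<And>i. poly_deg_le l (\<lambda>x. w x $ i)"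
  shows "poly_deg_le l (\<lambda>x. cross3 (w x) n $ i)"
proof -
  have "\<forall>i. poly_deg_le l (\<lambda>x. cross3 (w x) n $ i)"
    unfolding forall_3 cross_components mult.commute[of "w _ $ _"]
    by (intro conjI poly_deg_le_diff poly_deg_le_cmult assms)
  then show ?thesis ..
qed

lemma poly_deg_le_grad: "poly_deg_le (l + 1) p \<Longrightarrow> poly_deg_le l (\<lambda>x. grad p x $ i)"
  using poly_deg_le_partial_deriv[of "l + 1" p i] by (simp add: partial_deriv_eq[abs_def])

lemma poly_deg_le_curl:
  assumes "\<And>i. poly_deg_le (l + 1) (\<lambda>x. w x $ i)"
  shows "poly_deg_le l (\<lambda>x. curl w x $ i)"
proof -
  have "poly_deg_le l (\<lambda>x. partial_deriv j (\<lambda>y. w y $ i) x)" for i j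
    using poly_deg_le_partial_deriv[OF assms, of j i] by simp
  then have "\<forall>i. poly_deg_le l (\<lambda>x. curl w x $ i)"
    unfolding forall_3 curl_components by (intro conjI poly_deg_le_diff) 
  then show ?thesis ..
qed

lemma curl_lincomb:
  assumes "polynomial_function v" "polynomial_function w"
  shows "curl (\<lambda>x. v x + c *\<^sub>R w x) x = curl v x + c *\<^sub>R curl w x"
  using assms
  by (simp add: vec_eq_iff forall_3 curl_components partial_deriv_eq grad_lincomb
      polynomial_function_component algebra_simps)

lemma partial_deriv_add:
  assumes "real_polynomial_function p" "real_polynomial_function q"
  shows "partial_deriv i (\<lambda>x. p x + q x) = (\<lambda>x. partial_deriv i p x + partial_deriv i q x)"
  by (simp add: partial_deriv_eq grad_add assms fun_eq_iff)

lemma partial_deriv_mult: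
  assumes "real_polynomial_function p" "real_polynomial_function q"
  shows "partial_deriv i (\<lambda>x. p x * q x) = (\<lambda>x. p x * partial_deriv i q x + q x * partial_deriv i p x)"
  by (simp add: partial_deriv_eq grad_mult assms fun_eq_iff)

text \<open>Induction on the construction of polynomials; the product rule is symmetric in the two
  derivatives. It serves to show that gradients have no curl.\<close>

lemma partial_deriv_commute:
  "real_polynomial_function p \<Longrightarrow> partial_deriv i (partial_deriv j p) x = partial_deriv j (partial_deriv i p) x"
proof (induction p arbitrary: x rule: real_polynomial_function.induct)
  case (linear p)
  have "partial_deriv i p = (\<lambda>x. p (axis i 1))" for i :: 3
    by (simp add: partial_deriv_eq[abs_def] grad_linear[OF linear] fun_eq_iff)
  then show ?case by (simp add: partial_deriv_eq grad_const)
next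
  case (const c)
  have "partial_deriv i (\<lambda>x. c) = (\<lambda>x. 0)" for i :: 3 and c
    by (simp add: partial_deriv_eq[abs_def] grad_const fun_eq_iff)
  then show ?case by simp
next
  case (add p q)
  then show ?case by (simp add: partial_deriv_add polynomial_function_partial_deriv)
next
  case (mult p q)
  then show ?case
    by (simp add: partial_deriv_add partial_deriv_mult polynomial_function_partial_deriv
        real_polynomial_function_multI)
qed

lemma curl_grad:
  assumes "real_polynomial_function p"
  shows "curl (grad p) x = 0"
proof -
  have "(\<lambda>y. grad p y $ i) = partial_deriv i p" for i by (simp add: grad_def)
  then show ?thesis
    using partial_deriv_commute[OF assms] by (simp add: vec_eq_iff forall_3 curl_components)
qed

context polyhedron
begin

text \<open>The tangential part of the ambient gradient solves the description in
  \<open>grad_face\<close>; a second solution is excluded by differentiating along a line in the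
  plane.\<close>

lemma grad_face_restr_hull:
  assumes F: "F \<in> faces K" and p: "real_polynomial_function p"
  shows "grad_face F (nrm K F) (restr_hull F p)
    = restr_hull F (\<lambda>x. grad p x - (grad p x \<bullet> nrm K F) *\<^sub>R nrm K F)"
proof -
  let ?n = "nrm K F" and ?H = "affine hull F" and ?r = "restr_hull F p"
  have n: "?n \<bullet> ?n = 1" using norm_nrm[OF F] by (simp add: norm_eq_1)
  have "(THE g. g \<bullet> ?n = 0 \<and> (?r has_derivative (\<lambda>h. g \<bullet> h)) (at x within ?H))
      = grad p x - (grad p x \<bullet> ?n) *\<^sub>R ?n" (is "_ = ?g") if x: "x \<in> ?H" for x
  proof (rule the_equality)
    have H: "?H = {y. (y - x) \<bullet> ?n = 0}" by (rule face_hull[OF F x])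
    \<comment> \<open>Subtracting a multiple of the distance to the plane leaves the values on the
      plane unchanged and removes the normal derivative.\<close>
    let ?q = "\<lambda>y. p y - (grad p x \<bullet> ?n) * ((y - x) \<bullet> ?n)"
    have "(?q has_derivative (\<lambda>h. grad p x \<bullet> h - (grad p x \<bullet> ?n) * (h \<bullet> ?n))) (at x within ?H)"
      by (rule has_derivative_at_withinI)
        (auto intro!: derivative_eq_intros real_polynomial_function_has_derivative[OF p] simp: algebra_simps)
    then have "(?r has_derivative (\<lambda>h. grad p x \<bullet> h - (grad p x \<bullet> ?n) * (h \<bullet> ?n))) (at x within ?H)"
      by (rule has_derivative_transform[OF x, rotated]) (auto simp: H restr_hull_def)
    moreover have "(\<lambda>h. grad p x \<bullet> h - (grad p x \<bullet> ?n) * (h \<bullet> ?n)) = (\<lambda>h. ?g \<bullet> h)"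
      by (auto simp: inner_diff_left inner_commute[of ?n])
    ultimately have g: "(?r has_derivative (\<lambda>h. ?g \<bullet> h)) (at x within ?H)" by simp
    have gn: "?g \<bullet> ?n = 0" using n by (simp add: inner_diff_left)
    then show "?g \<bullet> ?n = 0 \<and> (?r has_derivative (\<lambda>h. ?g \<bullet> h)) (at x within ?H)" using g by simp
    fix g assume g': "g \<bullet> ?n = 0 \<and> (?r has_derivative (\<lambda>h. g \<bullet> h)) (at x within ?H)"
    \<comment> \<open>The difference of two candidates is tangential, so the line through x in
      direction \<open>w\<close> stays in the plane. Equality of both derivatives along it gives w .
      w = 0.\<close>
    define w where "w = g - ?g"
    have wn: "w \<bullet> ?n = 0" using g' gn by (simp add: w_def inner_diff_left)
    have line: "((\<lambda>t. ?r (x + t *\<^sub>R w)) has_derivative (\<lambda>t. u \<bullet> (t *\<^sub>R w))) (at 0)"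
      if "(?r has_derivative (\<lambda>h. u \<bullet> h)) (at x within ?H)" for u
    proof (rule has_derivative_in_compose[where f="\<lambda>t. x + t *\<^sub>R w" and g="?r" and g'="\<lambda>h. u \<bullet> h"])
      show "((\<lambda>t. x + t *\<^sub>R w) has_derivative (\<lambda>t. t *\<^sub>R w)) (at 0)"
        by (auto intro!: derivative_eq_intros)
      have "range (\<lambda>t. x + t *\<^sub>R w) \<subseteq> ?H" using wn by (auto simp: H)
      then show "(?r has_derivative (\<lambda>h. u \<bullet> h)) (at (x + 0 *\<^sub>R w) within range (\<lambda>t. x + t *\<^sub>R w))"
        using that by (auto intro: has_derivative_subset)
    qed
    have "(\<lambda>t. g \<bullet> (t *\<^sub>R w)) = (\<lambda>t. ?g \<bullet> (t *\<^sub>R w))"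
      using line[of g] line[of ?g] g g' by (intro has_derivative_unique) auto
    from fun_cong[OF this, of 1] have "w \<bullet> w = 0" by (simp add: w_def inner_diff_left)
    then show "g = ?g" by (simp add: w_def)
  qed
  then show ?thesis by (auto simp: grad_face_def restr_hull_def fun_eq_iff)
qed

text \<open>The cross product with the normal annihilates the normal component, so the ambient
  gradient may stand for the tangential one.\<close>

lemma rot_face_restr_hull:
  assumes F: "F \<in> faces K" and p: "real_polynomial_function p"
  shows "rot_face F (nrm K F) (restr_hull F p) = restr_hull F (\<lambda>x. cross3 (grad p x) (nrm K F))"
  unfolding rot_face_def grad_face_restr_hull[OF F p]
  by (simp add: restr_hull_def fun_eq_iff Cross3.left_diff_distrib cross_mult_left)

lemma R_face_finitely_spanned:
  assumes F: "F \<in> faces K"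
  shows "finitely_spanned (hull_polys F) (R_face l F (nrm K F))"
  unfolding R_face_def
proof (rule finitely_spanned_image[OF polys_finitely_spanned[of F] fun_subspace_hull_polys])
  let ?rot = "rot_face F (nrm K F)"
  have rp: "polynomial_function p \<Longrightarrow> ?rot (restr_hull F p) = restr_hull F (\<lambda>x. cross3 (grad p x) (nrm K F))"
    for p :: "real^3 \<Rightarrow> real"
    using rot_face_restr_hull[OF F] by (simp add: real_polynomial_function_eq)
  show "?rot f \<in> hull_polys F" if f: "f \<in> hull_polys F" for f
  proof -
    obtain p where p: "polynomial_function p" "f = restr_hull F p" by (rule hull_polysE[OF f])
    then show ?thesis
      unfolding p(2) rp[OF p(1)]
      by (intro hull_polysI polynomial_function_cross3 polynomial_function_grad polynomial_function_const)
        (simp add: real_polynomial_function_eq)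
  qed
  have "(\<lambda>x. 0) = restr_hull F (\<lambda>x. 0 :: real)" by (auto simp: restr_hull_def)
  then show "?rot (\<lambda>x. 0) = (\<lambda>x. 0)"
    using rp[of "\<lambda>x. 0"] by (simp add: grad_const) (auto simp: restr_hull_def)
  fix f g :: "real^3 \<Rightarrow> real" and c assume f: "f \<in> hull_polys F" and g: "g \<in> hull_polys F"
  obtain p where p: "polynomial_function p" "f = restr_hull F p" by (rule hull_polysE[OF f])
  obtain q where q: "polynomial_function q" "g = restr_hull F q" by (rule hull_polysE[OF g])
  have "(\<lambda>x. c *\<^sub>R f x + g x) = restr_hull F (\<lambda>x. q x + c * p x)"
    by (auto simp: p q restr_hull_def)
  moreover have "polynomial_function (\<lambda>x. q x + c * p x)"
    using polynomial_function_lincomb[OF q(1) p(1), of c] by simp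
  ultimately have "?rot (\<lambda>x. c *\<^sub>R f x + g x) = restr_hull F (\<lambda>x. cross3 (grad q x + c *\<^sub>R grad p x) (nrm K F))"
    using p(1) q(1) by (simp add: rp grad_lincomb real_polynomial_function_eq)
  also have "\<dots> = (\<lambda>x. c *\<^sub>R ?rot f x + ?rot g x)"
    unfolding p(2) q(2) rp[OF p(1)] rp[OF q(1)]
    by (simp add: restr_hull_def fun_eq_iff cross_add_left cross_mult_left)
  finally show "?rot (\<lambda>x. c *\<^sub>R f x + g x) = (\<lambda>x. c *\<^sub>R ?rot f x + ?rot g x)" .
qed

lemma R_face_subset_tan_polys:
  assumes F: "F \<in> faces K"
  shows "R_face l F (nrm K F) \<subseteq> tan_polys l F (nrm K F)"
proof
  fix f assume "f \<in> R_face l F (nrm K F)"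
  then obtain p where p: "poly_deg_le (l + 1) p" "real_polynomial_function p"
      "f = rot_face F (nrm K F) (restr_hull F p)"
    unfolding R_face_def by (auto elim!: polysE)
  then have f: "f = restr_hull F (\<lambda>x. cross3 (grad p x) (nrm K F))"
    by (simp add: rot_face_restr_hull[OF F])
  have "f \<in> vec_polys l F"
    unfolding f using p(1) by (intro vec_polysI poly_deg_le_cross3_const poly_deg_le_grad)
  then show "f \<in> tan_polys l F (nrm K F)"
    by (simp add: tan_polys_def) (simp add: f restr_hull_def dot_cross_self)
qed

lemma tan_polys_subset_hull_polys: "tan_polys l F n \<subseteq> hull_polys F"
  using vec_polys_subset_hull_polys by (auto simp: tan_polys_def)

lemma fun_subspace_tan_polys: "fun_subspace (tan_polys l F n)"
  using fun_subspace_vec_polys[of l F]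
  by (auto simp: fun_subspace_def tan_polys_def inner_add_left)

lemma polys_mono: "l \<le> l' \<Longrightarrow> polys l X \<subseteq> polys l' X"
  using poly_deg_le_mono by (auto simp: polys_def)

lemma vec_polys_mono: "l \<le> l' \<Longrightarrow> vec_polys l X \<subseteq> vec_polys l' X"
  using poly_deg_le_mono by (fastforce simp: vec_polys_def)

lemma restr_hull_body: "restr_hull (body K) p = p"
  by (simp add: restr_hull_def affine_hull_body)

lemma vec_polys_body_iff: "w \<in> vec_polys l (body K) \<longleftrightarrow> (\<forall>i. poly_deg_le l (\<lambda>x. w x $ i))"
  by (auto simp: vec_polys_def restr_hull_body)

lemma hull_polys_body_iff: "w \<in> hull_polys (body K) \<longleftrightarrow> polynomial_function w"
  by (auto simp: hull_polys_def restr_hull_body)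

lemma vec_polys_body_polynomial: "w \<in> vec_polys l (body K) \<Longrightarrow> polynomial_function w"
  using vec_polys_subset_hull_polys[of l "body K"] hull_polys_body_iff by blast

lemma R_cell_finitely_spanned: "finitely_spanned (hull_polys (body K)) (R_cell l (body K))"
  unfolding R_cell_def
proof (rule finitely_spanned_image[OF vec_polys_finitely_spanned fun_subspace_hull_polys])
  show "curl (\<lambda>x. 0) = (\<lambda>x. 0)"
    by (simp add: fun_eq_iff vec_eq_iff forall_3 curl_components partial_deriv_eq grad_const)
  fix f g :: "real^3 \<Rightarrow> real^3" and c
  assume "f \<in> hull_polys (body K)" "g \<in> hull_polys (body K)"
  then show "curl (\<lambda>x. c *\<^sub>R f x + g x) = (\<lambda>x. c *\<^sub>R curl f x + curl g x)"
    using curl_lincomb[of g f c] by (simp add: hull_polys_body_iff add.commute fun_eq_iff)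
qed (simp add: hull_polys_body_iff polynomial_function_curl)

lemma R_cell_subset_vec_polys: "R_cell l (body K) \<subseteq> vec_polys l (body K)"
  by (auto simp: R_cell_def vec_polys_body_iff intro!: poly_deg_le_curl)

lemma G_cell_finitely_spanned: "finitely_spanned (hull_polys (body K)) (G_cell l (body K))"
  unfolding G_cell_def
proof (rule finitely_spanned_image[OF polys_finitely_spanned fun_subspace_hull_polys])
  show "grad (\<lambda>x. 0) = (\<lambda>x. 0)" by (simp add: fun_eq_iff grad_const)
  fix f g :: "real^3 \<Rightarrow> real" and c
  assume "f \<in> hull_polys (body K)" "g \<in> hull_polys (body K)"
  then show "grad (\<lambda>x. c *\<^sub>R f x + g x) = (\<lambda>x. c *\<^sub>R grad f x + grad g x)"
    using grad_lincomb[of g f c]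
    by (simp add: hull_polys_body_iff real_polynomial_function_eq add.commute fun_eq_iff)
qed (simp add: hull_polys_body_iff polynomial_function_grad real_polynomial_function_eq)

lemma G_cell_subset_vec_polys: "G_cell l (body K) \<subseteq> vec_polys l (body K)"
  by (auto simp: G_cell_def polys_def restr_hull_body vec_polys_body_iff intro!: poly_deg_le_grad)

text \<open>From a vector potential \<open>w\<close> its projection onto the gradients is
  subtracted, which does not change the curl. Hence the first equation of \<open>P_curl\<close>,
  although restricted to fields orthogonal to gradients, fixes the moments against all of
  R^k.\<close>

lemma R_cell_eq_curl_G_cell_perp:
  assumes "z \<in> R_cell k (body K)"
  obtains w where "w \<in> G_cell_perp (k + 1) (body K)" "z = curl w"
proof -
  interpret T: polynomial_integral "body K" "int_cell (body K)" by (rule polynomial_integral_body)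
  let ?G = "G_cell (k + 1) (body K)" and ?V = "vec_polys (k + 1) (body K)"
  obtain w where w: "w \<in> ?V" "z = curl w" using assms by (auto simp: R_cell_def)
  have w_poly: "poly_on (body K) w"
    using w(1) vec_polys_subset_hull_polys by (blast intro: poly_on_hull_polys)
  obtain g where g: "g \<in> ?G" "\<forall>h\<in>?G. T.ip g h = T.ip w h"
    using T.projection_exists[OF G_cell_finitely_spanned w_poly] by blast
  have G_hull: "?G \<subseteq> hull_polys (body K)"
    using G_cell_subset_vec_polys vec_polys_subset_hull_polys by blast
  let ?w = "\<lambda>x. w x - g x"
  have "?w \<in> ?V"
    using w(1) g(1) G_cell_subset_vec_polys by (intro fun_subspace_diff fun_subspace_vec_polys) auto
  moreover have "T.ip ?w h = 0" if "h \<in> ?G" for h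
  proof -
    have "T.ip ?w h = T.ip w h - T.ip g h"
      using g(1) that G_hull by (intro T.ip_diff w_poly poly_on_hull_polys) auto
    then show ?thesis using g(2) that by simp
  qed
  ultimately have perp: "?w \<in> G_cell_perp (k + 1) (body K)"
    by (simp add: G_cell_perp_def orth_complement_in_def)
  obtain p where p: "g = grad p" "real_polynomial_function p"
    using g(1) poly_deg_le_polynomial by (auto simp: G_cell_def polys_def restr_hull_body)
  have "curl ?w x = z x" for x
    using curl_lincomb[of w g "-1" x] vec_polys_body_polynomial[OF w(1)] polynomial_function_grad[OF p(2)]
      curl_grad[OF p(2), of x] by (simp add: p(1) w(2))
  then have "z = curl ?w" by auto
  with perp show ?thesis by (rule that)
qed

end

section \<open>The operators on the interpolate of a polynomial field\<close>

locale polynomial_interpolant = polyhedron +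
  fixes k :: int and v :: "real^3 \<Rightarrow> real^3"
  assumes k: "0 \<le> k" and v: "v \<in> vec_polys k (body K)"
begin

abbreviation u :: curl_element where "u \<equiv> I_curl k K v"

lemma v_deg: "poly_deg_le k (\<lambda>x. v x $ i)"
  using v by (simp add: vec_polys_body_iff)

lemma v_poly: "polynomial_function v"
  by (rule vec_polys_body_polynomial[OF v])

text \<open>The natural degree k - 1 is raised to k, the degree of the spaces containing
  \<open>C_face\<close> and \<open>C_full\<close>.\<close>

lemma curl_deg: "poly_deg_le k (\<lambda>x. curl v x $ i)"
proof -
  have "poly_deg_le (k - 1) (\<lambda>x. curl v x $ i)" using v_deg by (intro poly_deg_le_curl) simp
  then show ?thesis by (rule poly_deg_le_mono) simp
qed

lemma vedge_interpolant:
  assumes E: "E \<in> edges K"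
  shows "vedge u E = restr_hull E (\<lambda>x. v x \<bullet> tng K E)"
proof -
  interpret E: polynomial_integral E "int_edge E" by (rule polynomial_integral_edge[OF E])
  have "L2_proj (int_edge E) (polys k E) (\<lambda>x. v x \<bullet> tng K E) = restr_hull E (\<lambda>x. v x \<bullet> tng K E)"
    by (intro E.L2_proj_eqI fun_subspace_polys polys_subset_hull_polys polysI poly_deg_le_inner_const v_deg E.cong)
      (simp add: restr_hull_on)
  then show ?thesis by (simp add: I_curl_def)
qed

context
  fixes F assumes F: "F \<in> faces K"
begin

abbreviation n where "n \<equiv> nrm K F"
abbreviation v_tan where "v_tan \<equiv> tangential_part n v"

interpretation F: polynomial_integral F "int_face F" by (rule polynomial_integral_face[OF F])

lemma tangential_part_eq: "v_tan x = v x - (v x \<bullet> n) *\<^sub>R n"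
  using norm_nrm[OF F] by (simp add: tangential_part_def Lagrange norm_eq_1 inner_commute)

lemma tangential_part_inner: "w \<bullet> n = 0 \<Longrightarrow> v_tan x \<bullet> w = v x \<bullet> w"
  by (simp add: tangential_part_eq inner_diff_left inner_commute[of n w])

lemma tangential_part_in_tan_polys: "restr_hull F v_tan \<in> tan_polys k F n"
proof -
  have "poly_deg_le k (\<lambda>x. v_tan x $ i)" for i
  proof -
    have "poly_deg_le k (\<lambda>x. v x $ i - n $ i * (v x \<bullet> n))"
      by (intro poly_deg_le_diff poly_deg_le_cmult poly_deg_le_inner_const v_deg)
    then show ?thesis by (simp add: tangential_part_eq mult.commute)
  qed
  then have "restr_hull F v_tan \<in> vec_polys k F" by (rule vec_polysI)
  moreover have "restr_hull F v_tan x \<bullet> n = 0" for x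
    by (simp add: restr_hull_def tangential_part_def dot_cross_self)
  ultimately show ?thesis by (simp add: tan_polys_def)
qed

lemma R_face_mono: "R_face (k - 1) F n \<subseteq> R_face k F n"
  unfolding R_face_def by (intro image_mono polys_mono) simp

text \<open>\<open>v_tan\<close> is not cut off outside the plane of the face; its representative
  \<open>restr_hull F v_tan\<close> plays the role of \<open>f0\<close>.\<close>

lemmas face_decomposition = F.L2_proj_decomposition[OF fun_subspace_tan_polys tan_polys_subset_hull_polys
    R_face_finitely_spanned[OF F, of k] R_face_subset_tan_polys[OF F]
    R_face_finitely_spanned[OF F, of "k - 1"] R_face_mono tangential_part_in_tan_polys,
    of v_tan, OF restr_hull_on[symmetric], folded R_face_perp_def]

lemma v_R_face_moments:
  assumes "h \<in> R_face (k - 1) F n"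
  shows "F.ip (v_R_face k K u F) h = F.ip v_tan h"
  using face_decomposition(3)[OF _ assms] face_decomposition(5)
  by (simp add: v_R_face_def I_curl_def)

lemma v_R_perp_face_moments:
  assumes "h \<in> R_face_perp k F n"
  shows "F.ip (v_R_perp_face k K u F) h = F.ip v_tan h"
  using face_decomposition(4)[OF _ assms] face_decomposition(6)
  by (simp add: v_R_perp_face_def I_curl_def)

text \<open>The edges are not contained in the open face but lie in its plane, where
  \<open>restr_hull F p\<close> still takes the values of \<open>p\<close>.\<close>

lemma edge_terms:
  "(\<Sum>E\<in>edges_of K F. omega_FE K F E * int_edge E (\<lambda>x. vedge u E x * restr_hull F p x))
    = (\<Sum>E\<in>edges_of K F. omega_FE K F E * int_edge E (\<lambda>x. (v x \<bullet> tng K E) * p x))"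
proof (intro sum.cong refl arg_cong2[of _ _ _ _ "(*)"])
  fix E assume E: "E \<in> edges_of K F"
  interpret E: polynomial_integral E "int_edge E" by (rule polynomial_integral_edge[OF edges_of(1)[OF E]])
  show "int_edge E (\<lambda>x. vedge u E x * restr_hull F p x) = int_edge E (\<lambda>x. (v x \<bullet> tng K E) * p x)"
  proof (rule E.cong)
    fix x assume "x \<in> E"
    moreover from this have "x \<in> affine hull F"
      using closure_edge_subset_hull[OF F E] closure_subset by blast
    ultimately show "vedge u E x * restr_hull F p x = (v x \<bullet> tng K E) * p x"
      using vedge_interpolant[OF edges_of(1)[OF E]] by (simp add: restr_hull_on) (simp add: restr_hull_def)
  qed
qed

lemma stokes_interpolant:
  assumes p: "real_polynomial_function p"
  shows "int_face F (\<lambda>x. v_tan x \<bullet> rot_face F n (restr_hull F p) x)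
    = int_face F (\<lambda>x. restr_hull F (\<lambda>x. curl v x \<bullet> n) x * restr_hull F p x)
      + (\<Sum>E\<in>edges_of K F. omega_FE K F E * int_edge E (\<lambda>x. vedge u E x * restr_hull F p x))"
proof -
  have "int_face F (\<lambda>x. v_tan x \<bullet> rot_face F n (restr_hull F p) x)
      = int_face F (\<lambda>x. v x \<bullet> cross3 (grad p x) n)"
    by (rule F.cong) (simp add: rot_face_restr_hull[OF F p] restr_hull_on tangential_part_inner dot_cross_self)
  also have "\<dots> = int_face F (\<lambda>x. (curl v x \<bullet> n) * p x)
      + (\<Sum>E\<in>edges_of K F. omega_FE K F E * int_edge E (\<lambda>x. (v x \<bullet> tng K E) * p x))"
    by (rule stokes_face_rot[OF F p v_poly])
  also have "int_face F (\<lambda>x. (curl v x \<bullet> n) * p x)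
      = int_face F (\<lambda>x. restr_hull F (\<lambda>x. curl v x \<bullet> n) x * restr_hull F p x)"
    by (rule F.cong) (simp add: restr_hull_on)
  finally show ?thesis by (simp only: edge_terms)
qed

text \<open>A test function of degree k has its rot in R^(k-1), where \<open>v_R_face\<close> has
  the moments of \<open>v_tan\<close>. The definition then becomes Stokes' formula for
  \<open>v\<close>.\<close>

lemma C_face_interpolant: "C_face k K u F = restr_hull F (\<lambda>x. curl v x \<bullet> n)"
  unfolding C_face_def
proof (rule the_equality)
  let ?c = "restr_hull F (\<lambda>x. curl v x \<bullet> n)"
  let ?rhs = "\<lambda>r. F.ip (v_R_face k K u F) (rot_face F n r)
      - (\<Sum>E\<in>edges_of K F. omega_FE K F E * int_edge E (\<lambda>x. vedge u E x * r x))"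
  have c: "?c \<in> polys k F" by (intro polysI poly_deg_le_inner_const curl_deg)
  have c_moments: "int_face F (\<lambda>x. ?c x * r x) = ?rhs r" if r: "r \<in> polys k F" for r
  proof -
    obtain p where p: "r = restr_hull F p" "real_polynomial_function p" using r by (rule polysE)
    have "rot_face F n r \<in> R_face (k - 1) F n" using r by (auto simp: R_face_def)
    then show ?thesis
      using v_R_face_moments[of "rot_face F n r"] stokes_interpolant[OF p(2)] by (simp add: p(1))
  qed
  let ?C = "\<lambda>q. q \<in> polys k F \<and> (\<forall>r\<in>polys k F. int_face F (\<lambda>x. q x * r x) = ?rhs r)"
  show "?C ?c" using c c_moments by blast
  fix q assume q: "?C q"
  show "q = ?c"
    by (rule F.ip_eqI[OF fun_subspace_polys polys_subset_hull_polys _ c]) (use q c_moments in auto)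
qed

text \<open>With the face curl identified, Stokes' formula holds for test functions of degree k + 1,
  whose rots fill R^k. The second condition supplies the moments against the complement, and
  \<open>eq_by_moments\<close> applies.\<close>

lemma gamma_t_interpolant: "gamma_t k K u F = restr_hull F v_tan"
  unfolding gamma_t_def
proof (rule the_equality)
  let ?g = "restr_hull F v_tan" and ?V = "tan_polys k F n"
  let ?rhs = "\<lambda>r. int_face F (\<lambda>x. C_face k K u F x * r x)
      + (\<Sum>E\<in>edges_of K F. omega_FE K F E * int_edge E (\<lambda>x. vedge u E x * r x))"
  have g_ip: "F.ip ?g w = F.ip v_tan w" for w
    by (rule F.cong) (simp add: restr_hull_on)
  have g_rot: "F.ip ?g (rot_face F n r) = ?rhs r" if r: "r \<in> polys (k + 1) F" for r
  proof -
    obtain p where p: "r = restr_hull F p" "real_polynomial_function p" using r by (rule polysE)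
    show ?thesis unfolding g_ip p(1) C_face_interpolant by (rule stokes_interpolant[OF p(2)])
  qed
  have g_perp: "F.ip ?g w = F.ip (v_R_perp_face k K u F) w"
    if "w \<in> R_face_perp k F n" for w
    using v_R_perp_face_moments[OF that] g_ip by simp
  let ?C = "\<lambda>h. h \<in> ?V \<and> (\<forall>r\<in>polys0_face (k + 1) F. F.ip h (rot_face F n r) = ?rhs r) \<and>
      (\<forall>w\<in>R_face_perp k F n. F.ip h w = F.ip (v_R_perp_face k K u F) w)"
  show "?C ?g"
    using tangential_part_in_tan_polys g_rot g_perp by (auto simp: polys0_face_def)
  fix h assume h: "?C h"
  show "h = ?g"
  proof (rule F.eq_by_moments[OF fun_subspace_tan_polys tan_polys_subset_hull_polys])
    show "R_face k F n \<subseteq> hull_polys F"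
      using R_face_subset_tan_polys[OF F] tan_polys_subset_hull_polys by blast
    fix z assume "z \<in> R_face k F n"
    then obtain r where r: "r \<in> polys (k + 1) F" "z = rot_face F n r" by (auto simp: R_face_def)
    obtain p where p: "r = restr_hull F p" "poly_deg_le (k + 1) p" "real_polynomial_function p"
      using r(1) by (rule polysE)
    text \<open>Subtracting the average does not change the rotational.\<close>
    define c where "c = int_face F p / int_face F (\<lambda>x. 1)"
    \<comment> \<open>The area is nonzero by definiteness, as the constant 1 does not vanish on the
      hull.\<close>
    have pos: "int_face F (\<lambda>x. 1) \<noteq> 0"
    proof
      assume "int_face F (\<lambda>x. 1) = 0"
      moreover have "F \<noteq> {}" using polytopal_domain_aff_dim[OF face[OF F]] by auto
      then obtain x where "x \<in> affine hull F" by (metis all_not_in_conv hull_inc)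
      ultimately show False
        using F.definite[OF real_polynomial_function_constI[of 1], of x] by simp
    qed
    let ?p = "\<lambda>x. p x + (- c) * 1"
    have p': "real_polynomial_function ?p" "poly_deg_le (k + 1) ?p"
      using real_polynomial_function_addI[OF p(3) real_polynomial_function_constI[of "- c"]]
        poly_deg_le_lincomb[OF p(2) poly_deg_le_const, of "- c" 1] k by auto
    have "int_face F (restr_hull F ?p) = int_face F ?p" by (rule F.cong) (simp add: restr_hull_on)
    also have "\<dots> = 0"
      using F.lincomb[OF p(3) real_polynomial_function_constI, of "- c" 1] pos by (simp add: c_def)
    finally have "restr_hull F ?p \<in> polys0_face (k + 1) F"
      using p'(2) by (simp add: polys0_face_def polysI)
    moreover have "rot_face F n (restr_hull F ?p) = z"
      using grad_lincomb[OF p(3) real_polynomial_function_constI, of "- c" 1]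
      by (simp only: r(2) p(1) rot_face_restr_hull[OF F p'(1)] rot_face_restr_hull[OF F p(3)]) (simp add: grad_const)
    ultimately have "F.ip h z = ?rhs (restr_hull F ?p)"
        "F.ip ?g z = ?rhs (restr_hull F ?p)"
      using h g_rot[of "restr_hull F ?p"] by (auto simp: polys0_face_def)
    then show "F.ip h z = F.ip ?g z" by simp
  next
    fix w assume "w \<in> orth_complement_in (int_face F) ?V (R_face k F n)"
    then have "w \<in> R_face_perp k F n" by (simp add: R_face_perp_def)
    then show "F.ip h w = F.ip ?g w"
      using h g_perp by simp
  qed (use h tangential_part_in_tan_polys in auto)
qed

text \<open>w x n is tangential, so it does not see the normal component missing from the
  trace.\<close>

lemma gamma_t_moments:
  "int_face F (\<lambda>x. gamma_t k K u F x \<bullet> cross3 (w x) n) = int_face F (\<lambda>x. v x \<bullet> cross3 (w x) n)"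
  unfolding gamma_t_interpolant
  by (rule F.cong) (simp add: restr_hull_on tangential_part_inner dot_cross_self)

end

interpretation T: polynomial_integral "body K" "int_cell (body K)" by (rule polynomial_integral_body)

lemma R_cell_mono: "R_cell (k - 1) (body K) \<subseteq> R_cell k (body K)"
  unfolding R_cell_def by (intro image_mono vec_polys_mono) simp

lemmas cell_decomposition = T.L2_proj_decomposition[OF fun_subspace_vec_polys vec_polys_subset_hull_polys
    R_cell_finitely_spanned[of k] R_cell_subset_vec_polys
    R_cell_finitely_spanned[of "k - 1"] R_cell_mono v refl, folded R_cell_perp_def]

lemma v_R_perp_cell_moments:
  assumes "w \<in> R_cell_perp k (body K)"
  shows "T.ip (v_R_perp_cell k K u) w = T.ip v w"
  using cell_decomposition(4)[OF assms] cell_decomposition(6)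
  by (simp add: v_R_perp_cell_def I_curl_def)

text \<open>The component in the complement is orthogonal to R^k, hence to R^(k-1), and drops out.
  \<open>C_full\<close> tests the whole cell component, not one summand.\<close>

lemma vcell_moments:
  assumes z: "z \<in> R_cell (k - 1) (body K)"
  shows "T.ip (vcell u) z = T.ip v z"
proof -
  let ?a = "L2_proj (int_cell (body K)) (R_cell (k - 1) (body K)) v"
  let ?b = "L2_proj (int_cell (body K)) (R_cell_perp k (body K)) v"
  have R_hull: "R_cell l (body K) \<subseteq> hull_polys (body K)" for l
    using R_cell_subset_vec_polys vec_polys_subset_hull_polys by blast
  have b: "?b \<in> R_cell_perp k (body K)" by (rule cell_decomposition(2))
  then have "?b \<in> hull_polys (body K)"
    using vec_polys_subset_hull_polys by (auto simp: R_cell_perp_def orth_complement_in_def)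
  then have "T.ip (\<lambda>x. ?a x + ?b x) z = T.ip ?a z + T.ip ?b z"
    using cell_decomposition(1) z R_hull by (intro T.ip_add poly_on_hull_polys) auto
  moreover have "T.ip ?b z = 0"
  proof (rule orth_complementD(2))
    show "?b \<in> orth_complement_in (int_cell (body K)) (vec_polys k (body K)) (R_cell k (body K))"
      using b by (simp only: R_cell_perp_def)
  qed (use z R_cell_mono in auto)
  ultimately show ?thesis using cell_decomposition(3)[OF z] by (simp add: I_curl_def)
qed

text \<open>Fields of degree k have their curl in R^(k-1), so \<open>vcell u\<close> may be replaced
  by \<open>v\<close>; with the traces identified, the definition is Stokes' formula on the
  cell.\<close>

lemma C_full_interpolant: "C_full k K u = curl v"
  unfolding C_full_def
proof (rule the_equality)
  let ?V = "vec_polys k (body K)"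
  let ?rhs = "\<lambda>w. T.ip (vcell u) (curl w)
        + (\<Sum>F\<in>faces K. omega_TF K F * int_face F (\<lambda>x. gamma_t k K u F x \<bullet> cross3 (w x) (nrm K F)))"
  have c: "curl v \<in> ?V" using curl_deg by (simp add: vec_polys_body_iff)
  have moments: "T.ip (curl v) w = ?rhs w" if w: "w \<in> ?V" for w
  proof -
    have "curl w \<in> R_cell (k - 1) (body K)" using w by (simp add: R_cell_def)
    then show ?thesis
      using stokes_cell[OF v_poly vec_polys_body_polynomial[OF w]]
      by (simp add: vcell_moments gamma_t_moments)
  qed
  show "curl v \<in> ?V \<and> (\<forall>w\<in>?V. T.ip (curl v) w = ?rhs w)" using c moments by blast
  fix q assume q: "q \<in> ?V \<and> (\<forall>w\<in>?V. T.ip q w = ?rhs w)"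
  show "q = curl v"
    by (rule T.ip_eqI[OF fun_subspace_vec_polys vec_polys_subset_hull_polys _ c]) (use q moments in auto)
qed

text \<open>The test fields now have degree k + 1, beyond the reach of the moments of
  \<open>vcell u\<close> against R^(k-1), but the right-hand side contains only
  \<open>C_full\<close> and the traces, both exact. Stokes' formula turns it into the moments of
  \<open>v\<close>.\<close>

lemma P_curl_interpolant: "P_curl k K u = v"
  unfolding P_curl_def
proof (rule the_equality)
  let ?V = "vec_polys k (body K)"
  let ?rhs = "\<lambda>w. T.ip (C_full k K u) w
        - (\<Sum>F\<in>faces K. omega_TF K F * int_face F (\<lambda>x. gamma_t k K u F x \<bullet> cross3 (w x) (nrm K F)))"
  have moments: "T.ip v (curl w) = ?rhs w"
    if w: "w \<in> G_cell_perp (k + 1) (body K)" for w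
  proof -
    have "w \<in> vec_polys (k + 1) (body K)"
      using w by (simp add: G_cell_perp_def orth_complement_in_def)
    then show ?thesis
      using stokes_cell[OF v_poly vec_polys_body_polynomial]
      by (simp add: C_full_interpolant gamma_t_moments)
  qed
  note perp_moments = v_R_perp_cell_moments[symmetric]
  let ?C = "\<lambda>p. p \<in> ?V \<and> (\<forall>w\<in>G_cell_perp (k + 1) (body K). T.ip p (curl w) = ?rhs w) \<and>
      (\<forall>w\<in>R_cell_perp k (body K). T.ip p w = T.ip (v_R_perp_cell k K u) w)"
  show "?C v"
    using v moments perp_moments by blast
  fix p assume p: "?C p"
  show "p = v"
  proof (rule T.eq_by_moments[OF fun_subspace_vec_polys vec_polys_subset_hull_polys])
    show "R_cell k (body K) \<subseteq> hull_polys (body K)"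
      using R_cell_subset_vec_polys vec_polys_subset_hull_polys by blast
    fix z assume "z \<in> R_cell k (body K)"
    \<comment> \<open>Every element of R^k is the curl of an admissible test field, so the first
      equation compares p and v on all of R^k.\<close>
    then obtain w where "w \<in> G_cell_perp (k + 1) (body K)" "z = curl w" by (rule R_cell_eq_curl_G_cell_perp)
    then show "T.ip p z = T.ip v z"
      using p moments by simp
  next
    fix w assume "w \<in> orth_complement_in (int_cell (body K)) ?V (R_cell k (body K))"
    then have "w \<in> R_cell_perp k (body K)" by (simp add: R_cell_perp_def)
    then show "T.ip p w = T.ip v w"
      using p perp_moments by simp
  qed (use p v in auto)
qed

end

theorem proposition27:
  fixes k :: int and K :: polyhedral_cell and v :: "real^3 \<Rightarrow> real^3"
  assumes "k \<ge> 0"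
    and "polyhedron_with_faces K"
    and "v \<in> vec_polys k (body K)"
  shows "P_curl k K (I_curl k K v) = v"
proof -
  interpret polynomial_interpolant K k v
    by unfold_locales (use assms in auto)
  show ?thesis by (rule P_curl_interpolant)
qed

end
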